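(* For every $n=1,2,3,\ldots$, and up to the natural action of the symmetric group $S_{n+1}$ (by simultaneous conjugation), there are precisely three algorithms (Iterated Function Systems $\{A_0,A_1\}$) that split the unit $n$-dimensional simplex $\Delta$ in two and are contractive. They are the following. (1) The Mönkemeyer algorithm, induced by $(M_0,M_1)$; this is the only one of the three cases in which the associated Gauss-type map $G$ is continuous. If $n$ is odd, $G$ is orientation-preserving on $\Delta_0$ and orientation-reversing on $\Delta_1$; this behavior is reversed for even $n$, and is also reversed by replacing $(M_0,M_1)$ with the equivalent pair $(FM_1F^{-1},FM_0F^{-1})$. (2) The algorithm induced by $(M_0,M_1F)$, whose map $G$ is orientation-preserving for odd $n$ and orientation-reversing for even $n$. (3) The algorithm induced by $(M_0F,M_1)$, whose map $G$ is orientation-reversing for odd $n$ and orientation-preserving for even $n$.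
   Context: Let $n\ge 1$ and let $\Delta=\{x\in\mathbb{R}_{\ge0}^{n+1}:\sum x_i=1\}$ be the standard $n$-dimensional simplex, with vertices the standard basis vectors $e_0,\ldots,e_n$; rows and columns of $(n+1)\times(n+1)$ matrices are numbered from $0$ to $n$. Let $\Sigma$ be the monoid of all matrices in $\mathrm{GL}_{n+1}(\mathbb{Z})$ with nonnegative entries; its group of invertible elements is the group $S_{n+1}$ of permutation matrices. Each $A\in\Sigma$ is identified with the continuous map $\Delta\to\Delta$, $A(x)=Ax/\|Ax\|_1$. An algorithm (Iterated Function System, IFS) on two symbols is a set $\{A_0,A_1\}\subset\Sigma$ of two matrices, neither of which is a permutation matrix; write $\Delta_0=A_0[\Delta]$ and $\Delta_1=A_1[\Delta]$. It splits $\Delta$ in two (is simplex-splitting) if $\Delta=\Delta_0\cup\Delta_1$ and the interiors of $\Delta_0$ and $\Delta_1$ do not intersect. It is (topologically) contractive if for every infinite sequence $a_0a_1a_2\ldots\in\{0,1\}^{\omega}$ the intersection $\bigcap_{t\ge0}A_{a_0}A_{a_1}\cdots A_{a_{t-1}}[\Delta]$ is a singleton. Permutation matrices $P$ act on IFS by conjugation, $\{A_0,A_1\}\mapsto\{PA_0P^{-1},PA_1P^{-1}\}$ (the labelling of the two maps by $0$ and $1$ being immaterial for equivalence); two IFS are equivalent if they are in the same orbit. The Gauss-type map $G:\Delta\to\Delta$ of a simplex-splitting pair $(A_0,A_1)$ is $G(x)=A_{a(x)}^{-1}(x)$, where $a(x)\in\{0,1\}$ is the least index $a$ with $x\in\Delta_a$.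 $G$ is called orientation-preserving (respectively, orientation-reversing) on $\Delta_a$ if the matrix $A_a^{-1}$ defining this branch has positive (respectively, negative) determinant, and orientation-preserving (respectively, orientation-reversing) if it is so on both $\Delta_0$ and $\Delta_1$. Elementary matrices, all of size $(n+1)\times(n+1)$, with $I$ the identity: $N$ is obtained from $I$ by summing the first column to the second (so $Ne_1=e_0+e_1$ and $Ne_i=e_i$ for $i\ne1$); $F$ is obtained from $I$ by exchanging the first two columns; $R$ is obtained from $I$ by shifting cyclically each column to the previous one, while moving the first to the last (so $Re_i=e_{i+1}$ for $i<n$ and $Re_n=e_0$); $L=FNF$. Finally $M_0=NFR$ and $M_1=LR$. *)

theory Defs
  imports
    "HOL-Homology.Simplices"
    "HOL-Combinatorics.Permutations"
    "Jordan_Normal_Form.Determinant"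
begin

text \<open>
  Matrices are those of \<open>Jordan_Normal_Form\<close>, with rows and columns numbered from 0. A point of
  real (n+1)-space is a function \<open>nat \<Rightarrow> real\<close> vanishing beyond \<open>n\<close>, and the simplex is the library's
  \<open>standard_simplex n\<close>; the product topology on \<open>nat \<Rightarrow> real\<close> induces the usual topology on it.
\<close>

abbreviation mat_ring :: "nat \<Rightarrow> int mat ring" where
  "mat_ring n \<equiv> ring_mat TYPE(int) (n + 1) ()"

definition Sigma_mats :: "nat \<Rightarrow> int mat set" where
  "Sigma_mats n = {A \<in> Units (mat_ring n). \<forall>i\<le>n. \<forall>j\<le>n. 0 \<le> A $$ (i, j)}"

text \<open>Column \<open>j\<close> of \<open>perm_mat n p\<close> is the basis vector with index \<open>p j\<close>.\<close>

definition perm_mat :: "nat \<Rightarrow> (nat \<Rightarrow> nat) \<Rightarrow> int mat" where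
  "perm_mat n p = Matrix.mat (n + 1) (n + 1) (\<lambda>(i, j). if i = p j then 1 else 0)"

definition perm_mats :: "nat \<Rightarrow> int mat set" where
  "perm_mats n = perm_mat n ` {p. p permutes {0..n}}"

definition lin_act :: "int mat \<Rightarrow> (nat \<Rightarrow> real) \<Rightarrow> nat \<Rightarrow> real" where
  "lin_act A x = (\<lambda>i. if i < dim_row A then \<Sum>j<dim_col A. real_of_int (A $$ (i, j)) * x j else 0)"

definition proj_act :: "int mat \<Rightarrow> (nat \<Rightarrow> real) \<Rightarrow> nat \<Rightarrow> real" where
  "proj_act A x = (\<lambda>i. lin_act A x i / (\<Sum>k<dim_row A. \<bar>lin_act A x k\<bar>))"

definition is_ifs :: "nat \<Rightarrow> int mat \<Rightarrow> int mat \<Rightarrow> bool" where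
  "is_ifs n A0 A1 \<longleftrightarrow>
     A0 \<in> Sigma_mats n \<and> A1 \<in> Sigma_mats n \<and> A0 \<noteq> A1 \<and>
     A0 \<notin> perm_mats n \<and> A1 \<notin> perm_mats n"

text \<open>Interiors are taken in the topological space \<open>standard_simplex n\<close>.\<close>

definition simplex_splitting :: "nat \<Rightarrow> int mat \<Rightarrow> int mat \<Rightarrow> bool" where
  "simplex_splitting n A0 A1 \<longleftrightarrow>
     standard_simplex n = proj_act A0 ` standard_simplex n \<union> proj_act A1 ` standard_simplex n \<and>
     (top_of_set (standard_simplex n) interior_of (proj_act A0 ` standard_simplex n)) \<inter>
     (top_of_set (standard_simplex n) interior_of (proj_act A1 ` standard_simplex n)) = {}"

definition branch_mat :: "int mat \<Rightarrow> int mat \<Rightarrow> nat \<Rightarrow> int mat" where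
  "branch_mat A0 A1 a = (if a = 0 then A0 else A1)"

primrec word_mat :: "nat \<Rightarrow> int mat \<Rightarrow> int mat \<Rightarrow> (nat \<Rightarrow> nat) \<Rightarrow> nat \<Rightarrow> int mat" where
  "word_mat n A0 A1 a 0 = 1\<^sub>m (n + 1)"
| "word_mat n A0 A1 a (Suc t) = word_mat n A0 A1 a t * branch_mat A0 A1 (a t)"

definition contractive :: "nat \<Rightarrow> int mat \<Rightarrow> int mat \<Rightarrow> bool" where
  "contractive n A0 A1 \<longleftrightarrow>
     (\<forall>a. range a \<subseteq> {0, 1} \<longrightarrow>
        (\<exists>x. (\<Inter>t. proj_act (word_mat n A0 A1 a t) ` standard_simplex n) = {x}))"

definition contractive_splitting_ifs :: "nat \<Rightarrow> int mat set set" where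
  "contractive_splitting_ifs n =
     {{A0, A1} | A0 A1. is_ifs n A0 A1 \<and> simplex_splitting n A0 A1 \<and> contractive n A0 A1}"

definition conj_mat :: "nat \<Rightarrow> int mat \<Rightarrow> int mat \<Rightarrow> int mat" where
  "conj_mat n P A = P * A * inv\<^bsub>mat_ring n\<^esub> P"

definition ifs_orbit :: "nat \<Rightarrow> int mat set \<Rightarrow> int mat set set" where
  "ifs_orbit n S = (\<lambda>P. conj_mat n P ` S) ` perm_mats n"

definition gauss_index :: "nat \<Rightarrow> int mat \<Rightarrow> int mat \<Rightarrow> (nat \<Rightarrow> real) \<Rightarrow> nat" where
  "gauss_index n A0 A1 x =
     (LEAST a. a \<in> {0, 1} \<and> x \<in> proj_act (branch_mat A0 A1 a) ` standard_simplex n)"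

definition gauss_map :: "nat \<Rightarrow> int mat \<Rightarrow> int mat \<Rightarrow> (nat \<Rightarrow> real) \<Rightarrow> nat \<Rightarrow> real" where
  "gauss_map n A0 A1 x =
     proj_act (inv\<^bsub>mat_ring n\<^esub> (branch_mat A0 A1 (gauss_index n A0 A1 x))) x"

definition orientation_preserving_on :: "nat \<Rightarrow> int mat \<Rightarrow> int mat \<Rightarrow> nat \<Rightarrow> bool" where
  "orientation_preserving_on n A0 A1 a \<longleftrightarrow>
     0 < Determinant.det (inv\<^bsub>mat_ring n\<^esub> (branch_mat A0 A1 a))"

definition orientation_reversing_on :: "nat \<Rightarrow> int mat \<Rightarrow> int mat \<Rightarrow> nat \<Rightarrow> bool" where
  "orientation_reversing_on n A0 A1 a \<longleftrightarrow>
     Determinant.det (inv\<^bsub>mat_ring n\<^esub> (branch_mat A0 A1 a)) < 0"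

definition orientation_preserving :: "nat \<Rightarrow> int mat \<Rightarrow> int mat \<Rightarrow> bool" where
  "orientation_preserving n A0 A1 \<longleftrightarrow> (\<forall>a\<in>{0, 1}. orientation_preserving_on n A0 A1 a)"

definition orientation_reversing :: "nat \<Rightarrow> int mat \<Rightarrow> int mat \<Rightarrow> bool" where
  "orientation_reversing n A0 A1 \<longleftrightarrow> (\<forall>a\<in>{0, 1}. orientation_reversing_on n A0 A1 a)"

definition N_mat :: "nat \<Rightarrow> int mat" where
  "N_mat n = Matrix.mat (n + 1) (n + 1) (\<lambda>(i, j). if i = j \<or> i = 0 \<and> j = 1 then 1 else 0)"

definition F_mat :: "nat \<Rightarrow> int mat" where
  "F_mat n = perm_mat n (\<lambda>j. if j = 0 then 1 else if j = 1 then 0 else j)"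

definition R_mat :: "nat \<Rightarrow> int mat" where
  "R_mat n = perm_mat n (\<lambda>j. if j < n then j + 1 else 0)"

definition L_mat :: "nat \<Rightarrow> int mat" where
  "L_mat n = F_mat n * N_mat n * F_mat n"

definition M0 :: "nat \<Rightarrow> int mat" where
  "M0 n = N_mat n * F_mat n * R_mat n"

definition M1 :: "nat \<Rightarrow> int mat" where
  "M1 n = L_mat n * R_mat n"

end

(*
  A word in the two matrices acts on a simplex by splitting the edge between its two active columns,
  keeping one of them, and permuting the columns.

  Necessity. Covering the vertices and two points of an edge forces the two matrices to have the columns
  e_k and e_i + e_j, up to order. By Koenig's lemma contractivity is uniform in the word. Hence no column
  can avoid the active positions forever, so that the inactive positions can be ordered such that
  columns move down. If a column that survives left the active positions, one could
  keep it alive and kill the lighter of two active columns again and again; the other columns would then grow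
  exponentially, while the survivor only enters them by unit amounts, against contractivity. The few
  exceptions are excluded by explicit words. What is left are two position maps for each label.

  Sufficiency. The four remaining pairs, two of which are conjugate, are all described by a queue: a survivor
  meets the head of the queue, one of them is kept, and their sum is appended. Since all masses start
  at 1, the queue stays sorted and its masses differ by at most the factor 2, and all
  elements of the queue soon have a common ancestor whose weight in them is bounded below.
*)
theory Submission
  imports Defs
begin

text \<open>A branch multiplies from the right, so it acts on every row of a word in the same way.
  It is therefore enough to follow one row functional at a time (\<open>gval\<close>). The
  coordinates of the normalised columns are quotients of such values, with the constant functional 1
  in the denominator. The obstacle to necessity is that a column surviving forever is in itself
  harmless: if one label is repeated, its vertex may come to dominate all other columns, and the
  cells still shrink to that vertex. A contradiction needs the mass of the other vertices to outgrow
  what the survivor contributes. That contribution is bounded by a sum over the earlier growth, so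
  exponential growth suffices. This is also why an inactive survivor matters: an active one dictates
  the label, an inactive one leaves it free. In sufficiency the factor 2 keeps the weight of the
  older parent at least 1/2 and, for at most \<open>n\<close> steps after a switch, that of the
  survivor at least 1/3. Runs that are longer, or never end, have to be treated separately.\<close>

section \<open>Contraction of the queue\<close>

text \<open>
  \<open>K t\<close> is the mass of the survivor at time \<open>t\<close> and \<open>Q t, \<dots>, Q (t + n - 1)\<close> the masses in the queue;
  \<open>KV\<close> and \<open>V\<close> are the values of a second linear functional on the same vectors. As all masses start
  at 1, the queue is always sorted and its masses differ by a factor of at most 2.
\<close>

locale queue =
  fixes n :: nat and sw :: "nat \<Rightarrow> bool" and K Q KV V :: "nat \<Rightarrow> real"
  assumes n: "n \<ge> 1"
    and K0: "K 0 = 1" and Q0: "\<And>t. t < n \<Longrightarrow> Q t = 1"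
    and K_Suc: "\<And>t. K (Suc t) = (if sw t then Q t else K t)"
    and Q_add: "\<And>t. Q (t + n) = Q t + K t"
    and KV_Suc: "\<And>t. KV (Suc t) = (if sw t then V t else KV t)"
    and V_add: "\<And>t. V (t + n) = V t + KV t"
begin

definition r :: "nat \<Rightarrow> real" where "r t = V t / Q t"
definition kr :: "nat \<Rightarrow> real" where "kr t = KV t / K t"

definition confined :: "nat \<Rightarrow> real \<Rightarrow> real \<Rightarrow> bool" where
  "confined t a D \<longleftrightarrow> kr t \<in> {a..a + D} \<and> (\<forall>j<n. r (t + j) \<in> {a..a + D})"

text \<open>The last clause drives the induction: it makes the appended sum \<open>Q t + K t\<close>
  at least as large as the last element, so the queue stays sorted. It persists because one summand
  is the next survivor and the other is at most the next head.\<close>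

lemma masses: "1 \<le> K t \<and> K t \<le> Q t \<and> (\<forall>j. Suc j < n \<longrightarrow> Q (t + j) \<le> Q (t + Suc j)) \<and> Q (t + (n - 1)) \<le> K t + Q t"
proof (induction t)
  case 0
  show ?case using n K0 Q0 by auto
next
  case (Suc t)
  have mono: "Q t \<le> Q (Suc t)"
  proof (cases "n = 1")
    case True
    then show ?thesis using Q_add[of t] Suc by auto
  next
    case False
    then have "Suc 0 < n" using n by simp
    then show ?thesis using Suc by (metis add_0_right add_Suc_right)
  qed
  have last: "Q (Suc t + (n - 1)) = Q t + K t"
    using Q_add[of t] n by simp
  have "Q (Suc t + j) \<le> Q (Suc t + Suc j)" if "Suc j < n" for j
  proof (cases "Suc (Suc j) < n")
    case True
    then show ?thesis using Suc by (metis add_Suc_right add_Suc)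
  next
    case False
    then have j: "n = Suc (Suc j)" using that by simp
    then show ?thesis using Suc last by (simp add: add.commute)
  qed
  moreover have "Q (Suc t + (n - 1)) \<le> K (Suc t) + Q (Suc t)"
    unfolding last K_Suc using mono Suc by auto
  ultimately show ?case using Suc mono K_Suc[of t] by auto
qed

lemma Q_mono1: "Q t \<le> Q (Suc t)"
proof (cases "n = 1")
  case True
  then show ?thesis using Q_add[of t] masses[of t] by auto
next
  case False
  then have "Suc 0 < n" using n by simp
  then show ?thesis using masses[of t] by (metis add_0_right add_Suc_right)
qed

lemma Q_mono: "s \<le> t \<Longrightarrow> Q s \<le> Q t"
  using Q_mono1 by (rule lift_Suc_mono_le)

lemma K_pos: "K t \<ge> 1" and K_le: "K t \<le> Q t" and Q_pos: "Q t \<ge> 1"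
  using masses[of t] by auto

lemma Q_double: "Q (t + n) \<le> 2 * Q t"
  using Q_add[of t] K_le[of t] by simp

lemma r_add: "r (t + n) = (Q t / Q (t + n)) * r t + (K t / Q (t + n)) * kr t"
  using K_pos[of t] Q_pos[of t] by (simp add: r_def kr_def V_add add_divide_distrib[symmetric])

lemma weights: "Q t / Q (t + n) + K t / Q (t + n) = 1" "Q t / Q (t + n) \<ge> 1 / 2" "K t / Q (t + n) \<ge> 0"
  "Q t / Q (t + n) \<ge> 0"
proof -
  have "Q (t + n) > 0" using Q_pos[of "t + n"] by linarith
  then show "Q t / Q (t + n) + K t / Q (t + n) = 1" "Q t / Q (t + n) \<ge> 1 / 2" "K t / Q (t + n) \<ge> 0"
    "Q t / Q (t + n) \<ge> 0"
    using Q_add[of t] K_pos[of t] Q_double[of t] Q_pos[of t] by (simp_all add: add_divide_distrib[symmetric] field_simps)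
qed

lemma convex_mem:
  fixes a b x y p q :: real
  assumes "x \<in> {a..b}" "y \<in> {a..b}" "p + q = 1" "p \<ge> 0" "q \<ge> 0"
  shows "p * x + q * y \<in> {a..b}"
proof -
  have "p * a + q * a \<le> p * x + q * y" "p * x + q * y \<le> p * b + q * b"
    using assms by (auto intro!: add_mono mult_left_mono)
  then show ?thesis using assms(3) by (simp flip: distrib_right)
qed

text \<open>A third of the weight is reserved for \<open>y\<close>. The rest has weight 2/3, so all
  mixtures with the same \<open>y\<close> lie in one interval of length \<open>2 / 3 * D\<close>,
  whatever \<open>x\<close> and the weights are.\<close>

lemma convex_mem_third:
  fixes a D x y p q :: real
  assumes "x \<in> {a..a + D}" "y \<in> {a..a + D}" "p + q = 1" "p \<ge> 0" "q \<ge> 1 / 3"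
  shows "p * x + q * y \<in> {y / 3 + 2 / 3 * a..y / 3 + 2 / 3 * a + 2 / 3 * D}"
proof -
  have "p * a + (q - 1 / 3) * a \<le> p * x + (q - 1 / 3) * y"
    "p * x + (q - 1 / 3) * y \<le> p * (a + D) + (q - 1 / 3) * (a + D)"
    using assms by (auto intro!: add_mono mult_left_mono)
  moreover have "p * b + (q - 1 / 3) * b = 2 / 3 * b" for b
  proof -
    have "p * b + (q - 1 / 3) * b = (p + q) * b - b / 3" by (simp add: algebra_simps)
    then show ?thesis unfolding assms by simp
  qed
  moreover have "p * x + q * y = y / 3 + (p * x + (q - 1 / 3) * y)" by (simp add: algebra_simps)
  ultimately show ?thesis by auto
qed

lemma confined_Suc:
  assumes "confined t a D"
  shows "confined (Suc t) a D"
proof -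
  have "0 < n" using n by simp
  then have "r (t + 0) \<in> {a..a + D}" using assms unfolding confined_def by blast
  then have r0: "r t \<in> {a..a + D}" by simp
  have k: "kr t \<in> {a..a + D}" using assms by (simp add: confined_def)
  have k': "kr (Suc t) = (if sw t then r t else kr t)"
    by (simp add: kr_def r_def K_Suc KV_Suc)
  have "r (Suc t + j) \<in> {a..a + D}" if "j < n" for j
  proof (cases "Suc j < n")
    case True
    then show ?thesis using assms unfolding confined_def by (metis add_Suc_right add_Suc)
  next
    case False
    then have "Suc t + j = t + n" using that by simp
    then show ?thesis
      using r_add[of t] convex_mem[OF r0 k, of "Q t / Q (t + n)" "K t / Q (t + n)"] weights[of t]
      by auto
  qed
  then show ?thesis using k' r0 k by (auto simp: confined_def)
qed

lemma confined_mono: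
  assumes "confined s a D" "s \<le> t"
  shows "confined t a D"
  using assms(2,1) by (induction rule: dec_induct) (auto intro: confined_Suc)

lemma confined_later:
  assumes "confined s a D" "s \<le> t"
  shows "r t \<in> {a..a + D}" "kr t \<in> {a..a + D}"
proof -
  have c: "confined t a D" using confined_mono[OF assms] .
  have "0 < n" using n by simp
  then have "r (t + 0) \<in> {a..a + D}" using c unfolding confined_def by blast
  then show "r t \<in> {a..a + D}" by simp
  show "kr t \<in> {a..a + D}" using c by (simp add: confined_def)
qed

lemma K_run: "sw i \<Longrightarrow> (\<And>j. i < j \<Longrightarrow> j < t \<Longrightarrow> \<not> sw j) \<Longrightarrow> i < t \<Longrightarrow> K t = Q i \<and> KV t = V i"
proof (induction t)
  case (Suc t)
  show ?case
  proof (cases "t = i")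
    case True
    then show ?thesis using Suc by (simp add: K_Suc KV_Suc)
  next
    case False
    then have "i < t" using Suc by simp
    then show ?thesis using Suc by (simp add: K_Suc KV_Suc)
  qed
qed simp

lemma kr_run: "sw i \<Longrightarrow> (\<And>j. i < j \<Longrightarrow> j < t \<Longrightarrow> \<not> sw j) \<Longrightarrow> i < t \<Longrightarrow> kr t = r i"
  using K_run[of i t] by (simp add: kr_def r_def)

text \<open>During the run \<open>K t = Q i\<close>, and \<open>Q t <= Q (i + n) <= 2 * Q i\<close>.
  So the survivor makes up at least a third of \<open>Q t + K t\<close>.\<close>

lemma run_weight:
  assumes "sw i" "\<And>j. i < j \<Longrightarrow> j < t \<Longrightarrow> \<not> sw j" "i < t" "t \<le> i + n"
  shows "K t / Q (t + n) \<ge> 1 / 3"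
proof -
  have "K t = Q i" using K_run[OF assms(1-3)] by blast
  moreover have "Q t \<le> 2 * Q i" using Q_mono[OF assms(4)] Q_double[of i] by simp
  ultimately show ?thesis using Q_add[of t] Q_pos[of i] Q_pos[of t] by (simp add: field_simps)
qed

text \<open>One survivor meets \<open>n\<close> heads in succession, so the whole queue is replaced
  by mixtures that share this parent with weight at least 1/3.\<close>

lemma long_run_contracts:
  assumes c: "confined s a D" and s: "s \<le> i" "sw i" and run: "\<And>j. i < j \<Longrightarrow> j \<le> i + n \<Longrightarrow> \<not> sw j"
  shows "\<exists>a'. confined (i + n + 1) a' (2 / 3 * D)"
proof -
  let ?p = "r i"
  have p: "?p \<in> {a..a + D}" using confined_later[OF c s(1)] by simp
  have D: "D \<ge> 0" using p by simp
  let ?a = "?p / 3 + 2 / 3 * a"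
  have kr: "kr t = ?p" if "i < t" "t \<le> i + n + 1" for t
    using kr_run[of i t] s(2) run that by auto
  have "r (i + n + 1 + j) \<in> {?a..?a + 2 / 3 * D}" if "j < n" for j
  proof -
    let ?t = "i + 1 + j"
    let ?q = "Q ?t / Q (?t + n)" and ?k = "K ?t / Q (?t + n)"
    have k3: "?k \<ge> 1 / 3" using run_weight[of i ?t] s(2) run that by auto
    have w: "?q + ?k = 1" using weights[of ?t] by simp
    have x: "r ?t \<in> {a..a + D}" using confined_later[OF c, of ?t] s by simp
    have kt: "kr ?t = ?p" using kr[of ?t] that by simp
    have "i + n + 1 + j = ?t + n" by simp
    then have "r (i + n + 1 + j) = ?q * r ?t + ?k * ?p"
      using r_add[of ?t] kt by metis
    then show ?thesis using convex_mem_third[OF x p w weights(4) k3] by simp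
  qed
  moreover have "kr (i + n + 1) \<in> {?a..?a + 2 / 3 * D}" using kr[of "i + n + 1"] p n by (simp add: field_simps)
  ultimately show ?thesis unfolding confined_def by blast
qed

definition last_sw :: "nat \<Rightarrow> nat" where "last_sw t = Max {i. i < t \<and> sw i}"

lemma last_sw:
  assumes "sw s" "s < t"
  shows "sw (last_sw t)" "last_sw t < t" "s \<le> last_sw t" "\<And>j. last_sw t < j \<Longrightarrow> j < t \<Longrightarrow> \<not> sw j"
proof -
  have fin: "finite {i. i < t \<and> sw i}" by simp
  have "last_sw t \<in> {i. i < t \<and> sw i}"
    unfolding last_sw_def using assms by (intro Max_in) auto
  then show "sw (last_sw t)" "last_sw t < t" by auto
  show "s \<le> last_sw t" unfolding last_sw_def using assms by (intro Max_ge) auto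
  show "\<not> sw j" if "last_sw t < j" "j < t" for j
    using that Max_ge[OF fin, of j] unfolding last_sw_def by fastforce
qed

text \<open>
  The queue element \<open>t + n\<close> is a mixture of its parents \<open>t\<close> and \<open>last_sw t\<close>. Two elements at distance
  \<open>d > 0\<close> have a common parent or parents at a smaller distance.
\<close>

lemma short_runs_close:
  assumes c: "confined s a D" and s: "sw s" and short: "\<And>t. s < t \<Longrightarrow> t \<le> last_sw t + n"
  shows "u \<ge> s + 1 + n * (d + 1) \<Longrightarrow> \<bar>r u - r (u + d)\<bar> \<le> (1 - (1 / 3) ^ d) * D"
proof (induction d arbitrary: u rule: less_induct)
  case (less d)
  have D: "D \<ge> 0" using confined_later[OF c, of s] by simp
  show ?case
  proof (cases "d = 0")
    case False
    define t t' where "t = u - n" and "t' = t + d"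
    have u: "u = t + n" "u + d = t' + n" using less.prems by (auto simp: t_def t'_def)
    have tge: "t \<ge> s + 1 + n * d" using less.prems by (simp add: t_def)
    have st: "s < t" "s < t'" using tge by (auto simp: t'_def)
    note l = last_sw[OF s st(1)] and l' = last_sw[OF s st(2)]
    have kr: "kr t = r (last_sw t)" "kr t' = r (last_sw t')"
      using kr_run l l' by blast+
    have mem: "r x \<in> {a..a + D}" if "s \<le> x" for x
      using confined_later[OF c that] by simp
    have w: "K t / Q (t + n) \<ge> 1 / 3" "K t' / Q (t' + n) \<ge> 1 / 3"
      using run_weight l l' short st by blast+
    let ?p = "Q t / Q (t + n)" and ?p' = "Q t' / Q (t' + n)"
    have Kp: "K t / Q (t + n) = 1 - ?p" "K t' / Q (t' + n) = 1 - ?p'"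
      using weights(1)[of t] weights(1)[of t'] by linarith+
    have p: "1 / 3 \<le> ?p" "?p \<le> 2 / 3" "1 / 3 \<le> ?p'" "?p' \<le> 2 / 3"
      using weights(2)[of t] weights(2)[of t'] w Kp by linarith+
    have ru: "r u = ?p * r t + (1 - ?p) * r (last_sw t)" "r (u + d) = ?p' * r t' + (1 - ?p') * r (last_sw t')"
      using r_add[of t] r_add[of t'] unfolding kr Kp u(2) unfolding u(1) by - assumption+
    \<comment> \<open>Weight 1/3 is split off from the close pair \<open>y\<close>,
      \<open>y'\<close>; the remaining two thirds differ by at most \<open>2 / 3 * D\<close>. A
      saving \<open>e\<close> on the pair becomes \<open>e / 3\<close>. A common parent is the case
      \<open>e = 1\<close>.\<close>
    have mix: "\<bar>(x * y + (1 - x) * z) - (x' * y' + (1 - x') * z')\<bar> \<le> (1 - e / 3) * D"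
      if "1 / 3 \<le> x" "x \<le> 2 / 3" "1 / 3 \<le> x'" "x' \<le> 2 / 3" "\<bar>y - y'\<bar> \<le> (1 - e) * D"
        "{y, y', z, z'} \<subseteq> {a..a + D}" for x y z x' y' z' e :: real
    proof -
      have eq: "(x * y + (1 - x) * z) - (x' * y' + (1 - x') * z') =
          1 / 3 * (y - y') + (((x - 1 / 3) * y + (1 - x) * z) - ((x' - 1 / 3) * y' + (1 - x') * z'))"
        by (simp add: field_simps)
      have b: "(v - 1 / 3) * f + (1 - v) * g \<in> {2 / 3 * a..2 / 3 * (a + D)}"
        if "1 / 3 \<le> v" "v \<le> 2 / 3" "f \<in> {a..a + D}" "g \<in> {a..a + D}" for v f g :: real
      proof -
        have "(v - 1 / 3) * a + (1 - v) * a \<le> (v - 1 / 3) * f + (1 - v) * g"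
          "(v - 1 / 3) * f + (1 - v) * g \<le> (v - 1 / 3) * (a + D) + (1 - v) * (a + D)"
          using that by (auto intro!: add_mono mult_left_mono)
        then show ?thesis by (simp add: field_simps)
      qed
      have "\<bar>((x - 1 / 3) * y + (1 - x) * z) - ((x' - 1 / 3) * y' + (1 - x') * z')\<bar> \<le> 2 / 3 * D"
      proof -
        have "\<bar>v - w\<bar> \<le> 2 / 3 * D" if "v \<in> {2 / 3 * a..2 / 3 * (a + D)}" "w \<in> {2 / 3 * a..2 / 3 * (a + D)}" for v w
          using that unfolding atLeastAtMost_iff by argo
        then show ?thesis using b[of x y z] b[of x' y' z'] that by blast
      qed
      moreover have "\<bar>1 / 3 * (y - y')\<bar> \<le> (1 - e) * D / 3" using that(5) by (simp only: abs_mult) simp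
      ultimately have "\<bar>1 / 3 * (y - y') + (((x - 1 / 3) * y + (1 - x) * z) - ((x' - 1 / 3) * y' + (1 - x') * z'))\<bar>
          \<le> (1 - e) * D / 3 + 2 / 3 * D"
        by linarith
      also have "\<dots> = (1 - e / 3) * D" by (simp add: field_simps)
      finally show ?thesis unfolding eq .
    qed
    show ?thesis
    proof (cases "last_sw t = last_sw t'")
      case True
      have "\<bar>r u - r (u + d)\<bar> \<le> (1 - 1 / 3) * D"
      proof -
        have "r u = (1 - ?p) * r (last_sw t) + (1 - (1 - ?p)) * r t"
          "r (u + d) = (1 - ?p') * r (last_sw t') + (1 - (1 - ?p')) * r t'"
          unfolding ru by simp_all
        moreover have "{r (last_sw t), r (last_sw t'), r t, r t'} \<subseteq> {a..a + D}"
          using mem[of t] mem[of t'] mem[of "last_sw t"] mem[of "last_sw t'"] l(3) l'(3) st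
            unfolding insert_subset by (meson empty_subsetI less_imp_le)
        moreover have "1 / 3 \<le> 1 - ?p" "1 - ?p \<le> 2 / 3" "1 / 3 \<le> 1 - ?p'" "1 - ?p' \<le> 2 / 3"
          using p by linarith+
        ultimately show ?thesis
          using mix[of "1 - ?p" "1 - ?p'" "r (last_sw t)" "r (last_sw t')" "1" "r t" "r t'"] True by simp
      qed
      also have "\<dots> \<le> (1 - (1 / 3) ^ d) * D"
        using D False power_decreasing[of 1 d "1 / 3 :: real"] by (intro mult_right_mono) auto
      finally show ?thesis .
    next
      case ne: False
      \<comment> \<open>No switch lies strictly between \<open>last_sw t\<close> and
        \<open>t\<close>. So a different last switch before \<open>t'\<close> happens at
        \<open>t\<close> or later, and \<open>t\<close> and \<open>last_sw t'\<close> are parents at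
        a distance smaller than \<open>d\<close>.\<close>
      have ge: "t \<le> last_sw t'"
      proof (rule ccontr)
        assume "\<not> t \<le> last_sw t'"
        then have lt: "last_sw t' < t" by simp
        have "last_sw t' \<le> last_sw t" using last_sw(3)[OF l'(1) lt] .
        moreover have "\<not> last_sw t' < last_sw t" using l'(4) l(1,2) by (auto simp: t'_def)
        ultimately show False using ne by simp
      qed
      define e where "e = last_sw t' - t"
      have e: "e < d" "last_sw t' = t + e" using ge l'(2) by (auto simp: e_def t'_def)
      have "n * (e + 1) \<le> n * d" using e(1) by (intro mult_le_mono2) simp
      then have "t \<ge> s + 1 + n * (e + 1)" using tge by linarith
      then have "\<bar>r t - r (last_sw t')\<bar> \<le> (1 - (1 / 3) ^ e) * D"
        using less.IH[OF e(1), of t] e(2) by simp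
      then have "\<bar>r u - r (u + d)\<bar> \<le> (1 - (1 / 3) ^ e / 3) * D"
      proof -
        have "r (u + d) = (1 - ?p') * r (last_sw t') + (1 - (1 - ?p')) * r t'"
          unfolding ru by simp
        moreover have "{r t, r (last_sw t'), r (last_sw t), r t'} \<subseteq> {a..a + D}"
          using mem[of t] mem[of t'] mem[of "last_sw t"] mem[of "last_sw t'"] l(3) l'(3) st
            unfolding insert_subset by (meson empty_subsetI less_imp_le)
        moreover have "1 / 3 \<le> 1 - ?p'" "1 - ?p' \<le> 2 / 3"
          using p by linarith+
        ultimately show ?thesis
          using mix[of ?p "1 - ?p'" "r t" "r (last_sw t')" "(1 / 3) ^ e" "r (last_sw t)" "r t'"] p ru(1)
            \<open>\<bar>r t - r (last_sw t')\<bar> \<le> _\<close> by metis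
      qed
      also have "\<dots> \<le> (1 - (1 / 3) ^ d) * D"
        using D power_decreasing[of "Suc e" d "1 / 3 :: real"] e(1) by (intro mult_right_mono) auto
      finally show ?thesis .
    qed
  qed simp
qed

text \<open>If no long run occurs, the survivor is itself a recent element of the queue sequence,
  and \<open>short_runs_close\<close> compares all current masses at once. The exponent
  \<open>2 * n\<close> bounds the distances there, and the resulting factor is weak enough to cover
  the factor 2/3 of a long run too.\<close>

lemma contraction_step:
  assumes c: "confined s a D" and inf: "\<And>t. \<exists>i\<ge>t. sw i"
  shows "\<exists>t a'. confined t a' ((1 - (1 / 3) ^ (2 * n)) * D)"
proof -
  obtain s' where s': "s' \<ge> s" "sw s'" using inf by blast
  have c': "confined s' a D" using confined_mono[OF c s'(1)] .
  have D: "D \<ge> 0" using confined_later[OF c, of s] by simp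
  show ?thesis
  proof (cases "\<exists>i\<ge>s'. sw i \<and> (\<forall>j. i < j \<and> j \<le> i + n \<longrightarrow> \<not> sw j)")
    case True
    then obtain t a' where t: "confined t a' (2 / 3 * D)"
      using long_run_contracts[OF c'] by blast
    have "2 / 3 * D \<le> (1 - (1 / 3) ^ (2 * n)) * D"
      using D n power_decreasing[of 1 "2 * n" "1 / 3 :: real"] by (intro mult_right_mono) auto
    then have "confined t a' ((1 - (1 / 3) ^ (2 * n)) * D)" using t unfolding confined_def by fastforce
    then show ?thesis by blast
  next
    case False
    have short: "t \<le> last_sw t + n" if "s' < t" for t
    proof (rule ccontr)
      assume long: "\<not> t \<le> last_sw t + n"
      note l = last_sw[OF s'(2) that]
      have "\<not> sw j" if "last_sw t < j" "j \<le> last_sw t + n" for j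
        using l(4)[of j] that long by linarith
      then show False using False l(1,3) by blast
    qed
    let ?e = "(1 - (1 / 3) ^ (2 * n)) * D"
    \<comment> \<open>The survivor and the queue occupy the indices from \<open>last_sw t\<close> to
      \<open>t + n - 1\<close>, fewer than \<open>2 * n + 1\<close> in number. The delay lets
      \<open>short_runs_close\<close> apply to every pair of them.\<close>
    define t where "t = s' + 1 + n * (2 * n + 1) + n"
    have st: "s' < t" by (simp add: t_def)
    note l = last_sw[OF s'(2) st]
    have lt: "t \<le> last_sw t + n" using short st by simp
    define X where "X = r ` {last_sw t..<t + n}"
    have close: "\<bar>x - y\<bar> \<le> ?e" if xy: "x \<in> X" "y \<in> X" for x y
    proof -
      have *: "\<bar>r u - r v\<bar> \<le> ?e" if "last_sw t \<le> u" "u \<le> v" "v < t + n" for u v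
      proof -
        have d: "v - u \<le> 2 * n" using that lt by simp
        then have "n * (v - u + 1) \<le> n * (2 * n + 1)" by (intro mult_le_mono2) simp
        moreover have "u \<ge> s' + 1 + n * (2 * n + 1)" using that(1) lt by (simp only: t_def)
        ultimately have "u \<ge> s' + 1 + n * (v - u + 1)" by linarith
        then have "\<bar>r u - r (u + (v - u))\<bar> \<le> (1 - (1 / 3) ^ (v - u)) * D"
          using short_runs_close[OF c' s'(2) short] by blast
        also have "\<dots> \<le> ?e" using D d by (intro mult_right_mono diff_left_mono power_decreasing) auto
        finally show ?thesis using that by simp
      qed
      obtain u v where "x = r u" "y = r v" "u \<in> {last_sw t..<t + n}" "v \<in> {last_sw t..<t + n}"
        using xy by (auto simp: X_def)
      then show ?thesis using *[of u v] *[of v u] by (cases "u \<le> v") (auto simp: abs_minus_commute)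
    qed
    have X: "finite X" "X \<noteq> {}" using l(2) by (auto simp: X_def)
    have mem: "x \<in> {Min X..Min X + ?e}" if "x \<in> X" for x
      using close[OF that Min_in[OF X]] Min_le[OF X(1) that] by auto
    have "kr t = r (last_sw t)" using kr_run l by blast
    moreover have "r (last_sw t) \<in> X" "\<And>j. j < n \<Longrightarrow> r (t + j) \<in> X" using l(2) by (auto simp: X_def)
    ultimately have "confined t (Min X) ?e"
      unfolding confined_def using mem by metis
    then show ?thesis by blast
  qed
qed

lemma confined_exists: "\<exists>a D. confined 0 a D"
proof -
  define X where "X = insert (kr 0) (r ` {..<n})"
  have X: "finite X" by (simp add: X_def)
  have "Min X \<le> x \<and> x \<le> Max X" if "x \<in> X" for x
    using X that by simp
  moreover have "kr 0 \<in> X" "\<And>j. j < n \<Longrightarrow> r (0 + j) \<in> X" by (auto simp: X_def)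
  ultimately have "confined 0 (Min X) (Max X - Min X)"
    unfolding confined_def by simp
  then show ?thesis by blast
qed

lemma contraction_infinite:
  assumes inf: "\<And>t. \<exists>i\<ge>t. sw i" and e: "e > 0"
  shows "\<exists>t a. confined t a e"
proof -
  let ?c = "1 - (1 / 3) ^ (2 * n) :: real"
  obtain a0 D where c0: "confined 0 a0 D" using confined_exists by blast
  have D: "D \<ge> 0" using c0 by (simp add: confined_def)
  have "\<exists>t a. confined t a (?c ^ m * D)" for m
  proof (induction m)
    case (Suc m)
    then obtain t a where "confined t a (?c ^ m * D)" by blast
    from contraction_step[OF this inf] show ?case unfolding power_Suc mult.assoc .
  qed (use c0 in auto)
  moreover have "(\<lambda>m. ?c ^ m * D) \<longlonglongrightarrow> 0 * D"
    by (intro tendsto_mult LIMSEQ_realpow_zero tendsto_const) (auto simp: power_le_one)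
  then have "eventually (\<lambda>m. ?c ^ m * D < e) sequentially"
    using e by (simp add: order_tendsto_iff)
  then obtain m where "?c ^ m * D < e" by (auto simp: eventually_sequentially)
  ultimately obtain t a where "confined t a (?c ^ m * D)" by blast
  then have "confined t a e" using \<open>?c ^ m * D < e\<close> unfolding confined_def by fastforce
  then show ?thesis by blast
qed

text \<open>With a fixed survivor, each round adds the same pair of values to every element. So
  \<open>V - ?p * Q\<close> stays constant while \<open>Q\<close> grows without bound, and all
  ratios tend to \<open>?p\<close>. The weight of the survivor tends to 0 here, which is why no
  geometric bound is available.\<close>

lemma contraction_finite:
  assumes fin: "\<And>t. t \<ge> s \<Longrightarrow> \<not> sw t" and e: "e > 0"
  shows "\<exists>t a. confined t a e"
proof -
  have K: "K (s + m) = K s \<and> KV (s + m) = KV s" for m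
    by (induction m) (auto simp: K_Suc KV_Suc fin)
  let ?p = "kr s"
  have pK: "?p * K s = KV s" using K_pos[of s] by (simp add: kr_def)
  define C where "C = Max ((\<lambda>j. \<bar>V (s + j) - ?p * Q (s + j)\<bar>) ` {..<n})"
  have inv: "V (s + j + m * n) - ?p * Q (s + j + m * n) = V (s + j) - ?p * Q (s + j)" for j m
  proof (induction m)
    case (Suc m)
    have "K (s + j + m * n) = K s" "KV (s + j + m * n) = KV s"
      using K[of "j + m * n"] by (auto simp: add.assoc)
    then show ?case using Suc V_add[of "s + j + m * n"] Q_add[of "s + j + m * n"] pK
      by (simp add: algebra_simps)
  qed simp
  have lower: "Q (s + j + m * n) \<ge> 1 + m" for j m
  proof (induction m)
    case (Suc m)
    then show ?case using Q_add[of "s + j + m * n"] K_pos[of "s + j + m * n"] by (simp add: algebra_simps)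
  qed (use Q_pos in simp)
  obtain m :: nat where m: "m > C / (e / 2)" using reals_Archimedean2 by blast
  have C: "C \<ge> 0" "\<And>j. j < n \<Longrightarrow> \<bar>V (s + j) - ?p * Q (s + j)\<bar> \<le> C"
  proof -
    show *: "\<bar>V (s + j) - ?p * Q (s + j)\<bar> \<le> C" if "j < n" for j
      unfolding C_def using that by (intro Max_ge) auto
    show "C \<ge> 0" using *[of 0] n by linarith
  qed
  have near: "\<bar>r (s + m * n + j) - ?p\<bar> \<le> e / 2" if "j < n" for j
  proof -
    let ?u = "s + j + m * n"
    have u: "s + m * n + j = ?u" by simp
    have "r ?u - ?p = (V ?u - ?p * Q ?u) / Q ?u" using Q_pos[of ?u] by (simp add: r_def field_simps)
    then have "\<bar>r ?u - ?p\<bar> = \<bar>V ?u - ?p * Q ?u\<bar> / Q ?u" using Q_pos[of ?u] by simp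
    also have "\<dots> \<le> C / Q ?u" using inv[of j m] C(2)[OF that] Q_pos[of ?u] by (intro divide_right_mono) auto
    also have "\<dots> \<le> C / (1 + m)" using C lower[of m j] by (intro divide_left_mono) auto
    also have "\<dots> \<le> e / 2" using m e by (simp add: field_simps)
    finally show ?thesis unfolding u .
  qed
  have kr: "kr (s + m * n) = ?p" using K[of "m * n"] by (simp add: kr_def)
  have "r (s + m * n + j) \<in> {?p - e / 2..?p - e / 2 + e}" if "j < n" for j
    using near[OF that] unfolding abs_le_iff atLeastAtMost_iff by argo
  then have "confined (s + m * n) (?p - e / 2) e"
    unfolding confined_def using e kr by auto
  then show ?thesis by blast
qed

theorem contraction: "e > 0 \<Longrightarrow> \<exists>t a. confined t a e"
  using contraction_infinite contraction_finite by blast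

end

section \<open>The game of positions\<close>

text \<open>
  A row functional has the value \<open>x k\<close> on column \<open>k\<close> of a matrix. Multiplying the matrix on the right
  by a splitting matrix with label \<open>a\<close> adds column \<open>u a\<close> to column \<open>u (1 - a)\<close> and then permutes the
  columns by \<open>p a\<close>.
\<close>

definition gstep :: "(nat \<Rightarrow> nat) \<Rightarrow> (nat \<Rightarrow> nat \<Rightarrow> nat) \<Rightarrow> nat \<Rightarrow> (nat \<Rightarrow> real) \<Rightarrow> nat \<Rightarrow> real" where
  "gstep u p a y k = y (p a k) + (if p a k = u (1 - a) then y (u a) else 0)"

primrec gval :: "(nat \<Rightarrow> nat) \<Rightarrow> (nat \<Rightarrow> nat \<Rightarrow> nat) \<Rightarrow> (nat \<Rightarrow> nat) \<Rightarrow> (nat \<Rightarrow> real) \<Rightarrow> nat \<Rightarrow> nat \<Rightarrow> real" where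
  "gval u p w x 0 = x"
| "gval u p w x (Suc t) = gstep u p (w t) (gval u p w x t)"

definition binary :: "(nat \<Rightarrow> nat) \<Rightarrow> bool" where
  "binary w \<longleftrightarrow> (\<forall>t. w t = 0 \<or> w t = 1)"

definition ratio :: "(nat \<Rightarrow> nat) \<Rightarrow> (nat \<Rightarrow> nat \<Rightarrow> nat) \<Rightarrow> (nat \<Rightarrow> nat) \<Rightarrow> (nat \<Rightarrow> real) \<Rightarrow> nat \<Rightarrow> nat \<Rightarrow> real" where
  "ratio u p w x t k = gval u p w x t k / gval u p w (\<lambda>_. 1) t k"

abbreviation share :: "(nat \<Rightarrow> nat) \<Rightarrow> (nat \<Rightarrow> nat \<Rightarrow> nat) \<Rightarrow> (nat \<Rightarrow> nat) \<Rightarrow> nat \<Rightarrow> nat \<Rightarrow> nat \<Rightarrow> real" where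
  "share u p w i \<equiv> ratio u p w (\<lambda>j. of_bool (j = i))"

text \<open>The time \<open>T\<close> is chosen before the word;
  \<open>no_exponential_growth\<close> selects its word only after the time at which it is
  examined.\<close>

definition uniformly_contractive :: "nat \<Rightarrow> (nat \<Rightarrow> nat) \<Rightarrow> (nat \<Rightarrow> nat \<Rightarrow> nat) \<Rightarrow> bool" where
  "uniformly_contractive n u p \<longleftrightarrow>
     (\<forall>e>0. \<exists>T. \<forall>t\<ge>T. \<forall>w. binary w \<longrightarrow>
       (\<forall>i\<le>n. \<forall>k\<le>n. \<forall>l\<le>n. \<bar>share u p w i t k - share u p w i t l\<bar> \<le> e))"

lemma gval_add: "gval u p w (\<lambda>j. x j + y j) t k = gval u p w x t k + gval u p w y t k"
  by (induction t arbitrary: k) (auto simp: gstep_def)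

lemma gval_zero: "gval u p w (\<lambda>j. 0) t k = 0"
  by (induction t arbitrary: k) (auto simp: gstep_def)

lemma gval_sum: "finite S \<Longrightarrow> gval u p w (\<lambda>j. \<Sum>i\<in>S. x i j) t k = (\<Sum>i\<in>S. gval u p w (x i) t k)"
  by (induction S rule: finite_induct) (auto simp: gval_zero gval_add)

lemma gval_mono:
  assumes "\<And>j. x j \<le> y j"
  shows "gval u p w x t k \<le> gval u p w y t k"
  using assms by (induction t arbitrary: k) (auto simp: gstep_def intro!: add_mono)

lemma gval_nonneg: "(\<And>j. x j \<ge> 0) \<Longrightarrow> gval u p w x t k \<ge> 0"
  using gval_mono[of "\<lambda>_. 0" x] by (auto simp: gval_zero)

lemma gval_one_ge: "gval u p w (\<lambda>_. 1) t k \<ge> 1"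
proof (induction t arbitrary: k)
  case (Suc t)
  then show ?case using add_mono[OF Suc Suc] by (fastforce simp: gstep_def intro: order_trans[OF _ add_mono[OF Suc Suc]])
qed simp

lemma gval_one_le: "gval u p w (\<lambda>_. 1) t k \<le> 2 ^ t"
proof (induction t arbitrary: k)
  case (Suc t)
  then show ?case using add_mono[OF Suc Suc] by (fastforce simp: gstep_def intro: order_trans[OF Suc])
qed simp

lemma gval_shift: "gval u p w x (s + t) k = gval u p (\<lambda>i. w (s + i)) (gval u p w x s) t k"
  by (induction t arbitrary: k) (auto simp: gstep_def)

lemma gval_cong_on:
  assumes "\<And>a k. a \<in> {0, 1} \<Longrightarrow> k \<le> n \<Longrightarrow> p a k \<le> n" "u 0 \<le> n" "u 1 \<le> n" "binary w"
    and "\<And>j. j \<le> n \<Longrightarrow> x j = y j" "k \<le> n"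
  shows "gval u p w x t k = gval u p w y t k"
  using assms(6)
proof (induction t arbitrary: k)
  case (Suc t)
  have "w t = 0 \<or> w t = 1" using assms(4) by (auto simp: binary_def)
  then show ?case using Suc assms(1-3) by (auto simp: gstep_def)
qed (use assms in auto)

locale splitting_game =
  fixes n :: nat and u :: "nat \<Rightarrow> nat" and p :: "nat \<Rightarrow> nat \<Rightarrow> nat"
  assumes perm: "p 0 permutes {0..n}" "p 1 permutes {0..n}"
    and u: "u 0 \<le> n" "u 1 \<le> n" "u 0 \<noteq> u 1"
begin

lemma p_le: "a \<in> {0, 1} \<Longrightarrow> k \<le> n \<Longrightarrow> p a k \<le> n"
  using permutes_in_image[OF perm(1), of k] permutes_in_image[OF perm(2), of k] by auto

lemma p_inj: "a \<in> {0, 1} \<Longrightarrow> p a k = p a l \<longleftrightarrow> k = l"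
  using permutes_inj[OF perm(1)] permutes_inj[OF perm(2)] by (auto dest: injD)

lemma p_surj: "a \<in> {0, 1} \<Longrightarrow> j \<le> n \<Longrightarrow> \<exists>k\<le>n. p a k = j"
  using permutes_image[OF perm(1)] permutes_image[OF perm(2)]
  by (auto simp: set_eq_iff image_iff Bex_def) (metis atLeast0AtMost atMost_iff)+

end

locale contractive_game = splitting_game +
  assumes uc: "uniformly_contractive n u p"
begin

lemma uc_set:
  assumes "e > 0" "S \<subseteq> {0..n}"
  shows "\<exists>T. \<forall>t\<ge>T. \<forall>w. binary w \<longrightarrow> (\<forall>k\<le>n. \<forall>l\<le>n.
    \<bar>ratio u p w (\<lambda>j. of_bool (j \<in> S)) t k - ratio u p w (\<lambda>j. of_bool (j \<in> S)) t l\<bar> \<le> e)"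
proof -
  have fin: "finite S" using assms(2) finite_subset by blast
  define d where "d = e / (card S + 1)"
  have d: "d > 0" using assms(1) by (simp add: d_def)
  obtain T where T: "\<And>t w i k l. t \<ge> T \<Longrightarrow> binary w \<Longrightarrow> i \<le> n \<Longrightarrow> k \<le> n \<Longrightarrow> l \<le> n \<Longrightarrow>
      \<bar>share u p w i t k - share u p w i t l\<bar> \<le> d"
    using uc d unfolding uniformly_contractive_def by meson
  have sum: "ratio u p w (\<lambda>j. of_bool (j \<in> S)) t k = (\<Sum>i\<in>S. share u p w i t k)" for w t k
  proof -
    have "(\<lambda>j. of_bool (j \<in> S)) = (\<lambda>j. \<Sum>i\<in>S. of_bool (j = i) :: real)"
      using fin by (auto simp: of_bool_def)
    then show ?thesis using gval_sum[OF fin] by (simp add: ratio_def sum_divide_distrib)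
  qed
  have "\<bar>ratio u p w (\<lambda>j. of_bool (j \<in> S)) t k - ratio u p w (\<lambda>j. of_bool (j \<in> S)) t l\<bar> \<le> e"
    if "t \<ge> T" "binary w" "k \<le> n" "l \<le> n" for t w k l
  proof -
    have "\<bar>ratio u p w (\<lambda>j. of_bool (j \<in> S)) t k - ratio u p w (\<lambda>j. of_bool (j \<in> S)) t l\<bar> \<le> (\<Sum>i\<in>S. d)"
      unfolding sum sum_subtractf[symmetric]
      using assms(2) that by (intro order_trans[OF sum_abs] sum_mono T) auto
    also have "\<dots> \<le> e" using assms(1) by (simp add: d_def field_simps)
    finally show ?thesis .
  qed
  then show ?thesis by blast
qed

text \<open>Sums are formed only between columns of equal colour. So coloured columns are made of
  initially coloured vertices alone and the others of none: the shares of the coloured set stay 1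
  and 0.\<close>

lemma no_separating_colouring:
  assumes w: "binary w"
    and step: "\<And>t k. k \<le> n \<Longrightarrow> c (Suc t) k \<longleftrightarrow> c t (p (w t) k)"
    and active: "\<And>t. c t (u 0) \<longleftrightarrow> c t (u 1)"
    and both: "\<exists>k\<le>n. c 0 k" "\<exists>k\<le>n. \<not> c 0 k"
  shows False
proof -
  have w01: "w t \<in> {0, 1}" for t using w by (auto simp: binary_def)
  let ?x = "\<lambda>j. of_bool (j \<in> {j. j \<le> n \<and> c 0 j}) :: real"
  have val: "gval u p w ?x t k = (if c t k then gval u p w (\<lambda>_. 1) t k else 0)" if "k \<le> n" for t k
    using that
  proof (induction t arbitrary: k)
    case (Suc t)
    have "p (w t) k \<le> n" using p_le w01 Suc.prems by blast
    moreover have "u (w t) \<le> n" "c t (u (1 - w t)) = c t (u (w t))" using w01[of t] u active[of t] by auto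
    ultimately show ?case using Suc step[of k t] by (auto simp: gstep_def)
  qed auto
  have col: "(\<exists>k\<le>n. c t k) \<and> (\<exists>k\<le>n. \<not> c t k)" for t
  proof (induction t)
    case (Suc t)
    then show ?case using step[of _ t] p_surj[OF w01, of _ t] by metis
  qed (use both in auto)
  obtain T where T: "\<And>t w k l. t \<ge> T \<Longrightarrow> binary w \<Longrightarrow> k \<le> n \<Longrightarrow> l \<le> n \<Longrightarrow>
      \<bar>ratio u p w ?x t k - ratio u p w ?x t l\<bar> \<le> 1 / 2"
    using uc_set[of "1 / 2" "{j. j \<le> n \<and> c 0 j}"] by fastforce
  obtain k l where kl: "k \<le> n" "c T k" "l \<le> n" "\<not> c T l" using col by blast
  then have "ratio u p w ?x T k = 1" "ratio u p w ?x T l = 0"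
    unfolding ratio_def val[OF kl(1)] val[OF kl(3)] using gval_one_ge[of u p w T k] by auto
  then show False using T[OF order_refl w kl(1,3)] by simp
qed

lemma no_inactive_path:
  assumes w: "binary w" and path: "\<And>t. j t = p (w t) (j (Suc t))"
    and inactive: "\<And>t. j t \<le> n" "\<And>t. j t \<noteq> u 0" "\<And>t. j t \<noteq> u 1"
  shows False
proof (rule no_separating_colouring[OF w, of "\<lambda>t k. k = j t"])
  show "(k = j (Suc t)) = (p (w t) k = j t)" for t k
    using path[of t] p_inj[of "w t" k "j (Suc t)"] w by (auto simp: binary_def)
  show "\<exists>k\<le>n. k \<noteq> j 0" using inactive(2) u(1) by metis
  show "(u 0 = j t) = (u 1 = j t)" for t using inactive(2,3) by metis
qed (use inactive(1) in auto)

text \<open>\<open>p a k = m\<close> means that the column in position \<open>m\<close> moves to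
  \<open>k\<close>. If every position of \<open>S\<close> had such a move inside \<open>S\<close>,
  repeating these moves would give a column that is never active.\<close>

lemma inactive_has_exit:
  assumes "S \<subseteq> {0..n} - {u 0, u 1}" "S \<noteq> {}"
  shows "\<exists>m\<in>S. \<forall>a\<in>{0, 1}. \<forall>k\<in>S. p a k \<noteq> m"
proof (rule ccontr)
  assume "\<not> ?thesis"
  then have "\<forall>m\<in>S. \<exists>ak. fst ak \<in> {0, 1} \<and> snd ak \<in> S \<and> p (fst ak) (snd ak) = m"
    by (auto; metis)
  then obtain f where f: "\<And>m. m \<in> S \<Longrightarrow> fst (f m) \<in> {0, 1} \<and> snd (f m) \<in> S \<and> p (fst (f m)) (snd (f m)) = m"
    by metis
  obtain m0 where m0: "m0 \<in> S" using assms by blast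
  define j where "j = (\<lambda>t. ((\<lambda>m. snd (f m)) ^^ t) m0)"
  have j: "j t \<in> S" for t by (induction t) (auto simp: j_def m0 f)
  show False
  proof (rule no_inactive_path[of "\<lambda>t. fst (f (j t))" j])
    show "binary (\<lambda>t. fst (f (j t)))" using f[OF j] by (auto simp: binary_def)
    show "j t = p (fst (f (j t))) (j (Suc t))" for t using f[OF j[of t]] by (simp add: j_def)
    show "j t \<le> n" "j t \<noteq> u 0" "j t \<noteq> u 1" for t using j[of t] assms(1) by auto
  qed
qed

lemma inactive_order:
  "S \<subseteq> {0..n} - {u 0, u 1} \<Longrightarrow> \<exists>xs. distinct xs \<and> set xs = S \<and>
     (\<forall>a\<in>{0, 1}. \<forall>i<length xs. \<forall>j<length xs. p a (xs ! i) = xs ! j \<longrightarrow> i < j)"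
proof (induction "card S" arbitrary: S)
  case 0
  then have "S = {}" using finite_subset[OF 0(2)] by simp
  then show ?case by auto
next
  case (Suc m)
  have fin: "finite S" using finite_subset[OF Suc.prems] by simp
  have ne: "S \<noteq> {}" using Suc(2) by auto
  obtain s where s: "s \<in> S" "\<And>a k. a \<in> {0, 1} \<Longrightarrow> k \<in> S \<Longrightarrow> p a k \<noteq> s"
    using inactive_has_exit[OF Suc.prems ne] by blast
  have "card (S - {s}) = m" using Suc(2) s(1) fin by simp
  then have "m = card (S - {s})" "S - {s} \<subseteq> {0..n} - {u 0, u 1}" using Suc.prems by auto
  then obtain xs where xs: "distinct xs" "set xs = S - {s}"
      "\<And>a i j. a \<in> {0, 1} \<Longrightarrow> i < length xs \<Longrightarrow> j < length xs \<Longrightarrow> p a (xs ! i) = xs ! j \<Longrightarrow> i < j"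
    using Suc(1)[of "S - {s}"] by meson
  have "i < j" if h: "a \<in> {0, 1}" "i < length (s # xs)" "j < length (s # xs)"
    "p a ((s # xs) ! i) = (s # xs) ! j" for a i j
  proof -
    have "(s # xs) ! i \<in> set (s # xs)" using h(2) by (rule nth_mem)
    moreover have "set (s # xs) = S" using s(1) xs(2) by auto
    ultimately have "(s # xs) ! i \<in> S" by (rule back_subst)
    then obtain j' where j': "j = Suc j'" using s(2)[OF h(1) \<open>(s # xs) ! i \<in> S\<close>] h(4) by (metis nth_Cons_0 old.nat.exhaust)
    show ?thesis
    proof (cases i)
      case (Suc i')
      then show ?thesis using xs(3)[OF h(1), of i' j'] h(2-4) j' by simp
    qed (simp add: j')
  qed
  moreover have "distinct (s # xs)" "set (s # xs) = S" using xs(1,2) s(1) by auto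
  ultimately show ?case by blast
qed

end

section \<open>Renaming positions and labels\<close>

lemma gval_relabel:
  assumes g: "g permutes {0..n}" and b: "\<And>a. a \<in> {0, 1} \<Longrightarrow> b a \<in> {0, 1} \<and> b (1 - a) = 1 - b a"
    and u': "\<And>a. a \<in> {0, 1} \<Longrightarrow> g (u' a) = u (b a)" and w: "binary w"
  shows "gval u' (\<lambda>a. inv_into UNIV g \<circ> p (b a) \<circ> g) w (x \<circ> g) t k = gval u p (\<lambda>t. b (w t)) x t (g k)"
proof (induction t arbitrary: k)
  case (Suc t)
  have w01: "w t \<in> {0, 1}" using w by (auto simp: binary_def)
  have g_inv: "g (inv_into UNIV g y) = y" for y using g by (rule permutes_inverses)
  have "inv_into UNIV g (p (b (w t)) (g k)) = u' (1 - w t) \<longleftrightarrow> p (b (w t)) (g k) = u (1 - b (w t))"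
  proof -
    have "1 - w t \<in> {0, 1}" using w01 by auto
    then have "u (1 - b (w t)) = g (u' (1 - w t))" using u' b[OF w01] by metis
    moreover have "inv_into UNIV g (g z) = z" for z using g by (rule permutes_inverses)
    ultimately show ?thesis using g_inv by metis
  qed
  then show ?case using Suc u'[OF w01] g_inv by (simp add: gstep_def)
qed simp

lemma uniformly_contractive_relabel:
  assumes g: "g permutes {0..n}" and b: "\<And>a. a \<in> {0, 1} \<Longrightarrow> b a \<in> {0, 1} \<and> b (1 - a) = 1 - b a"
    and u': "\<And>a. a \<in> {0, 1} \<Longrightarrow> g (u' a) = u (b a)"
    and uc: "uniformly_contractive n u p"
  shows "uniformly_contractive n u' (\<lambda>a. inv_into UNIV g \<circ> p (b a) \<circ> g)"
  unfolding uniformly_contractive_def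
proof (intro allI impI)
  fix e :: real
  assume "e > 0"
  then obtain T where T: "\<And>t w i k l. t \<ge> T \<Longrightarrow> binary w \<Longrightarrow> i \<le> n \<Longrightarrow> k \<le> n \<Longrightarrow> l \<le> n \<Longrightarrow>
      \<bar>share u p w i t k - share u p w i t l\<bar> \<le> e"
    using uc unfolding uniformly_contractive_def by meson
  have le: "g k \<le> n" if "k \<le> n" for k using permutes_in_image[OF g, of k] that by simp
  have r: "ratio u' (\<lambda>a. inv_into UNIV g \<circ> p (b a) \<circ> g) w (\<lambda>j. of_bool (j = i)) t k =
      ratio u p (\<lambda>t. b (w t)) (\<lambda>j. of_bool (j = g i)) t (g k)" if "binary w" for w t i k
  proof -
    have A: "gval u' (\<lambda>a. inv_into UNIV g \<circ> p (b a) \<circ> g) w (\<lambda>j. x (g j)) t k = gval u p (\<lambda>t. b (w t)) x t (g k)" for x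
      using gval_relabel[where g = g and n = n and b = b and u = u and u' = u' and w = w and p = p and x = x, OF g b u' that] by (simp only: comp_def)
    have "g j = g i \<longleftrightarrow> j = i" for j using permutes_inj[OF g] by (simp add: inj_eq)
    then show ?thesis unfolding ratio_def
      using A[of "\<lambda>j. of_bool (j = g i)"] A[of "\<lambda>_. 1"] by simp
  qed
  have "binary (\<lambda>t. b (w t))" if "binary w" for w
    unfolding binary_def
  proof
    show "b (w t) = 0 \<or> b (w t) = 1" for t
      using that b[of "w t"] unfolding binary_def by auto
  qed
  then show "\<exists>T. \<forall>t\<ge>T. \<forall>w. binary w \<longrightarrow> (\<forall>i\<le>n. \<forall>k\<le>n. \<forall>l\<le>n.
      \<bar>ratio u' (\<lambda>a. inv_into UNIV g \<circ> p (b a) \<circ> g) w (\<lambda>j. of_bool (j = i)) t k -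
       ratio u' (\<lambda>a. inv_into UNIV g \<circ> p (b a) \<circ> g) w (\<lambda>j. of_bool (j = i)) t l\<bar> \<le> e)"
    using T le by (intro exI[of _ T] allI impI) (simp only: r)
qed

text \<open>The active positions become 0 and 1, and the others are numbered along
  \<open>inactive_order\<close>. As the new column \<open>k\<close> is the old column
  \<open>p a k\<close>, the condition \<open>k < p a k\<close> says that inactive columns move
  down.\<close>

lemma (in contractive_game) ordered_relabelling:
  "\<exists>g. g permutes {0..n} \<and> g 0 = u 0 \<and> g 1 = u 1 \<and>
     contractive_game n id (\<lambda>a. inv_into UNIV g \<circ> p a \<circ> g) \<and>
     (\<forall>a\<in>{0, 1}. \<forall>k\<le>n. (inv_into UNIV g \<circ> p a \<circ> g) k \<ge> 2 \<longrightarrow> k < (inv_into UNIV g \<circ> p a \<circ> g) k)"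
proof -
  let ?I = "{0..n} - {u 0, u 1}"
  obtain xs where xs12: "distinct xs" "set xs = ?I"
      and ord: "\<forall>a\<in>{0, 1}. \<forall>i<length xs. \<forall>j<length xs. p a (xs ! i) = xs ! j \<longrightarrow> i < j"
    using inactive_order[OF order_refl] by meson
  have xs: "distinct xs" "set xs = ?I"
      "\<And>a i j. a \<in> {0, 1} \<Longrightarrow> i < length xs \<Longrightarrow> j < length xs \<Longrightarrow> p a (xs ! i) = xs ! j \<Longrightarrow> i < j"
    using xs12 ord by blast+
  let ?L = "u 0 # u 1 # xs"
  have dist: "distinct ?L" using xs12 u(3) by simp
  have "set ?L = {u 0, u 1} \<union> ?I" using xs12(2) by auto
  moreover have "{u 0, u 1} \<subseteq> {0..n}" using u(1,2) by simp
  ultimately have set: "set ?L = {0..n}" by blast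
  have len: "length ?L = n + 1" using distinct_card[OF dist] set by simp
  define g where "g k = (if k \<le> n then ?L ! k else k)" for k
  have n: "n \<ge> 1" using u by linarith
  have "bij_betw ((!) ?L) {..<length ?L} (set ?L)" using dist by (rule bij_betw_nth) simp_all
  then have "bij_betw ((!) ?L) {0..n} {0..n}" unfolding set len
    by (simp add: atLeast0AtMost lessThan_Suc_atMost)
  then have "bij_betw g {0..n} {0..n}" by (subst bij_betw_cong[of _ g "(!) ?L"]) (auto simp: g_def)
  then have g: "g permutes {0..n}" by (rule bij_imp_permutes) (auto simp: g_def)
  have g0: "g 0 = u 0" "g 1 = u 1" using n by (auto simp: g_def)
  let ?p = "\<lambda>a. inv_into UNIV g \<circ> p a \<circ> g"
  have perm': "?p 0 permutes {0..n}" "?p 1 permutes {0..n}"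
    using g perm by (auto intro!: permutes_compose permutes_inv)
  have "uniformly_contractive n id ?p"
    using uniformly_contractive_relabel[where g = g and n = n and b = id and u' = id and u = u and p = p] g g0 uc
    by auto
  then have "contractive_game n id ?p"
    using perm' n by unfold_locales auto
  moreover have "k < ?p a k" if a: "a \<in> {0, 1}" and k: "k \<le> n" and ge: "?p a k \<ge> 2" for a k
  proof (cases "k \<ge> 2")
    case True
    define j where "j = ?p a k"
    have "p a (g k) = g j" unfolding j_def using permutes_inverses(1)[OF g] by simp
    moreover have jn: "j \<le> n" unfolding j_def
      using a k permutes_in_image[OF perm'(1), of k] permutes_in_image[OF perm'(2), of k] by auto
    ultimately have "p a (xs ! (k - 2)) = xs ! (j - 2)"
      using True k ge unfolding j_def[symmetric] by (simp add: g_def nth_Cons' numeral_2_eq_2)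
    then have "k - 2 < j - 2" using xs(3)[OF a] len k jn True ge unfolding j_def[symmetric] by simp
    then show ?thesis unfolding j_def by simp
  next
    case False
    then show ?thesis using ge by simp
  qed
  ultimately show ?thesis using g g0 by blast
qed

section \<open>A vertex that survives forever\<close>

lemma unbounded_record:
  fixes f :: "nat \<Rightarrow> real"
  assumes "\<And>B. \<exists>T. f T > B"
  shows "\<exists>T\<ge>T0. \<forall>s\<le>T. f s \<le> f T"
proof -
  define M where "M = Max (f ` {..T0})"
  have M: "f s \<le> M" if "s \<le> T0" for s unfolding M_def using that by (intro Max_ge) auto
  define T where "T = (LEAST T. f T > M)"
  have T: "f T > M" unfolding T_def using assms by (rule LeastI_ex)
  have less: "f s \<le> M" if "s < T" for s using not_less_Least that unfolding T_def by (metis not_le)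
  have "T \<ge> T0" using M T by (meson leI less_imp_le not_le)
  moreover have "f s \<le> f T" if "s \<le> T" for s using less[of s] T that by (cases "s = T") auto
  ultimately show ?thesis by blast
qed

locale standard_game = contractive_game n id p for n p
begin

lemma n_pos: "n \<ge> 1"
  using u by simp

text \<open>\<open>j t\<close> follows one column through its positions. With active positions 0 and
  1, label \<open>w t\<close> replaces the column in position \<open>1 - w t\<close>, so the last
  condition keeps it an unchanged vertex.\<close>

definition surviving :: "(nat \<Rightarrow> nat) \<Rightarrow> (nat \<Rightarrow> nat) \<Rightarrow> bool" where
  "surviving w j \<longleftrightarrow> binary w \<and> (\<forall>t. j t \<le> n \<and> p (w t) (j (Suc t)) = j t \<and> j t \<noteq> 1 - w t)"

definition own :: "(nat \<Rightarrow> nat) \<Rightarrow> (nat \<Rightarrow> nat) \<Rightarrow> nat \<Rightarrow> nat \<Rightarrow> real" where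
  "own w j t k = gval id p w (\<lambda>k. of_bool (k = j 0)) t k"

definition other :: "(nat \<Rightarrow> nat) \<Rightarrow> (nat \<Rightarrow> nat) \<Rightarrow> nat \<Rightarrow> nat \<Rightarrow> real" where
  "other w j t k = gval id p w (\<lambda>k. of_bool (k \<noteq> j 0)) t k"

lemma survivingD:
  assumes "surviving w j"
  shows "binary w" "w t \<in> {0, 1}" "j t \<le> n" "p (w t) (j (Suc t)) = j t" "j t \<noteq> 1 - w t"
  using assms by (auto simp: surviving_def binary_def)

lemma surviving_shift: "surviving w j \<Longrightarrow> surviving (\<lambda>i. w (s + i)) (\<lambda>i. j (s + i))"
  by (auto simp: surviving_def binary_def)

lemma own_plus_other: "gval id p w (\<lambda>_. 1) t k = own w j t k + other w j t k"
proof -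
  have "(\<lambda>_. 1 :: real) = (\<lambda>k. of_bool (k = j 0) + of_bool (k \<noteq> j 0))" by auto
  then show ?thesis unfolding own_def other_def gval_add[symmetric] by simp
qed

lemma other_nonneg: "other w j t k \<ge> 0" and own_nonneg: "own w j t k \<ge> 0"
  unfolding other_def own_def by (intro gval_nonneg; simp)+

lemma other_le: "other w j t k \<le> 2 ^ t"
  using own_plus_other[of w t k j] own_nonneg[of w j t k] gval_one_le[of id p w t k] by linarith

lemma other_survivor:
  assumes "surviving w j"
  shows "other w j t (j t) = 0"
proof (induction t)
  case (Suc t)
  then show ?case using survivingD(4,5)[OF assms, of t] by (simp add: other_def gstep_def)
qed (simp add: other_def)

lemma other_ge_one:
  assumes "surviving w j"
  shows "k \<noteq> j t \<Longrightarrow> other w j t k \<ge> 1"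
proof (induction t arbitrary: k)
  case (Suc t)
  have "p (w t) k \<noteq> j t"
    using p_inj[OF survivingD(2)[OF assms], of t k "j (Suc t)"] survivingD(4)[OF assms, of t] Suc.prems by simp
  then have "other w j t (p (w t) k) \<ge> 1" by (rule Suc.IH)
  moreover have "other w j (Suc t) k \<ge> other w j t (p (w t) k)"
    using other_nonneg[of w j t "w t"] by (simp add: other_def gstep_def)
  ultimately show ?case by linarith
qed (simp add: other_def)

text \<open>The first step adds the survivor's vertex, with coefficient 1, to at most one other
  column. Bounding this by one unit in every column, the contribution becomes \<open>own\<close>
  plus \<open>other\<close> of the shifted word. Iterating gives one term for each starting
  time.\<close>

lemma own_le_sum:
  assumes G: "\<And>w j s k. surviving w j \<Longrightarrow> k \<le> n \<Longrightarrow> other w j s k \<le> G s"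
  shows "surviving w j \<Longrightarrow> k \<le> n \<Longrightarrow> k \<noteq> j T \<Longrightarrow> own w j T k \<le> (\<Sum>s<T. G s)"
proof (induction T arbitrary: w j)
  case (Suc T)
  note D = survivingD(2,4,5)[OF Suc.prems(1), of 0]
  let ?w = "\<lambda>i. w (1 + i)" and ?j = "\<lambda>i. j (1 + i)"
  have S: "surviving ?w ?j" using surviving_shift[OF Suc.prems(1), of 1] .
  have first: "gstep id p (w 0) (\<lambda>k. of_bool (k = j 0)) k \<le> of_bool (k = j 1) + of_bool (k \<noteq> j 1)" for k
    using p_inj[OF D(1), of k "j 1"] D(2,3) by (auto simp: gstep_def)
  have "own w j (Suc T) k = gval id p ?w (gstep id p (w 0) (\<lambda>k. of_bool (k = j 0))) T k"
    unfolding own_def using gval_shift[of id p w "\<lambda>k. of_bool (k = j 0)" 1 T k] by simp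
  also have "\<dots> \<le> gval id p ?w (\<lambda>k. of_bool (k = j 1) + of_bool (k \<noteq> j 1)) T k"
    by (rule gval_mono) (rule first)
  also have "\<dots> = own ?w ?j T k + other ?w ?j T k"
    unfolding gval_add own_def other_def by simp
  also have "\<dots> \<le> (\<Sum>s<T. G s) + G T"
    using Suc.IH[OF S Suc.prems(2)] Suc.prems(3) G[OF S Suc.prems(2)] by (intro add_mono) auto
  finally show ?case by simp
qed (simp add: own_def)

text \<open>
  If the other columns could grow exponentially next to a surviving one, then at a record of their
  growth rate the share of the survivor, which only enters by unit amounts, would still be bounded.
\<close>

lemma no_exponential_growth:
  assumes N: "N \<ge> 1" and c: "c > 0"
    and growth: "\<And>M. \<exists>T\<ge>M. \<exists>w j k. surviving w j \<and> k \<le> n \<and> other w j T k ^ N \<ge> c * 2 ^ T"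
  shows False
proof -
  define X where "X T = insert 0 {other w j T k | w j k. surviving w j \<and> k \<le> n}" for T
  define G where "G T = Sup (X T)" for T
  have bdd: "bdd_above (X T)" for T
    unfolding X_def by (rule bdd_aboveI[of _ "2 ^ T"]) (auto intro: other_le)
  have G: "other w j s k \<le> G s" if "surviving w j" "k \<le> n" for w j s k
    unfolding G_def using that bdd by (intro cSup_upper) (auto simp: X_def)
  have G0: "G T \<ge> 0" for T
    unfolding G_def using bdd by (intro cSup_upper) (auto simp: X_def)
  \<comment> \<open>\<open>lam\<close> is the assumed rate of growth. With \<open>mu\<close>
    strictly between 1 and \<open>lam\<close>, the quotient \<open>G T / mu ^ T\<close> is
    unbounded, and at a record of it a geometric sum bounds the earlier \<open>G s\<close> by
    \<open>G T / (mu - 1)\<close> in total.\<close>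
  define lam mu where "lam = root N 2" and "mu = (1 + lam) / 2"
  have lam: "lam > 1" using N by (simp add: lam_def)
  have mu: "mu > 1" "mu < lam" using lam by (auto simp: mu_def)
  define f where "f T = G T / mu ^ T" for T
  have "\<exists>T. f T > B" for B
  proof -
    have "lam / mu > 1" using mu by simp
    then obtain M where M: "B / root N c < (lam / mu) ^ M" using real_arch_pow by blast
    obtain T w j k where T: "T \<ge> M" "surviving w j" "k \<le> n" "other w j T k ^ N \<ge> c * 2 ^ T"
      using growth by blast
    have "root N (c * 2 ^ T) \<le> root N (other w j T k ^ N)" using T(4) N by simp
    then have "root N c * lam ^ T \<le> other w j T k"
      using N other_nonneg by (simp add: lam_def real_root_mult real_root_power real_root_power_cancel)
    also have "\<dots> \<le> G T" using G T by blast
    finally have 1: "root N c * (lam / mu) ^ T \<le> f T"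
      using mu by (simp add: f_def power_divide field_simps)
    have rc: "root N c > 0" using N c by simp
    have "B < root N c * (lam / mu) ^ M" using M rc by (simp add: field_simps)
    also have "\<dots> \<le> root N c * (lam / mu) ^ T"
      using rc T(1) \<open>lam / mu > 1\<close> by (intro mult_left_mono power_increasing) auto
    finally show ?thesis using 1 by (intro exI[of _ T]) linarith
  qed
  note unb = this
  \<comment> \<open>The factor 2 pays for choosing a column with \<open>other\<close> only above
    \<open>G T / 2\<close>. It follows that \<open>own <= C * other\<close>, so the survivor's share
    in that column is at most \<open>1 - 1 / (C + 1) = 1 - 2 * e\<close>, too far from its share 1
    in the survivor itself.\<close>
  define C where "C = 2 / (mu - 1)"
  have C: "C > 0" using mu by (simp add: C_def)
  define d e where "d = 1 / (C + 1)" and "e = d / 2"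
  have "d > 0" using C by (simp add: d_def)
  then have e: "e > 0" "2 * e = 1 / (C + 1)" by (simp_all add: e_def flip: d_def)
  obtain T0 where T0: "\<And>t w i k l. t \<ge> T0 \<Longrightarrow> binary w \<Longrightarrow> i \<le> n \<Longrightarrow> k \<le> n \<Longrightarrow> l \<le> n \<Longrightarrow>
      \<bar>share id p w i t k - share id p w i t l\<bar> \<le> e"
  proof -
    show ?thesis using uc e(1) that unfolding uniformly_contractive_def by meson
  qed
  obtain T where T: "T \<ge> T0" "\<And>s. s \<le> T \<Longrightarrow> f s \<le> f T"
    using unbounded_record[OF unb] by blast
  have GT: "G T > 0"
  proof -
    obtain T' w j k where T': "surviving w j" "k \<le> n" "other w j T' k ^ N \<ge> c * 2 ^ T'"
      using growth by blast
    have "\<exists>k\<le>n. k \<noteq> j T" using n_pos by (metis le0 zero_neq_one)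
    then obtain k where "k \<le> n" "k \<noteq> j T" by blast
    then show ?thesis using other_ge_one[OF T'(1)] G[OF T'(1), of k T] by fastforce
  qed
  have "\<exists>x\<in>X T. G T / 2 < x"
    unfolding G_def using GT by (intro less_cSupD) (auto simp: X_def G_def)
  then obtain w j k where wj: "surviving w j" "k \<le> n" "G T / 2 < other w j T k"
    using GT by (auto simp: X_def)
  have ne: "k \<noteq> j T" using wj GT other_survivor[OF wj(1)] by auto
  let ?A = "own w j T k" and ?O = "other w j T k"
  have "?A \<le> (\<Sum>s<T. G s)" using own_le_sum[OF G wj(1,2) ne] by blast
  also have "\<dots> \<le> (\<Sum>s<T. f T * mu ^ s)"
  proof (intro sum_mono)
    fix s assume "s \<in> {..<T}"
    then have "f s \<le> f T" using T(2) by simp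
    then show "G s \<le> f T * mu ^ s" using mu unfolding f_def[of s] by (simp add: field_simps)
  qed
  also have "\<dots> = f T * ((mu ^ T - 1) / (mu - 1))"
    using mu by (simp flip: sum_distrib_left add: geometric_sum)
  also have "\<dots> \<le> f T * (mu ^ T / (mu - 1))"
    using mu GT by (intro mult_left_mono divide_right_mono) (auto simp: f_def)
  also have "\<dots> = G T / 2 * C" using mu by (simp add: f_def C_def)
  also have "\<dots> \<le> ?O * C" using wj(3) C by (intro mult_right_mono) auto
  finally have A: "?A \<le> C * ?O" by (simp add: mult.commute)
  have O: "?O > 0" using wj(3) GT by linarith
  have "share id p w (j 0) T k = ?A / (?A + ?O)"
    unfolding ratio_def own_plus_other[of w T k j] by (simp add: own_def)
  also have "\<dots> \<le> 1 - 1 / (C + 1)"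
    using A O C own_nonneg[of w j T k] by (simp add: field_simps add_pos_nonneg add_nonneg_pos)
  finally have 1: "share id p w (j 0) T k \<le> 1 - 2 * e" unfolding e(2) .
  have 2: "share id p w (j 0) T (j T) = 1"
    unfolding ratio_def using own_plus_other[of w T "j T" j] other_survivor[OF wj(1), of T]
      gval_one_ge[of id p w T "j T"] by (simp add: own_def)
  have "\<bar>share id p w (j 0) T (j T) - share id p w (j 0) T k\<bar> \<le> e"
    using T0[OF T(1) survivingD(1)[OF wj(1)]] survivingD(3)[OF wj(1)] wj(2) by blast
  then show False using 1 2 e(1) by linarith
qed

end

section \<open>Growth from killing the lighter active column\<close>

context standard_game
begin

lemma prod_ge_of_all_ge:
  fixes f :: "nat \<Rightarrow> real"
  assumes "finite S" "S \<noteq> {}" "\<And>k. k \<in> S \<Longrightarrow> f k \<ge> 1"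
  shows "\<exists>k\<in>S. f k ^ card S \<ge> prod f S"
proof -
  have fin: "finite (f ` S)" "f ` S \<noteq> {}" using assms by auto
  obtain k where k: "k \<in> S" "f k = Max (f ` S)" using Max_in[OF fin] by auto
  have "prod f S \<le> prod (\<lambda>_. f k) S"
  proof (rule prod_mono)
    show "0 \<le> f i \<and> f i \<le> f k" if "i \<in> S" for i
      using assms(3)[OF that] Max_ge[OF fin(1), of "f i"] that k by auto
  qed
  then show ?thesis using k(1) by auto
qed

text \<open>The product omits only the survivor. If the survivor is inactive, both active columns
  are factors, and a lighter column that is killed is replaced by a sum at least twice as
  large.\<close>

lemma other_prod_step:
  assumes S: "surviving w j"
  defines "P \<equiv> \<lambda>t. \<Prod>k\<in>{0..n} - {j t}. other w j t k"
  shows "P t \<ge> 1" "P (Suc t) \<ge> P t"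
    "j t \<ge> 2 \<Longrightarrow> other w j t (1 - w t) \<le> other w j t (w t) \<Longrightarrow> P (Suc t) \<ge> 2 * P t"
proof -
  let ?y = "other w j t" and ?a = "w t"
  note D = survivingD[OF S]
  have y1: "?y k \<ge> 1" if "k \<noteq> j t" for k using other_ge_one[OF S that] .
  have y0: "?y k \<ge> 0" for k by (rule other_nonneg)
  show P1: "P t \<ge> 1" unfolding P_def by (rule prod_ge_1) (use y1 in auto)
  have bij: "bij_betw (p ?a) ({0..n} - {j (Suc t)}) ({0..n} - {j t})"
  proof -
    have "p ?a permutes {0..n}" using D(2)[of t] perm by auto
    then have "bij_betw (p ?a) {0..n} {0..n}" by (rule permutes_imp_bij)
    then show ?thesis using D(4)[of t] bij_betw_DiffI[of "p ?a" "{0..n}" "{0..n}" "{j (Suc t)}" "{j t}"] D(3)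
      by (auto simp: bij_betw_def)
  qed
  define z where "z i = ?y i + (if i = 1 - ?a then ?y ?a else 0)" for i
  have "other w j (Suc t) k = z (p ?a k)" for k
    by (simp add: other_def gstep_def z_def)
  then have PS: "P (Suc t) = (\<Prod>i\<in>{0..n} - {j t}. z i)"
    unfolding P_def using prod.reindex_bij_betw[OF bij, of z] by simp
  have zy: "?y i \<le> z i" for i using y0 by (simp add: z_def)
  show "P (Suc t) \<ge> P t" unfolding PS unfolding P_def by (rule prod_mono) (use y0 zy in auto)
  assume j2: "j t \<ge> 2" and light: "?y (1 - ?a) \<le> ?y ?a"
  have i: "1 - ?a \<in> {0..n} - {j t}" using j2 n_pos by auto
  let ?R = "{0..n} - {j t} - {1 - ?a}"
  have "2 * P t = (2 * ?y (1 - ?a)) * prod ?y ?R"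
    unfolding P_def using prod.remove[OF _ i, of ?y] by simp
  also have "\<dots> \<le> z (1 - ?a) * prod z ?R"
    using light y0 zy by (intro mult_mono prod_mono prod_nonneg) (auto simp: z_def)
  also have "\<dots> = P (Suc t)"
    unfolding PS using prod.remove[OF _ i, of z] by simp
  finally show "P (Suc t) \<ge> 2 * P t" .
qed

text \<open>
  While the surviving vertex visits a position in \<open>Fr\<close>, either label keeps it in \<open>Z\<close>, so that one may
  always kill the lighter of the two active vertices; this doubles the product of the other masses.
  The rank \<open>rk\<close> bounds the time until the next visit of \<open>Fr\<close>.
\<close>

lemma no_greedy_strategy:
  fixes rk :: "nat \<Rightarrow> nat"
  assumes Z: "Z \<subseteq> {0..n}" "i0 \<in> Z"
    and forced: "\<And>i. i \<in> Z \<Longrightarrow> i \<notin> Fr \<Longrightarrow>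
      f i \<in> {0, 1} \<and> i \<noteq> 1 - f i \<and> (\<exists>k\<in>Z. p (f i) k = i \<and> rk k < rk i)"
    and free: "\<And>i a. i \<in> Z \<Longrightarrow> i \<in> Fr \<Longrightarrow> a \<in> {0, 1} \<Longrightarrow> i \<ge> 2 \<and> (\<exists>k\<in>Z. p a k = i)"
    and rk: "\<And>i. i \<in> Z \<Longrightarrow> rk i \<le> L"
  shows False
proof -
  define act where "act y i = (if i \<in> Fr then (if y 0 \<le> y 1 then 1 else 0) else f i)"
    for y :: "nat \<Rightarrow> real" and i
  \<comment> \<open>Word, masses and survivor are built together, because the greedy label depends
    on the current masses and the next position on the label.\<close>
  define nxt where "nxt s = (gstep id p (act (fst s) (snd s)) (fst s), SOME k. k \<in> Z \<and> p (act (fst s) (snd s)) k = snd s)"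
    for s
  define st where "st t = (nxt ^^ t) (\<lambda>k. of_bool (k \<noteq> i0), i0)" for t
  define w where "w t = act (fst (st t)) (snd (st t))" for t
  define j where "j t = snd (st t)" for t
  have j0: "j 0 = i0" by (simp add: j_def st_def)
  have st_Suc: "st (Suc t) = nxt (st t)" for t by (simp add: st_def)
  have y: "fst (st t) = other w j t" for t
  proof (induction t)
    case 0
    then show ?case by (simp add: other_def j0) (simp add: st_def)
  next
    case (Suc t)
    have "fst (st (Suc t)) = gstep id p (w t) (fst (st t))" by (simp add: st_Suc nxt_def w_def)
    moreover have "other w j t' = gval id p w (\<lambda>k. of_bool (k \<noteq> j 0)) t'" for t'
      by (rule ext) (simp add: other_def)
    ultimately show ?case unfolding Suc by simp
  qed
  have act01: "w t \<in> {0, 1}" and ex: "\<exists>k. k \<in> Z \<and> p (w t) k = j t" if "j t \<in> Z" for t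
    using forced[OF that] free[OF that, of 0] free[OF that, of 1] unfolding w_def act_def j_def by auto
  have jS: "j (Suc t) = (SOME k. k \<in> Z \<and> p (w t) k = j t)" for t
    by (simp add: j_def st_Suc nxt_def w_def)
  have jZ: "j t \<in> Z" for t
  proof (induction t)
    case (Suc t)
    then show ?case using someI_ex[OF ex[OF Suc]] by (simp add: jS)
  qed (simp add: j0 Z)
  have pj: "p (w t) (j (Suc t)) = j t" for t using someI_ex[OF ex[OF jZ]] by (simp add: jS)
  have S: "surviving w j"
    unfolding surviving_def binary_def
  proof (intro conjI allI)
    fix t
    show "w t = 0 \<or> w t = 1" using act01[OF jZ] by auto
    show "j t \<le> n" using jZ[of t] Z by auto
    show "p (w t) (j (Suc t)) = j t" by (rule pj)
    show "j t \<noteq> 1 - w t"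
    proof (cases "j t \<in> Fr")
      case True
      then show ?thesis using free[OF jZ, of t 0] by auto
    next
      case False
      then show ?thesis using forced[OF jZ False] by (simp add: w_def act_def j_def)
    qed
  qed
  define P where "P t = (\<Prod>k\<in>{0..n} - {j t}. other w j t k)" for t
  note step = other_prod_step[OF S, folded P_def]
  \<comment> \<open>A forced step lowers the rank and so doubles the second factor. A free step may
    reset the rank and lose up to \<open>2 ^ L\<close>, but the doubling of \<open>P\<close> gains
    \<open>2 ^ (L + 1)\<close>.\<close>
  have inv: "P t ^ (L + 1) * 2 ^ (L - rk (j t)) \<ge> 2 ^ t" for t
  proof (induction t)
    case 0
    have "(1::real) * 1 \<le> P 0 ^ (L + 1) * 2 ^ (L - rk (j 0))"
      using step(1)[of 0] by (intro mult_mono one_le_power) auto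
    then show ?case by simp
  next
    case (Suc t)
    have P0: "P t \<ge> 0" "P (Suc t) \<ge> 0" using step(1)[of t] step(1)[of "Suc t"] by linarith+
    show ?case
    proof (cases "j t \<in> Fr")
      case True
      have "other w j t (1 - w t) \<le> other w j t (w t)"
        using True by (auto simp: w_def act_def y j_def)
      moreover have "j t \<ge> 2" using free[OF jZ True, of 0] by simp
      ultimately have dbl: "2 * P t \<le> P (Suc t)" using step(3) by blast
      have "(2::real) ^ Suc t \<le> 2 * (P t ^ (L + 1) * 2 ^ (L - rk (j t)))" using Suc by simp
      also have "\<dots> \<le> 2 * (P t ^ (L + 1) * 2 ^ L)"
        using P0 by (intro mult_left_mono power_increasing) auto
      also have "\<dots> = (2 * P t) ^ (L + 1)" by (simp add: power_mult_distrib)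
      also have "\<dots> \<le> P (Suc t) ^ (L + 1)" using dbl P0 by (intro power_mono) auto
      also have "\<dots> \<le> P (Suc t) ^ (L + 1) * 2 ^ (L - rk (j (Suc t)))"
        using P0 mult_left_mono[of 1 "2 ^ (L - rk (j (Suc t)))" "P (Suc t) ^ (L + 1)"] by simp
      finally show ?thesis .
    next
      case False
      obtain k where k: "k \<in> Z" "p (f (j t)) k = j t" "rk k < rk (j t)" using forced[OF jZ False] by blast
      have "w t = f (j t)" using False by (simp add: w_def act_def j_def)
      then have "j (Suc t) = k" using k(2) pj[of t] p_inj[OF act01[OF jZ], of t] by metis
      then have "rk (j (Suc t)) < rk (j t)" using k(3) by simp
      then have r: "Suc (L - rk (j t)) \<le> L - rk (j (Suc t))" using rk[OF jZ, of t] by linarith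
      have "(2::real) ^ Suc t \<le> 2 * (P t ^ (L + 1) * 2 ^ (L - rk (j t)))" using Suc by simp
      also have "\<dots> = P t ^ (L + 1) * 2 ^ Suc (L - rk (j t))" by simp
      also have "\<dots> \<le> P (Suc t) ^ (L + 1) * 2 ^ (L - rk (j (Suc t)))"
        using P0 step(2) r by (intro mult_mono power_mono power_increasing) auto
      finally show ?thesis .
    qed
  qed
  show False
  proof (rule no_exponential_growth[of "n * (L + 1)" "1 / 2 ^ L"])
    fix M
    have fin: "finite ({0..n} - {j M})" and ne: "{0..n} - {j M} \<noteq> {}" and cd: "card ({0..n} - {j M}) = n"
    proof -
      have "j M \<in> {0..n}" using jZ[of M] Z by auto
      then show cd: "card ({0..n} - {j M}) = n" by simp
      show "{0..n} - {j M} \<noteq> {}" using cd n_pos by (metis card.empty not_one_le_zero)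
    qed simp
    have "other w j M k \<ge> 1" if "k \<in> {0..n} - {j M}" for k
      using other_ge_one[OF S, of k M] that by simp
    then obtain k where k: "k \<in> {0..n} - {j M}" "P M \<le> other w j M k ^ n"
      using prod_ge_of_all_ge[OF fin ne, of "other w j M"] unfolding cd P_def by meson
    have "(2::real) ^ M \<le> P M ^ (L + 1) * 2 ^ (L - rk (j M))" by (rule inv)
    also have "\<dots> \<le> (other w j M k ^ n) ^ (L + 1) * 2 ^ L"
      using k(2) step(1)[of M] by (intro mult_mono power_mono power_increasing) auto
    finally have "2 ^ M \<le> other w j M k ^ (n * (L + 1)) * 2 ^ L" unfolding power_mult .
    moreover have "1 / b * a \<le> x" if "a \<le> x * b" "b > 0" for a b x :: real
      using that by (simp add: field_simps)
    ultimately have "1 / 2 ^ L * 2 ^ M \<le> other w j M k ^ (n * (L + 1))" by simp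
    then show "\<exists>T\<ge>M. \<exists>w j k. surviving w j \<and> k \<le> n \<and> 1 / 2 ^ L * 2 ^ T \<le> other w j T k ^ (n * (L + 1))"
      using S k(1) by (intro exI[of _ M]) auto
  qed (use n_pos in auto)
qed

end
section \<open>The possible position maps\<close>

locale ordered_game = standard_game +
  assumes ordered: "\<And>a k. a \<in> {0, 1} \<Longrightarrow> k \<le> n \<Longrightarrow> p a k \<ge> 2 \<Longrightarrow> k < p a k"
begin

text \<open>The position to which the column in a given position moves; \<open>p a\<close> reads
  backwards, from new positions to old ones.\<close>

definition pos :: "nat \<Rightarrow> nat \<Rightarrow> nat" where "pos a = inv_into UNIV (p a)"

context
  fixes a :: nat
  assumes a: "a \<in> {0, 1}"
begin

lemma p_perm: "p a permutes {0..n}"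
  using a perm by auto

lemma p_pos: "p a (pos a j) = j" and pos_p: "pos a (p a j) = j"
  unfolding pos_def using permutes_inverses[OF p_perm] by auto

lemma pos_le: "j \<le> n \<Longrightarrow> pos a j \<le> n"
  unfolding pos_def using permutes_in_image[OF permutes_inv[OF p_perm], of j] by simp

lemma pos_eq_iff: "pos a i = pos a j \<longleftrightarrow> i = j"
  by (metis p_pos)

lemma pos_less: "2 \<le> j \<Longrightarrow> j \<le> n \<Longrightarrow> pos a j < j"
  using ordered[OF a pos_le, of j] by (simp add: p_pos)

lemma pos_eq_last: "\<exists>x\<in>{0, 1}. pos a x = n"
proof -
  have "p a n \<le> n" using p_le[OF a] by simp
  moreover have "\<not> p a n \<ge> 2" using pos_less[of "p a n"] calculation by (auto simp: pos_p)
  ultimately show ?thesis by (intro bexI[of _ "p a n"]) (auto simp: pos_p)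
qed

text \<open>One target among 0 and 1 is taken by \<open>x\<close>. Columns from inactive positions
  must move down, so 2 fills the other target, 3 fills the place left by 2, and so on. Only position
  \<open>n\<close> remains for the other active column.\<close>

lemma pos_chain:
  assumes n: "n \<ge> 2" and x: "x \<in> {0, 1}" "pos a x \<le> 1"
  shows "pos a 2 = 1 - pos a x" "\<And>j. 3 \<le> j \<Longrightarrow> j \<le> n \<Longrightarrow> pos a j = j - 1" "pos a (1 - x) = n"
proof -
  have x2: "x < 2" using x by auto
  have "pos a 2 < 2" "pos a 2 \<noteq> pos a x" using pos_less[of 2] n x2 pos_eq_iff by auto
  then show two: "pos a 2 = 1 - pos a x" using x(2) by linarith
  show "pos a j = j - 1" if "3 \<le> j" "j \<le> n" for j
    using that
  proof (induction j rule: less_induct)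
    case (less j)
    have lt: "pos a j < j" using pos_less less.prems by simp
    show ?case
    proof (rule ccontr)
      assume ne: "pos a j \<noteq> j - 1"
      consider "pos a j = pos a x" | "pos a j = pos a 2" | "pos a j \<ge> 2" using two x(2) by linarith
      then show False
      proof cases
        case 3
        then have "pos a (pos a j + 1) = pos a j" using less.IH[of "pos a j + 1"] lt ne less.prems by simp
        then show False using pos_eq_iff lt ne by simp
      qed (use pos_eq_iff x2 less.prems in auto)
    qed
  qed
  obtain z where "z \<in> {0, 1}" "pos a z = n" using pos_eq_last by blast
  moreover have "z \<noteq> x" using calculation(2) x(2) n by auto
  ultimately show "pos a (1 - x) = n" using x by auto
qed

end

lemma pos_chain_three:
  assumes n: "n \<ge> 3" and "pos 0 0 = 2" "pos 0 2 = 1"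
  shows "pos 0 3 = 0" "\<And>j. 4 \<le> j \<Longrightarrow> j \<le> n \<Longrightarrow> pos 0 j = j - 1" "pos 0 1 = n"
proof -
  have inj: "pos 0 i = pos 0 j \<longleftrightarrow> i = j" for i j by (rule pos_eq_iff) simp
  have "pos 0 3 < 3" using pos_less[of 0 3] n by simp
  moreover have "pos 0 3 \<noteq> 2" "pos 0 3 \<noteq> 1" using inj[of 3 0] inj[of 3 2] assms by auto
  ultimately show three: "pos 0 3 = 0" by linarith
  show "pos 0 j = j - 1" if "4 \<le> j" "j \<le> n" for j
    using that
  proof (induction j rule: less_induct)
    case (less j)
    have lt: "pos 0 j < j" using pos_less[of 0 j] less.prems by simp
    have "pos 0 j \<noteq> 0" "pos 0 j \<noteq> 1" "pos 0 j \<noteq> 2"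
      using inj[of j 0] inj[of j 2] inj[of j 3] assms three less.prems by auto
    then have ge: "pos 0 j \<ge> 3" by linarith
    show ?case
    proof (rule ccontr)
      assume ne: "pos 0 j \<noteq> j - 1"
      then have "pos 0 (pos 0 j + 1) = pos 0 j" using less.IH[of "pos 0 j + 1"] lt ge less.prems by simp
      then show False using inj lt ne by simp
    qed
  qed
  show "pos 0 1 = n" using pos_eq_last[of 0] assms by auto
qed

text \<open>
  If label 1 fixes position 1, the survivor has to avoid it; the case where label 0 moves it as in
  \<open>0 \<rightarrow> 2 \<rightarrow> 1\<close> leaves no freedom at all and needs explicit words.
\<close>

lemma no_parity_word:
  assumes "odd n" "n \<ge> 3" "pos 0 0 = 2" "pos 0 2 = 1"
  shows False
proof -
  note c = pos_chain_three[OF assms(2-4)]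
  \<comment> \<open>Colours alternate along the cycle 0, 2, 1, n, n - 1, ..., 3 of
    \<open>pos 0\<close>, whose length \<open>n + 1\<close> is even. The active positions 0 and 1
    are two steps apart, hence of equal colour.\<close>
  define d where "d k = (if k = 1 \<or> (even k \<and> k \<noteq> 2) then 0 else 1 :: nat)" for k :: nat
  have shift: "even (d (pos 0 j)) \<noteq> even (d j)" if "j \<le> n" for j
  proof -
    consider "j = 0" | "j = 1" | "j = 2" | "j = 3" | "j \<ge> 4" by linarith
    then show ?thesis
    proof cases
      case 2
      then show ?thesis using assms c(3) by (auto simp: d_def)
    next
      case 5
      then have "pos 0 j = j - 1" using c(2) that by simp
      then show ?thesis using 5 by (auto simp: d_def)
    qed (use assms c in \<open>auto simp: d_def\<close>)
  qed
  show False
  proof (rule no_separating_colouring[of "\<lambda>_. 0" "\<lambda>t k. even (d k + t)"])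
    show "even (d k + Suc t) = even (d (p 0 k) + t)" if "k \<le> n" for t k
      using shift[of "p 0 k"] p_le[of 0 k] that by (auto simp: pos_p)
    show "\<exists>k\<le>n. even (d k + 0)" by (intro exI[of _ 0]) (simp add: d_def)
    show "\<exists>k\<le>n. odd (d k + 0)" using assms(2) by (intro exI[of _ 2]) (simp add: d_def)
  qed (auto simp: binary_def d_def)
qed

text \<open>For even \<open>n\<close> the cycle of label 0 has odd length, so a parity colouring is
  impossible. Alternating labels instead carry the survivor back and forth between 0 and 2. In each
  pair of steps, label 1 puts a sum of two other columns into position \<open>n\<close>, which
  yields exponential growth.\<close>

lemma no_alternating_word:
  assumes "even n" "n \<ge> 2" "pos 0 0 = 2" "pos 0 2 = 1" "pos 1 1 = 1"
  shows False
proof -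
  define w where "w t = t mod 2" for t :: nat
  define j where "j t = (if even t then 0 else 2 :: nat)" for t :: nat
  note c1 = pos_chain[of 1 1, OF _ assms(2)]
  have p1: "p 1 0 = 2" "p 1 1 = 1" "p 1 n = 0" "\<And>k. 2 \<le> k \<Longrightarrow> k < n \<Longrightarrow> p 1 k = k + 1"
  proof -
    show "p 1 0 = 2" using c1(1) p_pos[of 1 2] assms by simp
    show "p 1 1 = 1" using p_pos[of 1 1] assms by simp
    show "p 1 n = 0" using c1(3) p_pos[of 1 0] assms by simp
    show "p 1 k = k + 1" if "2 \<le> k" "k < n" for k
      using c1(2)[of "k + 1"] p_pos[of 1 "k + 1"] assms that by simp
  qed
  have p0: "p 0 2 = 0" "p 0 1 = 2" "p 0 n = 1 \<or> n = 2" "n = 2 \<Longrightarrow> p 0 0 = 1"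
    "n \<ge> 3 \<Longrightarrow> p 0 0 = 3" "\<And>k. 3 \<le> k \<Longrightarrow> k < n \<Longrightarrow> p 0 k = k + 1"
  proof -
    show "p 0 2 = 0" "p 0 1 = 2" using p_pos[of 0 0] p_pos[of 0 2] assms by auto
    show "p 0 n = 1 \<or> n = 2" using pos_chain_three(3) p_pos[of 0 1] assms by (cases "n \<ge> 3") auto
    show "p 0 0 = 1" if "n = 2"
      using pos_eq_last[of 0] p_pos[of 0 1] pos_le[of 0 1] pos_eq_iff[of 0 1 0] pos_eq_iff[of 0 1 2] assms that
      by (metis One_nat_def insertCI le_Suc_eq le_zero_eq numeral_2_eq_2 zero_neq_one)
    show "p 0 0 = 3" if "n \<ge> 3" using pos_chain_three(1)[OF that] p_pos[of 0 3] assms by auto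
    show "p 0 k = k + 1" if "3 \<le> k" "k < n" for k
      using pos_chain_three(2)[of "k + 1"] p_pos[of 0 "k + 1"] assms that by auto
  qed
  have S: "surviving w j"
    unfolding surviving_def
  proof (intro conjI allI)
    show "binary w" by (auto simp: binary_def w_def)
    show "j t \<le> n" for t using assms(2) by (simp add: j_def)
    show "p (w t) (j (Suc t)) = j t" for t
      using p0(1) p1(1) by (cases "even t") (auto simp: w_def j_def odd_iff_mod_2_eq_one)
    show "j t \<noteq> 1 - w t" for t by (cases "even t") (auto simp: w_def j_def)
  qed
  define z where "z m k = other w j (2 * m) k" for m k
  have z1: "z m k \<ge> 1" if "k \<noteq> 0" for m k
    unfolding z_def using that by (intro other_ge_one[OF S]) (simp add: j_def)
  have z0: "z m 0 = 0" for m
    using other_survivor[OF S, of "2 * m"] by (simp add: z_def j_def)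
  have zS: "z (Suc m) k = z m (p 0 (p 1 k)) + (if p 1 k = 0 then z m 2 else 0)" for m k
  proof -
    have e: "other w j (Suc t) k = gstep id p (w t) (other w j t) k" for t k
    proof -
      have "other w j t' = gval id p w (\<lambda>k. of_bool (k \<noteq> j 0)) t'" for t'
        by (rule ext) (simp add: other_def)
      then show ?thesis by simp
    qed
    have a: "other w j (Suc (2 * m)) k = z m (p 0 k)" for k
      unfolding e using z0[of m] by (simp add: gstep_def w_def z_def)
    have "z (Suc m) k = gstep id p 1 (other w j (Suc (2 * m))) k"
      unfolding z_def using e[of "Suc (2 * m)" k] by (simp add: w_def)
    then show ?thesis using p0(2) by (simp add: gstep_def a)
  qed
  \<comment> \<open>The number of pairs of steps in tracing position \<open>k\<close> back to
    \<open>n\<close> by \<open>k -> p 0 (p 1 k)\<close>. Even positions climb by 2 to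
    \<open>n\<close>; odd ones from 3 on climb to \<open>n - 1\<close> and continue through 1 and 2.
    On positions 1 to \<open>n\<close> it is at most \<open>n - 1\<close>.\<close>
  define h where "h k = (if k = 1 then n div 2 else if even k then (n - k) div 2 else (n - 1 - k) div 2 + 1 + n div 2)" for k
  have main: "z m k ^ n \<ge> 2 ^ (m - h k)" if "1 \<le> k" "k \<le> n" for m k
    using that
  proof (induction m arbitrary: k)
    case 0
    then show ?case using z1[of k 0] by (simp add: one_le_power)
  next
    case (Suc m)
    obtain l where l: "n = 2 * l" using assms(1) by (elim evenE)
    have step: "z (Suc m) k ^ n \<ge> 2 ^ (Suc m - h k)"
      if kk: "1 \<le> k'" "k' \<le> n" "z (Suc m) k \<ge> z m k'" "h k = Suc (h k')" for k'
    proof -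
      have "(2::real) ^ (Suc m - h k) \<le> z m k' ^ n" using Suc.IH[OF kk(1,2)] kk(4) by simp
      also have "\<dots> \<le> z (Suc m) k ^ n" using kk(3) z1[of k' m] kk(1) by (intro power_mono) auto
      finally show ?thesis .
    qed
    have zmono: "z (Suc m) k \<ge> z m (p 0 (p 1 k))" using z1[of 2 m] by (simp add: zS)
    show ?case
    proof (cases "k = n")
      case True
      let ?i = "p 0 0"
      have i: "1 \<le> ?i" "?i \<le> n" "h ?i \<le> n - 1"
        using p0(4,5) assms(2) l by (cases "n = 2"; auto simp: h_def)+
      have h2: "h 2 \<le> n - 1" using l by (simp add: h_def)
      have lower: "z m i ^ n \<ge> 2 ^ (m - (n - 1))" if "1 \<le> i" "i \<le> n" "h i \<le> n - 1" for i
      proof -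
        have "(2::real) ^ (m - (n - 1)) \<le> 2 ^ (m - h i)" using that by (intro power_increasing) auto
        then show ?thesis using Suc.IH[OF that(1,2)] by linarith
      qed
      \<comment> \<open>Both summands are at most \<open>n - 1\<close> rounds behind. Doubling gains
        \<open>2 ^ n\<close> in the \<open>n\<close>-th power, which makes up for this delay and the
        present round.\<close>
      define y where "y = min (z m ?i) (z m 2)"
      have y: "y \<ge> 0" "y ^ n \<ge> 2 ^ (m - (n - 1))"
        using lower[OF i] lower[OF _ assms(2) h2] z1[of ?i m] z1[of 2 m] i by (auto simp: y_def min_def)
      have zk: "z (Suc m) k = z m ?i + z m 2" using zS[of m k] p1(3) True by simp
      have hn: "h n = 0" using assms by (simp add: h_def)
      have "(2::real) ^ Suc m \<le> 2 ^ (n + (m - (n - 1)))" using assms(2) by (intro power_increasing) auto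
      also have "\<dots> \<le> 2 ^ n * y ^ n" using y by (simp add: power_add)
      also have "\<dots> = (2 * y) ^ n" by (simp add: power_mult_distrib)
      also have "\<dots> \<le> z (Suc m) k ^ n" unfolding zk using y by (intro power_mono) (auto simp: y_def)
      finally show ?thesis using True hn by simp
    next
      case False
      consider "k = 1" | "2 \<le> k" "k + 2 \<le> n" | "k = n - 1" "k \<ge> 2" using Suc.prems False by linarith
      then show ?thesis
      proof cases
        case 1
        then show ?thesis using step[of 2] zmono p1(2) p0(2) assms(2) l by (simp add: h_def)
      next
        case 2
        have "p 0 (p 1 k) = k + 2" using p1(4)[of k] p0(6)[of "k + 1"] 2 by simp
        moreover have "h k = Suc (h (k + 2))" using 2 l
          by (auto simp: h_def elim!: oddE evenE; presburger)
        ultimately show ?thesis using step[of "k + 2"] zmono 2 by simp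
      next
        case 3
        have "p 0 (p 1 k) = 1" using p1(4)[of k] p0(3) 3 by auto
        moreover have "h k = Suc (h 1)" using 3 l by (auto simp: h_def)
        ultimately show ?thesis using step[of 1] zmono 3 by simp
      qed
    qed
  qed
  show False
  proof (rule no_exponential_growth[of "2 * n" "1 / 2 ^ (2 * n)"])
    fix M
    have "(2::real) ^ M \<le> 2 ^ (M - h n + h n)" by (intro power_increasing) auto
    have hn: "h n = 0" using assms by (simp add: h_def)
    have "(2 ^ M)\<^sup>2 \<le> (z M n ^ n)\<^sup>2" using main[of n M] assms(2) hn by (intro power_mono) auto
    then have "2 ^ (2 * M) \<le> z M n ^ (2 * n)" by (simp add: power_mult[symmetric] mult.commute)
    moreover have "1 / 2 ^ (2 * n) * 2 ^ (2 * M) \<le> (2::real) ^ (2 * M)" by (simp add: field_simps)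
    ultimately have "1 / 2 ^ (2 * n) * 2 ^ (2 * M) \<le> other w j (2 * M) n ^ (2 * n)" unfolding z_def by linarith
    then show "\<exists>T\<ge>M. \<exists>w j k. surviving w j \<and> k \<le> n \<and> 1 / 2 ^ (2 * n) * 2 ^ T \<le> other w j T k ^ (2 * n)"
      using S by (intro exI[of _ "2 * M"]) auto
  qed (use assms in auto)
qed

text \<open>Otherwise a survivor in position 0 can be moved to an inactive position, and the aim is
  to make it return forever to places where either label keeps it alive.\<close>

lemma pos_zero_le_one: "pos 0 0 \<le> 1"
proof (rule ccontr)
  assume "\<not> pos 0 0 \<le> 1"
  then have q: "pos 0 0 \<ge> 2" by simp
  have qn: "pos 0 0 \<le> n" by (rule pos_le) auto
  then have n: "n \<ge> 2" using q by simp
  show False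
  proof (cases "pos 1 1 = 1")
    case False
    \<comment> \<open>Position 0 is left for an inactive position at once; position 1 may pass
      through 0 first.\<close>
    let ?rk = "\<lambda>i. if i = 0 then 1 else if i = 1 then 2 else 0 :: nat"
    have fo: "\<exists>k\<in>{0..n}. p i k = i \<and> ?rk k < ?rk i" if "i \<in> {0, 1}" for i
      using that q False pos_le[of i i] p_pos[of i i] n by (intro bexI[of _ "pos i i"]) auto
    have fr: "\<exists>k\<in>{0..n}. p a k = i" if "a \<in> {0, 1}" "i \<in> {0..n}" for a i
      using that pos_le[of a i] p_pos[of a i] by (intro bexI[of _ "pos a i"]) auto
    show False
    proof (rule no_greedy_strategy[of "{0..n}" 0 "{2..}" id ?rk 2])
      fix i assume i: "i \<in> {0..n}" "i \<notin> {2..}"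
      then have "i \<in> {0, 1}" by auto
      then show "id i \<in> {0, 1} \<and> i \<noteq> 1 - id i \<and> (\<exists>k\<in>{0..n}. p (id i) k = i \<and> ?rk k < ?rk i)"
        using fo[of i] by auto
    next
      show "2 \<le> i \<and> (\<exists>k\<in>{0..n}. p a k = i)" if "i \<in> {0..n}" "i \<in> {2..}" "a \<in> {0, 1}" for i a
        using fr[OF that(3,1)] that(2) by simp
    qed auto
  next
    case True
    note c = pos_chain[of 1 1, OF _ n, unfolded True]
    have c2: "pos 1 2 = 0" and c3: "\<And>j. 3 \<le> j \<Longrightarrow> j \<le> n \<Longrightarrow> pos 1 j = j - 1"
      using c by auto
    \<comment> \<open>Position 1 is a trap: a survivor there needs label 1, which fixes it. On the
      rest, label 1 leads down to 2 and then to 0, from where label 0 leads up again.\<close>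
    let ?Z = "{0..n} - {1}"
    let ?f = "\<lambda>i. if i = 0 then 0 else 1 :: nat"
    have down: "\<exists>k\<in>?Z. p 1 k = i \<and> k = (if i = 2 then 0 else i - 1)" if "2 \<le> i" "i \<le> n" for i
    proof (intro bexI[of _ "pos 1 i"] conjI)
      show pi: "pos 1 i = (if i = 2 then 0 else i - 1)" using c2 c3[of i] that by simp
      show "p 1 (pos 1 i) = i" by (rule p_pos) simp
      show "pos 1 i \<in> ?Z" unfolding pi using that by auto
    qed
    have up: "pos 0 0 \<in> ?Z" "p 0 (pos 0 0) = 0"
      using q qn p_pos[of 0 0] by auto
    have pos2: "pos 0 2 = 0 \<or> pos 0 2 = 1" using pos_less[of 0 2] n by auto
    \<comment> \<open>A free position has to stay outside the trap under both labels. Position 2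
      serves unless label 0 sends it to 1; then 3 serves, provided that the survivor jumps from 0 to
      3 or beyond. Otherwise it bypasses 3.\<close>
    consider (a) "pos 0 2 = 0" | (b) "pos 0 2 = 1" "pos 0 0 \<ge> 3" | (c) "pos 0 2 = 1" "pos 0 0 = 2"
      using q pos2 by linarith
    then show False
    proof cases
      case a
      let ?rk = "\<lambda>i. if i = 0 then n else i - 2"
      have fr: "\<exists>k\<in>?Z. p b k = 2" if "b \<in> {0, 1}" for b
        using that a p_pos[of 0 2] c2 p_pos[of 1 2] by (intro bexI[of _ 0]) auto
      show False
      proof (rule no_greedy_strategy[of ?Z 0 "{2}" ?f ?rk n])
        fix i assume i: "i \<in> ?Z" "i \<notin> {2}"
        show "?f i \<in> {0, 1} \<and> i \<noteq> 1 - ?f i \<and> (\<exists>k\<in>?Z. p (?f i) k = i \<and> ?rk k < ?rk i)"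
        proof (cases "i = 0")
          case True
          then show ?thesis using up q qn by (intro conjI bexI[of _ "pos 0 0"]) auto
        next
          case False
          then have i2: "2 \<le> i" "i \<le> n" using i(1) by auto
          then have k: "(if i = 2 then 0 else i - 1) \<in> ?Z" "p 1 (if i = 2 then 0 else i - 1) = i"
            using down by metis+
          show ?thesis
          proof (intro conjI bexI)
            show "p (?f i) (if i = 2 then 0 else i - 1) = i" using k(2) False by simp
            show "?rk (if i = 2 then 0 else i - 1) < ?rk i" using i i2 by auto
          qed (use k False i2 in simp_all)
        qed
      next
        show "2 \<le> i \<and> (\<exists>k\<in>?Z. p b k = i)" if "i \<in> ?Z" "i \<in> {2}" "b \<in> {0, 1}" for i b
          using fr[OF that(3)] that(2) by simp
      qed auto
    next
      case b
      let ?rk = "\<lambda>i. if i = 0 then n else if i = 2 then n + 1 else i - 3"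
      have n3: "n \<ge> 3" using b qn by simp
      have "pos 0 3 < 3" using pos_less[of 0 3] n3 by simp
      moreover have "pos 0 3 \<noteq> 1" using pos_eq_iff[of 0 3 2] b by auto
      ultimately have "pos 0 3 \<in> ?Z" using n3 by auto
      then have "\<exists>k\<in>?Z. p 0 k = 3" using p_pos[of 0 3] by (intro bexI[of _ "pos 0 3"]) auto
      then have fr: "\<exists>k\<in>?Z. p b k = 3" if "b \<in> {0, 1}" for b
      proof (cases "b = 0")
        case False
        then show ?thesis using that down[of 3] n3 by auto
      qed (use \<open>\<exists>k\<in>?Z. p 0 k = 3\<close> in simp)
      show False
      proof (rule no_greedy_strategy[of ?Z 0 "{3}" ?f ?rk "n + 1"])
        fix i assume i: "i \<in> ?Z" "i \<notin> {3}"
        show "?f i \<in> {0, 1} \<and> i \<noteq> 1 - ?f i \<and> (\<exists>k\<in>?Z. p (?f i) k = i \<and> ?rk k < ?rk i)"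
        proof (cases "i = 0")
          case True
          then show ?thesis using up b qn by (intro conjI bexI[of _ "pos 0 0"]) auto
        next
          case False
          then have i2: "2 \<le> i" "i \<le> n" using i(1) by auto
          then have k: "(if i = 2 then 0 else i - 1) \<in> ?Z" "p 1 (if i = 2 then 0 else i - 1) = i"
            using down by metis+
          show ?thesis
          proof (intro conjI bexI)
            show "p (?f i) (if i = 2 then 0 else i - 1) = i" using k(2) False by simp
            show "?rk (if i = 2 then 0 else i - 1) < ?rk i" using i i2 by auto
          qed (use k False i2 in simp_all)
        qed
      next
        show "2 \<le> i \<and> (\<exists>k\<in>?Z. p b k = i)" if "i \<in> ?Z" "i \<in> {3}" "b \<in> {0, 1}" for i b
          using fr[OF that(3)] that(2) by simp
      qed auto
    next
      case c
      show False
      proof (cases "even n")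
        case e: True
        show ?thesis using no_alternating_word[OF e n c(2,1) True] .
      next
        case False
        then have "n \<ge> 3" using n by (cases "n = 2") auto
        then show ?thesis using no_parity_word[OF False _ c(2,1)] by simp
      qed
    qed
  qed
qed

end

section \<open>Normal form of the position maps\<close>

definition flip :: "nat \<Rightarrow> nat" where
  "flip k = (if k = 0 then 1 else if k = 1 then 0 else k)"

text \<open>Column \<open>k\<close> of \<open>M0 n\<close> and \<open>M1 n\<close> is, up to the added column, the basis vector \<open>std_perm n a k\<close>.\<close>

definition std_perm :: "nat \<Rightarrow> nat \<Rightarrow> nat \<Rightarrow> nat" where
  "std_perm n a k = (if k > n then k
     else if a = 0 then if k = 0 then 0 else if k = n then 1 else k + 1
     else if k = n then 0 else k + 1)"

lemma flip_flip [simp]: "flip (flip k) = k" and flip_comp: "flip \<circ> flip = id"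
  by (auto simp: flip_def fun_eq_iff)

lemma inv_flip: "inv_into UNIV flip = flip"
  by (rule inv_unique_comp) (auto simp: flip_comp)

lemma flip_permutes: "n \<ge> 1 \<Longrightarrow> flip permutes {0..n}"
  by (rule bij_imp_permutes) (auto simp: flip_def bij_betw_def inj_on_def image_iff split: if_splits)

context ordered_game
begin

text \<open>Exchanging both the active positions and the labels gives a game of the same kind, so
  what holds for label 0 at position 0 transfers to label 1 at position 1.\<close>

lemma mirror: "ordered_game n (\<lambda>a. inv_into UNIV flip \<circ> p (1 - a) \<circ> flip)"
proof -
  let ?p = "\<lambda>a. inv_into UNIV flip \<circ> p (1 - a) \<circ> flip"
  note g = flip_permutes[OF n_pos]
  have "?p 0 permutes {0..n}" "?p 1 permutes {0..n}"
    using g perm by (auto intro!: permutes_compose permutes_inv)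
  moreover have "uniformly_contractive n id ?p"
    by (rule uniformly_contractive_relabel[where g = flip and n = n and b = "\<lambda>a. 1 - a" and u' = id and u = id and p = p,
        OF g _ _ uc]) (auto simp: flip_def)
  moreover have "k < ?p a k" if "a \<in> {0, 1}" "k \<le> n" "?p a k \<ge> 2" for a k
  proof -
    have ge: "p (1 - a) (flip k) \<ge> 2" using that(3) by (auto simp: inv_flip flip_def split: if_splits)
    then have eq: "?p a k = p (1 - a) (flip k)" by (auto simp: inv_flip flip_def)
    have "flip k \<le> n" using permutes_in_image[OF g, of k] that(2) by simp
    then have "flip k < p (1 - a) (flip k)" using ordered[of "1 - a" "flip k"] ge that(1) by auto
    then show ?thesis unfolding eq using ge by (cases "k \<ge> 2") (auto simp: flip_def)
  qed
  ultimately show ?thesis using u by unfold_locales auto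
qed

lemma pos_one_le_one: "pos 1 1 \<le> 1"
proof -
  let ?p = "\<lambda>a. inv_into UNIV flip \<circ> p (1 - a) \<circ> flip"
  interpret m: ordered_game n ?p by (rule mirror)
  have "?p 0 (m.pos 0 0) = 0" by (rule m.p_pos) simp
  then have "p 1 (flip (m.pos 0 0)) = flip 0" by (simp add: inv_flip) (metis flip_flip)
  then have "p 1 (flip (m.pos 0 0)) = 1" by (simp add: flip_def)
  then have "pos 1 1 = flip (m.pos 0 0)" using pos_p[of 1 "flip (m.pos 0 0)"] by simp
  then show ?thesis using m.pos_zero_le_one by (simp add: flip_def)
qed

text \<open>As the kept column stays active, the only choice left is which of the positions 0 and 1
  it takes; \<open>pos_chain\<close> determines the rest. The two choices differ by
  \<open>flip\<close> on the new positions.\<close>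

theorem position_maps:
  assumes a: "a \<in> {0, 1}"
  shows "\<exists>f\<in>{id, flip}. \<forall>k\<le>n. p a k = std_perm n a (f k)"
proof -
  define b where "b = pos a a"
  have b: "b \<in> {0, 1}"
    using a pos_zero_le_one pos_one_le_one unfolding b_def by auto
  have pb: "p a b = a" unfolding b_def using a by (rule p_pos)
  let ?f = "if b = 0 then id else flip"
  have "p a k = std_perm n a (?f k)" if k: "k \<le> n" for k
  proof (cases "n = 1")
    case True
    have "p a (1 - b) \<le> 1" using p_le[OF a, of "1 - b"] True b by auto
    moreover have "p a (1 - b) \<noteq> a" using p_inj[OF a, of "1 - b" b] b pb by auto
    ultimately have pb': "p a (1 - b) = 1 - a" using a by auto
    have "k = b \<or> k = 1 - b" using k True b by auto
    then show ?thesis using pb pb' True a b by (auto simp: std_perm_def flip_def)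
  next
    case False
    then have n: "n \<ge> 2" using n_pos by simp
    have le: "pos a a \<le> 1" using b unfolding b_def by auto
    note c = pos_chain[OF a n a le, folded b_def]
    have p2: "p a (1 - b) = 2" using p_pos[OF a, of 2] c(1) by simp
    have pn: "p a n = 1 - a" using p_pos[OF a, of "1 - a"] c(3) by simp
    have pk: "p a k = k + 1" if "2 \<le> k" "k < n" for k
      using p_pos[OF a, of "k + 1"] c(2)[of "k + 1"] that by simp
    consider "k = b" | "k = 1 - b" | "k = n" "k \<ge> 2" | "2 \<le> k" "k < n" using k b by auto linarith+
    then show ?thesis
    proof cases
      case 1
      then show ?thesis using pb a b n by (auto simp: std_perm_def flip_def)
    next
      case 2
      then show ?thesis using p2 a b n by (auto simp: std_perm_def flip_def)
    next
      case 3
      then show ?thesis using pn a b by (auto simp: std_perm_def flip_def)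
    next
      case 4
      then show ?thesis using pk[OF 4] a b by (auto simp: std_perm_def flip_def)
    qed
  qed
  then show ?thesis by (intro bexI[of _ ?f]) auto
qed

end

theorem (in contractive_game) relabelled_maps:
  "\<exists>g. g permutes {0..n} \<and> g 0 = u 0 \<and> g 1 = u 1 \<and>
     (\<forall>a\<in>{0, 1}. \<exists>f\<in>{id, flip}. \<forall>k\<le>n. (inv_into UNIV g \<circ> p a \<circ> g) k = std_perm n a (f k))"
proof -
  obtain g where g: "g permutes {0..n}" "g 0 = u 0" "g 1 = u 1"
    and c: "contractive_game n id (\<lambda>a. inv_into UNIV g \<circ> p a \<circ> g)"
    and o: "\<forall>a\<in>{0, 1}. \<forall>k\<le>n. (inv_into UNIV g \<circ> p a \<circ> g) k \<ge> 2 \<longrightarrow> k < (inv_into UNIV g \<circ> p a \<circ> g) k"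
    using ordered_relabelling by metis
  interpret contractive_game n id "\<lambda>a. inv_into UNIV g \<circ> p a \<circ> g" by (rule c)
  interpret ordered_game n "\<lambda>a. inv_into UNIV g \<circ> p a \<circ> g"
    by unfold_locales (use o in blast)
  show ?thesis using g position_maps by metis
qed

section \<open>Projective action and nested simplices\<close>

text \<open>Having no zero column makes the normalisation in \<open>proj_act\<close> meaningful on
  the whole simplex, and the property passes to products.\<close>

definition pos_mat :: "nat \<Rightarrow> int mat \<Rightarrow> bool" where
  "pos_mat n A \<longleftrightarrow> A \<in> carrier_mat (n + 1) (n + 1) \<and> (\<forall>i\<le>n. \<forall>j\<le>n. 0 \<le> A $$ (i, j)) \<and>
     (\<forall>j\<le>n. \<exists>i\<le>n. 0 < A $$ (i, j))"

definition col_sum :: "nat \<Rightarrow> int mat \<Rightarrow> nat \<Rightarrow> real" where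
  "col_sum n A j = (\<Sum>i\<le>n. real_of_int (A $$ (i, j)))"

lemma pos_matD:
  assumes "pos_mat n A"
  shows "A \<in> carrier_mat (n + 1) (n + 1)" "dim_row A = n + 1" "dim_col A = n + 1"
    "\<And>i j. i \<le> n \<Longrightarrow> j \<le> n \<Longrightarrow> 0 \<le> A $$ (i, j)" "\<And>j. j \<le> n \<Longrightarrow> col_sum n A j \<ge> 1"
proof -
  show 0: "\<And>i j. i \<le> n \<Longrightarrow> j \<le> n \<Longrightarrow> 0 \<le> A $$ (i, j)" using assms by (auto simp: pos_mat_def)
  show "col_sum n A j \<ge> 1" if "j \<le> n" for j
  proof -
    obtain i where i: "i \<le> n" "0 < A $$ (i, j)" using assms \<open>j \<le> n\<close> unfolding pos_mat_def by blast
    have "real_of_int (A $$ (i, j)) \<le> col_sum n A j"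
      unfolding col_sum_def
    proof (rule member_le_sum)
      show "0 \<le> real_of_int (A $$ (k, j))" if "k \<in> {..n} - {i}" for k
        using 0[of k j] that \<open>j \<le> n\<close> by simp
    qed (use i in auto)
    moreover have "1 \<le> A $$ (i, j)" using i by simp
    ultimately show ?thesis by linarith
  qed
qed (use assms in \<open>auto simp: pos_mat_def\<close>)

lemma lin_act_eq:
  "A \<in> carrier_mat (n + 1) (n + 1) \<Longrightarrow>
    lin_act A x i = (if i \<le> n then \<Sum>j\<le>n. real_of_int (A $$ (i, j)) * x j else 0)"
  by (auto simp: lin_act_def lessThan_Suc_atMost)

lemma mult_index:
  fixes A B :: "int mat"
  assumes "A \<in> carrier_mat (n + 1) (n + 1)" "B \<in> carrier_mat (n + 1) (n + 1)" "i \<le> n" "k \<le> n"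
  shows "(A * B) $$ (i, k) = (\<Sum>j\<le>n. A $$ (i, j) * B $$ (j, k))"
  using assms by (auto simp: scalar_prod_def atLeast0LessThan lessThan_Suc_atMost intro!: sum.cong)

lemma lin_act_mult:
  assumes "A \<in> carrier_mat (n + 1) (n + 1)" "B \<in> carrier_mat (n + 1) (n + 1)"
  shows "lin_act (A * B) x = lin_act A (lin_act B x)"
proof
  fix i
  have AB: "A * B \<in> carrier_mat (n + 1) (n + 1)" using assms by (rule mult_carrier_mat)
  show "lin_act (A * B) x i = lin_act A (lin_act B x) i"
  proof (cases "i \<le> n")
    case True
    have "lin_act (A * B) x i = (\<Sum>k\<le>n. (\<Sum>j\<le>n. real_of_int (A $$ (i, j)) * real_of_int (B $$ (j, k))) * x k)"
      unfolding lin_act_eq[OF AB] using True by (auto simp: mult_index[OF assms] intro!: sum.cong)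
    also have "\<dots> = (\<Sum>j\<le>n. real_of_int (A $$ (i, j)) * (\<Sum>k\<le>n. real_of_int (B $$ (j, k)) * x k))"
      unfolding sum_distrib_left sum_distrib_right by (subst sum.swap) (simp add: mult.assoc)
    also have "\<dots> = lin_act A (lin_act B x) i"
      unfolding lin_act_eq[OF assms(1)] using True by (auto simp: lin_act_eq[OF assms(2)] intro!: sum.cong)
    finally show ?thesis .
  next
    case False
    then show ?thesis by (simp add: lin_act_eq[OF AB] lin_act_eq[OF assms(1)])
  qed
qed

lemma simplexD:
  assumes "x \<in> standard_simplex n"
  shows "x i \<ge> 0" "x i \<le> 1" "i > n \<Longrightarrow> x i = 0" "(\<Sum>i\<le>n. x i) = 1"
  using assms by (auto simp: standard_simplex_def)

lemma simplexI:
  assumes "\<And>i. x i \<ge> 0" "\<And>i. i > n \<Longrightarrow> x i = 0" "(\<Sum>i\<le>n. x i) = 1"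
  shows "x \<in> standard_simplex n"
proof -
  have "x i \<le> 1" for i
  proof (cases "i \<le> n")
    case True
    then have "x i \<le> (\<Sum>i\<le>n. x i)" using assms(1) member_le_sum[of i "{..n}" x] by simp
    then show ?thesis using assms by simp
  qed (use assms in auto)
  then show ?thesis using assms by (auto simp: standard_simplex_def)
qed

lemma sum_lin_act:
  assumes "A \<in> carrier_mat (n + 1) (n + 1)"
  shows "(\<Sum>i\<le>n. lin_act A x i) = (\<Sum>j\<le>n. col_sum n A j * x j)"
  unfolding lin_act_eq[OF assms] col_sum_def sum_distrib_right
  by (subst sum.swap) (auto intro!: sum.cong)

context
  fixes n A
  assumes A: "pos_mat n A"
begin

lemma lin_act_nonneg: "x \<in> standard_simplex n \<Longrightarrow> lin_act A x i \<ge> 0"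
  using pos_matD(4)[OF A] by (auto simp: lin_act_eq[OF pos_matD(1)[OF A]] simplexD intro!: sum_nonneg)

lemma sum_lin_act_ge: "x \<in> standard_simplex n \<Longrightarrow> (\<Sum>i\<le>n. lin_act A x i) \<ge> 1"
proof -
  assume x: "x \<in> standard_simplex n"
  have "(\<Sum>j\<le>n. 1 * x j) \<le> (\<Sum>j\<le>n. col_sum n A j * x j)"
    using pos_matD(5)[OF A] simplexD(1)[OF x] by (intro sum_mono mult_right_mono) auto
  then show ?thesis using simplexD(4)[OF x] by (simp add: sum_lin_act[OF pos_matD(1)[OF A]])
qed

lemma proj_act_eq:
  "x \<in> standard_simplex n \<Longrightarrow> proj_act A x i = lin_act A x i / (\<Sum>k\<le>n. lin_act A x k)"
  using lin_act_nonneg pos_matD(2)[OF A] by (simp add: proj_act_def lessThan_Suc_atMost)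

lemma proj_act_in: "x \<in> standard_simplex n \<Longrightarrow> proj_act A x \<in> standard_simplex n"
proof (rule simplexI)
  assume x: "x \<in> standard_simplex n"
  note S = sum_lin_act_ge[OF x]
  show "proj_act A x i \<ge> 0" for i
    unfolding proj_act_eq[OF x] using lin_act_nonneg[OF x] S by (intro divide_nonneg_nonneg) auto
  show "proj_act A x i = 0" if "i > n" for i
    unfolding proj_act_eq[OF x] using that by (simp add: lin_act_eq[OF pos_matD(1)[OF A]])
  show "(\<Sum>i\<le>n. proj_act A x i) = 1"
    unfolding proj_act_eq[OF x] sum_divide_distrib[symmetric] using S by simp
qed

lemma proj_act_scale:
  assumes "c > 0" shows "proj_act A (\<lambda>i. x i / c) = proj_act A x"
proof -
  have "lin_act A (\<lambda>i. x i / c) = (\<lambda>i. lin_act A x i / c)"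
    by (rule ext) (simp add: lin_act_eq[OF pos_matD(1)[OF A]] sum_divide_distrib)
  then show ?thesis using assms
    by (simp add: proj_act_def sum_divide_distrib[symmetric] abs_divide)
qed

lemma continuous_proj_act: "continuous_on (standard_simplex n) (proj_act A)"
proof (rule continuous_on_coordinatewise_then_product)
  fix i
  have c: "continuous_on (standard_simplex n) (\<lambda>x. lin_act A x k)" for k
    unfolding lin_act_eq[OF pos_matD(1)[OF A]]
    by (cases "k \<le> n") (auto intro!: continuous_intros continuous_on_subset[OF continuous_on_product_coordinates])
  have "continuous_on (standard_simplex n) (\<lambda>x. lin_act A x i / (\<Sum>k\<le>n. lin_act A x k))"
    using sum_lin_act_ge by (intro continuous_intros c) fastforce
  then show "continuous_on (standard_simplex n) (\<lambda>x. proj_act A x i)"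
    by (rule continuous_on_eq) (simp add: proj_act_eq)
qed

lemma proj_act_vertex:
  assumes "k \<le> n"
  shows "proj_act A (\<lambda>j. if j = k then 1 else 0) i = (if i \<le> n then real_of_int (A $$ (i, k)) / col_sum n A k else 0)"
proof -
  have x: "(\<lambda>j. if j = k then 1 else 0) \<in> standard_simplex n" using assms by simp
  show ?thesis unfolding proj_act_eq[OF x] sum_lin_act[OF pos_matD(1)[OF A]]
    using assms by (simp add: lin_act_eq[OF pos_matD(1)[OF A]] if_distrib[of "\<lambda>x. _ * x"] cong: if_cong)
qed

text \<open>The image point is a convex combination of the normalised columns, with weights
  proportional to \<open>col_sum n A k * x k\<close>.\<close>

lemma proj_act_between:
  assumes x: "x \<in> standard_simplex n" and i: "i \<le> n"
    and b: "\<And>k. k \<le> n \<Longrightarrow> lo \<le> A $$ (i, k) / col_sum n A k \<and> A $$ (i, k) / col_sum n A k \<le> hi"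
  shows "lo \<le> proj_act A x i \<and> proj_act A x i \<le> hi"
proof -
  define S where "S = (\<Sum>k\<le>n. lin_act A x k)"
  have S: "S \<ge> 1" unfolding S_def by (rule sum_lin_act_ge[OF x])
  have S2: "S = (\<Sum>j\<le>n. col_sum n A j * x j)" unfolding S_def by (rule sum_lin_act[OF pos_matD(1)[OF A]])
  have L: "lin_act A x i = (\<Sum>j\<le>n. A $$ (i, j) * x j)" using i by (simp add: lin_act_eq[OF pos_matD(1)[OF A]])
  have b': "lo * col_sum n A k \<le> A $$ (i, k) \<and> A $$ (i, k) \<le> hi * col_sum n A k" if "k \<le> n" for k
    using b[OF that] pos_matD(5)[OF A that] by (simp add: field_simps)
  have "lo * S \<le> lin_act A x i" "lin_act A x i \<le> hi * S"
    unfolding L S2 sum_distrib_left mult.assoc[symmetric]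
    using b' simplexD(1)[OF x] by (auto intro!: sum_mono mult_right_mono)
  then show ?thesis using S unfolding proj_act_eq[OF x] S_def[symmetric] by (simp add: field_simps)
qed

end

lemma compact_simplex: "compact (standard_simplex n)"
  using compactin_standard_simplex[of n] by (simp only: euclidean_product_topology compactin_euclidean_iff)

lemma proj_act_mult:
  assumes A: "pos_mat n A" and B: "pos_mat n B" and x: "x \<in> standard_simplex n"
  shows "proj_act (A * B) x = proj_act A (proj_act B x)"
proof -
  have "proj_act (A * B) x = proj_act A (lin_act B x)"
    unfolding proj_act_def lin_act_mult[OF pos_matD(1)[OF A] pos_matD(1)[OF B]] by simp
  also have "\<dots> = proj_act A (\<lambda>i. lin_act B x i / (\<Sum>k\<le>n. lin_act B x k))"
    using proj_act_scale[OF A] sum_lin_act_ge[OF B x] by simp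
  also have "\<dots> = proj_act A (proj_act B x)"
    using proj_act_eq[OF B x] by presburger
  finally show ?thesis .
qed

lemma pos_mat_mult:
  assumes A: "pos_mat n A" and B: "pos_mat n B"
  shows "pos_mat n (A * B)"
  unfolding pos_mat_def
proof (intro conjI allI impI)
  note c = pos_matD(1)[OF A] pos_matD(1)[OF B]
  show "A * B \<in> carrier_mat (n + 1) (n + 1)" using c by (rule mult_carrier_mat)
  show "0 \<le> (A * B) $$ (i, j)" if "i \<le> n" "j \<le> n" for i j
    unfolding mult_index[OF c that] using that pos_matD(4)[OF A] pos_matD(4)[OF B] by (intro sum_nonneg) auto
  fix j assume j: "j \<le> n"
  obtain k where k: "k \<le> n" "0 < B $$ (k, j)" using B j unfolding pos_mat_def by blast
  obtain i where i: "i \<le> n" "0 < A $$ (i, k)" using A k unfolding pos_mat_def by blast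
  have "0 < A $$ (i, k) * B $$ (k, j)" using i k by simp
  also have "\<dots> \<le> (\<Sum>l\<le>n. A $$ (i, l) * B $$ (l, j))"
  proof (rule member_le_sum[where f = "\<lambda>l. A $$ (i, l) * B $$ (l, j)"])
    show "0 \<le> A $$ (i, l) * B $$ (l, j)" if "l \<in> {..n} - {k}" for l
      using pos_matD(4)[OF A i(1), of l] pos_matD(4)[OF B _ j, of l] that by simp
  qed (use k in auto)
  finally show "\<exists>i\<le>n. 0 < (A * B) $$ (i, j)" using i j by (auto simp: mult_index[OF c])
qed

lemma pos_mat_one: "pos_mat n (1\<^sub>m (n + 1))"
  by (auto simp: pos_mat_def intro!: exI)

text \<open>By compactness the sequence eventually enters every open set containing its intersection
  (\<open>inside\<close>). This is applied to a small box around the point, and to the empty set for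
  nonemptiness.\<close>

lemma nested_compact_singleton:
  fixes C :: "nat \<Rightarrow> (nat \<Rightarrow> real) set"
  assumes comp: "\<And>t. compact (C t)" and dec: "\<And>s t. s \<le> t \<Longrightarrow> C t \<subseteq> C s"
    and ne: "\<And>t. C t \<noteq> {}" and supp: "\<And>t y i. y \<in> C t \<Longrightarrow> i > n \<Longrightarrow> y i = 0"
  shows "(\<exists>x. (\<Inter>t. C t) = {x}) \<longleftrightarrow> (\<forall>e>0. \<exists>t. \<forall>y\<in>C t. \<forall>z\<in>C t. \<forall>i\<le>n. \<bar>y i - z i\<bar> \<le> e)"
    (is "?L \<longleftrightarrow> ?R")
proof -
  have inside: "\<exists>T. C T \<subseteq> U" if U: "open U" "(\<Inter>t. C t) \<subseteq> U" for U
  proof -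
    have cov: "C 0 \<subseteq> (\<Union>t\<in>UNIV. U \<union> - C t)" using U(2) by blast
    have op: "\<And>t. t \<in> UNIV \<Longrightarrow> open (U \<union> - C t)" using comp U(1) compact_imp_closed by (intro open_Un) auto
    obtain F where F: "F \<subseteq> UNIV" "finite F" "C 0 \<subseteq> (\<Union>t\<in>F. U \<union> - C t)"
      using compactE_image[OF comp op cov] by metis
    define T where "T = Max (insert 0 F)"
    have "C T \<subseteq> U"
    proof
      fix y assume y: "y \<in> C T"
      then have "y \<in> C 0" using dec by blast
      then obtain t where t: "t \<in> F" "y \<in> U \<union> - C t" using F(3) by blast
      have "t \<le> T" unfolding T_def using F(2) t(1) by simp
      then show "y \<in> U" using t(2) dec y by blast
    qed
    then show ?thesis by blast
  qed
  show ?thesis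
  proof
    assume ?L
    then obtain x where x: "(\<Inter>t. C t) = {x}" by blast
    show ?R
    proof (intro allI impI)
      fix e :: real assume e: "e > 0"
      define U where "U = (\<Inter>i\<in>{..n}. {y. \<bar>y i - x i\<bar> < e / 2})"
      have "open {y. \<bar>y i - x i\<bar> < e / 2}" for i
        by (intro open_Collect_less continuous_intros) auto
      then have "open U" unfolding U_def by (intro open_INT) auto
      moreover have "(\<Inter>t. C t) \<subseteq> U" unfolding x U_def using e by auto
      ultimately obtain T where T: "C T \<subseteq> U" using inside by blast
      have "\<bar>y i - z i\<bar> \<le> e" if "y \<in> C T" "z \<in> C T" "i \<le> n" for y z i
      proof -
        have "\<bar>y i - x i\<bar> < e / 2" "\<bar>z i - x i\<bar> < e / 2" using T that unfolding U_def by auto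
        then show ?thesis by linarith
      qed
      then show "\<exists>t. \<forall>y\<in>C t. \<forall>z\<in>C t. \<forall>i\<le>n. \<bar>y i - z i\<bar> \<le> e" by blast
    qed
  next
    assume R: ?R
    have "(\<Inter>t. C t) \<noteq> {}"
    proof
      assume "(\<Inter>t. C t) = {}"
      then obtain T where "C T \<subseteq> {}" using inside[of "{}"] by auto
      then show False using ne by blast
    qed
    then obtain x where x: "x \<in> (\<Inter>t. C t)" by blast
    have "y = x" if y: "y \<in> (\<Inter>t. C t)" for y
    proof
      fix i
      show "y i = x i"
      proof (cases "i \<le> n")
        case True
        have "\<bar>y i - x i\<bar> \<le> e" if "e > 0" for e
        proof -
          obtain t where "\<forall>y\<in>C t. \<forall>z\<in>C t. \<forall>i\<le>n. \<bar>y i - z i\<bar> \<le> e" using R \<open>e > 0\<close> by blast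
          then show ?thesis using True x y by blast
        qed
        then have "\<bar>y i - x i\<bar> \<le> 0" by (rule field_le_epsilon) simp
        then show ?thesis by simp
      next
        case False
        then show ?thesis using supp[of y 0 i] supp[of x 0 i] x y by auto
      qed
    qed
    then show ?L using x by blast
  qed
qed

text \<open>\<open>Q v t\<close> says that the first \<open>t\<close> letters of \<open>v\<close>
  extend to words with \<open>P\<close> at arbitrarily late times. One of the two next letters
  preserves this: otherwise a word good up to the later of the two failing times would contradict
  \<open>anti\<close>.\<close>

lemma binary_koenig:
  assumes pre: "\<And>w w' t. (\<And>s. s < t \<Longrightarrow> w s = w' s) \<Longrightarrow> P w t \<Longrightarrow> P w' t"
    and anti: "\<And>w s t. binary w \<Longrightarrow> s \<le> t \<Longrightarrow> P w t \<Longrightarrow> P w s"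
    and ex: "\<And>T. \<exists>w. binary w \<and> P w T"
  shows "\<exists>w. binary w \<and> (\<forall>t. P w t)"
proof -
  define Q where "Q v t \<longleftrightarrow> (\<forall>T. \<exists>w. binary w \<and> (\<forall>s<t. w s = v s) \<and> P w T)" for v :: "nat \<Rightarrow> nat" and t
  have step: "\<exists>b. (b = 0 \<or> b = 1) \<and> Q (v(t := b)) (Suc t)" if "Q v t" for v t
  proof (rule ccontr)
    assume "\<not> ?thesis"
    then have n0: "\<not> Q (v(t := 0)) (Suc t)" and n1: "\<not> Q (v(t := 1)) (Suc t)" by blast+
    obtain T0 where T0: "\<forall>w. \<not> (binary w \<and> (\<forall>s<Suc t. w s = (v(t := 0)) s) \<and> P w T0)"
      using n0 unfolding Q_def by blast
    obtain T1 where T1: "\<forall>w. \<not> (binary w \<and> (\<forall>s<Suc t. w s = (v(t := 1)) s) \<and> P w T1)"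
      using n1 unfolding Q_def by blast
    obtain w where w: "binary w" "\<forall>s<t. w s = v s" "P w (max T0 T1)" using \<open>Q v t\<close> unfolding Q_def by blast
    have "P w T0" "P w T1" using anti[OF w(1) _ w(3)] by auto
    moreover have "w t = 0 \<or> w t = 1" using w(1) by (simp add: binary_def)
    moreover have "\<forall>s<Suc t. w s = (v(t := w t)) s" using w(2) by (simp add: less_Suc_eq)
    ultimately show False using T0 T1 w(1) by metis
  qed
  define V where "V = rec_nat (\<lambda>_. 0) (\<lambda>t v. v(t := SOME b. (b = 0 \<or> b = 1) \<and> Q (v(t := b)) (Suc t)))"
  have VS: "V (Suc t) = (V t)(t := SOME b. (b = 0 \<or> b = 1) \<and> Q ((V t)(t := b)) (Suc t))" for t
    by (simp add: V_def)
  have V: "Q (V t) t" for t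
  proof (induction t)
    case 0
    show ?case unfolding Q_def using ex by blast
  next
    case (Suc t)
    show ?case unfolding VS using someI_ex[OF step[OF Suc]] by blast
  qed
  define v where "v s = V (Suc s) s" for s
  have v01: "v t = 0 \<or> v t = 1" for t
    unfolding v_def VS using someI_ex[OF step[OF V[of t]]] by simp
  have "s < t \<Longrightarrow> V t s = v s" for s t
  proof (induction t)
    case (Suc t)
    then show ?case by (cases "s = t") (auto simp: v_def VS)
  qed simp
  then have "P v t" for t
  proof -
    obtain w where "binary w" "\<forall>s<t. w s = V t s" "P w t" using V[of t] unfolding Q_def by blast
    then show ?thesis using pre[of t w v] \<open>\<And>s t. s < t \<Longrightarrow> V t s = v s\<close> by simp
  qed
  then show ?thesis using v01 by (auto simp: binary_def)
qed

section \<open>Splitting matrices and the game\<close>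

declare One_nat_def [simp del]

definition split_mat :: "nat \<Rightarrow> (nat \<Rightarrow> nat) \<Rightarrow> nat \<Rightarrow> (nat \<Rightarrow> nat) \<Rightarrow> int mat" where
  "split_mat n u a q = Matrix.mat (n + 1) (n + 1)
     (\<lambda>(i, k). (if i = q k then 1 else 0) + (if q k = u (1 - a) \<and> i = u a then 1 else 0))"

lemma split_mat_carrier [simp]: "split_mat n u a q \<in> carrier_mat (n + 1) (n + 1)"
  by (simp add: split_mat_def)

lemma split_mat_index:
  "i \<le> n \<Longrightarrow> k \<le> n \<Longrightarrow> split_mat n u a q $$ (i, k) =
     (if i = q k then 1 else 0) + (if q k = u (1 - a) \<and> i = u a then 1 else 0)"
  by (simp add: split_mat_def)

lemma pos_mat_split_mat:
  assumes "\<And>k. k \<le> n \<Longrightarrow> q k \<le> n"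
  shows "pos_mat n (split_mat n u a q)"
  unfolding pos_mat_def
proof (intro conjI allI impI)
  fix j assume "j \<le> n"
  then show "\<exists>i\<le>n. 0 < split_mat n u a q $$ (i, j)"
    using assms by (intro exI[of _ "q j"]) (auto simp: split_mat_index)
qed (simp_all only: split_mat_carrier, simp add: split_mat_index)

lemma mult_split_mat:
  fixes W :: "int mat"
  assumes "W \<in> carrier_mat (n + 1) (n + 1)" "i \<le> n" "k \<le> n" "q k \<le> n" "u a \<le> n"
  shows "(W * split_mat n u a q) $$ (i, k) = W $$ (i, q k) + (if q k = u (1 - a) then W $$ (i, u a) else 0)"
proof -
  have "(W * split_mat n u a q) $$ (i, k) =
      (\<Sum>j\<le>n. (if j = q k then W $$ (i, j) else 0) + (if q k = u (1 - a) then if j = u a then W $$ (i, j) else 0 else 0))"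
    unfolding mult_index[OF assms(1) split_mat_carrier assms(2,3)]
    using assms(3) by (intro sum.cong) (auto simp: split_mat_index)
  also have "\<dots> = W $$ (i, q k) + (if q k = u (1 - a) then W $$ (i, u a) else 0)"
    using assms(4,5) by (simp add: sum.distrib)
  finally show ?thesis .
qed

lemma range_binary: "range w \<subseteq> {0, 1} \<longleftrightarrow> binary w"
  by (simp add: binary_def image_subset_iff)

lemma word_mat_cong:
  "(\<And>s. s < t \<Longrightarrow> w s = w' s) \<Longrightarrow> word_mat n A0 A1 w t = word_mat n A0 A1 w' t"
  by (induction t) auto

context splitting_game
begin

abbreviation branch :: "nat \<Rightarrow> int mat" where
  "branch a \<equiv> split_mat n u a (p a)"

abbreviation word :: "(nat \<Rightarrow> nat) \<Rightarrow> nat \<Rightarrow> int mat" where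
  "word w t \<equiv> word_mat n (branch 0) (branch 1) w t"

abbreviation cell :: "(nat \<Rightarrow> nat) \<Rightarrow> nat \<Rightarrow> (nat \<Rightarrow> real) set" where
  "cell w t \<equiv> proj_act (word w t) ` standard_simplex n"

lemma pos_mat_branch: "a \<in> {0, 1} \<Longrightarrow> pos_mat n (branch a)"
  using p_le by (intro pos_mat_split_mat) auto

lemma branch_mat_eq: "a \<in> {0, 1} \<Longrightarrow> branch_mat (branch 0) (branch 1) a = branch a"
  by (auto simp: branch_mat_def)

context
  fixes w
  assumes w: "binary w"
begin

lemma w01: "w t \<in> {0, 1}"
  using w by (auto simp: binary_def)

lemma word_Suc: "word w (Suc t) = word w t * branch (w t)"
  by (simp add: branch_mat_eq[OF w01])

lemma pos_mat_word: "pos_mat n (word w t)"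
proof (induction t)
  case (Suc t)
  then show ?case unfolding word_Suc using pos_mat_branch[OF w01] by (intro pos_mat_mult)
qed (use pos_mat_one in simp)

lemma word_index:
  "i \<le> n \<Longrightarrow> k \<le> n \<Longrightarrow> real_of_int (word w t $$ (i, k)) = gval u p w (\<lambda>j. of_bool (j = i)) t k"
proof (induction t arbitrary: k)
  case (Suc t)
  have le: "p (w t) k \<le> n" "u (w t) \<le> n" using p_le[OF w01 Suc.prems(2)] w01[of t] u by auto
  show ?case unfolding word_Suc
      mult_split_mat[where u = u and a = "w t" and q = "p (w t)", OF pos_matD(1)[OF pos_mat_word] Suc.prems le]
    using Suc.IH[OF Suc.prems(1)] le by (simp add: gstep_def)
qed auto

lemma col_sum_word: "k \<le> n \<Longrightarrow> col_sum n (word w t) k = gval u p w (\<lambda>_. 1) t k"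
proof -
  assume k: "k \<le> n"
  have "col_sum n (word w t) k = gval u p w (\<lambda>j. \<Sum>i\<le>n. of_bool (j = i)) t k"
    unfolding col_sum_def gval_sum[OF finite_atMost] using k by (intro sum.cong) (auto simp: word_index)
  also have "\<dots> = gval u p w (\<lambda>_. 1) t k"
    using k p_le u w by (intro gval_cong_on[of n]) (auto simp: of_bool_def)
  finally show ?thesis .
qed

lemma vertex_ratio:
  assumes "i \<le> n" "k \<le> n"
  shows "proj_act (word w t) (\<lambda>j. if j = k then 1 else 0) i = share u p w i t k"
  unfolding proj_act_vertex[OF pos_mat_word assms(2)] ratio_def
  using assms by (simp add: word_index col_sum_word)

lemma cell_Suc: "cell w (Suc t) \<subseteq> cell w t"
  unfolding word_Suc
  using proj_act_mult[OF pos_mat_word pos_mat_branch[OF w01]] proj_act_in[OF pos_mat_branch[OF w01]] by auto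

lemma cell_antimono: "s \<le> t \<Longrightarrow> cell w t \<subseteq> cell w s"
  using lift_Suc_antimono_le[of "cell w" s t] cell_Suc by blast

lemma cell_singleton_iff:
  "(\<exists>x. (\<Inter>t. cell w t) = {x}) \<longleftrightarrow> (\<forall>e>0. \<exists>t. \<forall>y\<in>cell w t. \<forall>z\<in>cell w t. \<forall>i\<le>n. \<bar>y i - z i\<bar> \<le> e)"
proof (rule nested_compact_singleton)
  show "compact (cell w t)" for t
    using compact_continuous_image[OF continuous_proj_act[OF pos_mat_word] compact_simplex] .
  show "cell w t \<noteq> {}" for t using nonempty_standard_simplex by simp
  show "y i = 0" if "y \<in> cell w t" "i > n" for t y i
    using that proj_act_in[OF pos_mat_word] simplexD(3) by blast
qed (rule cell_antimono)

text \<open>The extreme values of a coordinate on a cell are attained at its vertices, the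
  normalised columns of the word.\<close>

lemma cell_diameter_iff:
  "(\<forall>y\<in>cell w t. \<forall>z\<in>cell w t. \<forall>i\<le>n. \<bar>y i - z i\<bar> \<le> e) \<longleftrightarrow>
   (\<forall>i\<le>n. \<forall>k\<le>n. \<forall>l\<le>n. \<bar>share u p w i t k - share u p w i t l\<bar> \<le> e)"
    (is "?L \<longleftrightarrow> ?R")
proof
  assume L: ?L
  show ?R
  proof (intro allI impI)
    fix i k l assume i: "i \<le> n" and kl: "k \<le> n" "l \<le> n"
    let ?v = "\<lambda>k. proj_act (word w t) (\<lambda>j. if j = k then 1 else 0)"
    have "?v k \<in> cell w t" "?v l \<in> cell w t" using kl by (auto intro!: imageI)
    then have "\<bar>?v k i - ?v l i\<bar> \<le> e" using L i by blast
    then show "\<bar>share u p w i t k - share u p w i t l\<bar> \<le> e"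
      unfolding vertex_ratio[OF i kl(1)] vertex_ratio[OF i kl(2)] .
  qed
next
  assume R: ?R
  show ?L
  proof (intro ballI allI impI)
    fix y z i assume yz: "y \<in> cell w t" "z \<in> cell w t" and i: "i \<le> n"
    define f where "f k = share u p w i t k" for k
    have f: "word w t $$ (i, k) / col_sum n (word w t) k = f k" if "k \<le> n" for k
      unfolding f_def ratio_def using that i by (simp add: word_index col_sum_word)
    have fin: "finite (f ` {..n})" "f ` {..n} \<noteq> {}" by auto
    have b: "Min (f ` {..n}) \<le> x i \<and> x i \<le> Max (f ` {..n})" if x: "x \<in> cell w t" for x
    proof -
      obtain x' where "x' \<in> standard_simplex n" "x = proj_act (word w t) x'" using x by blast
      then show ?thesis
        using proj_act_between[OF pos_mat_word, of x' i "Min (f ` {..n})" t "Max (f ` {..n})"] i f fin by simp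
    qed
    have "Max (f ` {..n}) - Min (f ` {..n}) \<le> e"
    proof -
      obtain k l where "k \<le> n" "l \<le> n" "Max (f ` {..n}) = f k" "Min (f ` {..n}) = f l"
        using Max_in[OF fin] Min_in[OF fin] by (metis atMost_iff imageE)
      then show ?thesis using R i unfolding f_def by (metis abs_le_D1)
    qed
    then show "\<bar>y i - z i\<bar> \<le> e" using b[OF yz(1)] b[OF yz(2)] by linarith
  qed
qed

end

lemma contractive_iff:
  "contractive n (branch 0) (branch 1) \<longleftrightarrow>
   (\<forall>w. binary w \<longrightarrow> (\<forall>e>0. \<exists>t. \<forall>i\<le>n. \<forall>k\<le>n. \<forall>l\<le>n.
      \<bar>share u p w i t k - share u p w i t l\<bar> \<le> e))"
  unfolding contractive_def range_binary using cell_singleton_iff cell_diameter_iff by simp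

text \<open>Koenig's lemma is applied to the property that a cell is still large. Since cells are
  nested, this passes to shorter prefixes; if it occurred at every time for some word, one infinite
  word would have only large cells.\<close>

lemma contractive_imp_uniformly:
  assumes "contractive n (branch 0) (branch 1)"
  shows "uniformly_contractive n u p"
  unfolding uniformly_contractive_def
proof (intro allI impI)
  fix e :: real assume e: "e > 0"
  define P where "P w t \<longleftrightarrow> \<not> (\<forall>y\<in>cell w t. \<forall>z\<in>cell w t. \<forall>i\<le>n. \<bar>y i - z i\<bar> \<le> e)" for w t
  have anti: "P w s" if "binary w" "s \<le> t" "P w t" for w s t
    using that cell_antimono[OF that(1,2)] unfolding P_def by blast
  have "\<not> (\<exists>w. binary w \<and> (\<forall>t. P w t))"
    using assms e unfolding contractive_def range_binary P_def by (metis cell_singleton_iff)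
  moreover have "P w' t" if "\<And>s. s < t \<Longrightarrow> w s = w' s" "P w t" for w w' t
  proof -
    have "word w t = word w' t" using that(1) by (rule word_mat_cong)
    then show ?thesis using that(2) unfolding P_def by simp
  qed
  ultimately obtain T where T: "\<And>w. binary w \<Longrightarrow> \<not> P w T"
    using binary_koenig[of P] anti by metis
  show "\<exists>T. \<forall>t\<ge>T. \<forall>w. binary w \<longrightarrow> (\<forall>i\<le>n. \<forall>k\<le>n. \<forall>l\<le>n.
      \<bar>share u p w i t k - share u p w i t l\<bar> \<le> e)"
  proof (intro exI[of _ T] allI impI)
    fix t w i k l
    assume t: "T \<le> t" and w: "binary w" and le: "i \<le> n" "k \<le> n" "l \<le> n"
    have "\<not> P w t" using anti[OF w t] T[OF w] by blast
    then show "\<bar>share u p w i t k - share u p w i t l\<bar> \<le> e"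
      using cell_diameter_iff[OF w] le unfolding P_def by blast
  qed
qed

end

section \<open>The standard algorithms are contractive\<close>

locale standard_ifs =
  fixes n :: nat and f :: "nat \<Rightarrow> nat \<Rightarrow> nat"
  assumes n: "n \<ge> 1" and f: "\<And>a. f a = id \<or> f a = flip"
begin

definition q :: "nat \<Rightarrow> nat \<Rightarrow> nat" where "q a = (\<lambda>k. std_perm n a (f a k))"

text \<open>
  The algorithms only differ by exchanging positions 0 and 1; the set of these two columns and the
  order of the others evolve in the same way. \<open>flipped w t\<close> records whether they are exchanged.
\<close>

primrec flipped :: "(nat \<Rightarrow> nat) \<Rightarrow> nat \<Rightarrow> bool" where
  "flipped w 0 = False"
| "flipped w (Suc t) = (f (w t) = flip)"

definition norm_pos :: "(nat \<Rightarrow> nat) \<Rightarrow> nat \<Rightarrow> nat \<Rightarrow> nat" where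
  "norm_pos w t k = (if flipped w t then flip k else k)"

definition val :: "(nat \<Rightarrow> nat) \<Rightarrow> (nat \<Rightarrow> real) \<Rightarrow> nat \<Rightarrow> nat \<Rightarrow> real" where
  "val w x t k = gval id q w x t (norm_pos w t k)"

text \<open>Label \<open>w t\<close> keeps actual position \<open>w t\<close>. The normalised
  survivor in position 0 is given up if this is normalised position 1.\<close>

definition switch :: "(nat \<Rightarrow> nat) \<Rightarrow> nat \<Rightarrow> bool" where
  "switch w t \<longleftrightarrow> (w t = 1) \<noteq> flipped w t"

lemma flip_neq_id: "flip \<noteq> id"
proof
  assume "flip = id"
  then have "flip 0 = id 0" by simp
  then show False by (simp add: flip_def)
qed

text \<open>\<open>q a\<close> applies \<open>f a\<close> first, to the new position, so undoing the
  latest flip cancels it. Hence \<open>flipped\<close> depends on the last label only.\<close>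

lemma q_norm_pos: "q (w t) (norm_pos w (Suc t) k) = std_perm n (w t) k"
  using f[of "w t"] flip_neq_id by (auto simp: q_def norm_pos_def)

lemma val_Suc:
  assumes w: "binary w" and k: "k \<le> n"
  shows "val w x (Suc t) k =
    (if k = 0 then if switch w t then val w x t 1 else val w x t 0
     else if k = n then val w x t 0 + val w x t 1 else val w x t (k + 1))"
proof -
  have w01: "w t = 0 \<or> w t = 1" using w by (simp add: binary_def)
  have g: "val w x (Suc t) k = gval id q w x t (std_perm n (w t) k) +
      (if std_perm n (w t) k = 1 - w t then gval id q w x t (w t) else 0)"
    by (simp add: val_def gstep_def q_norm_pos)
  have v: "val w x t j = gval id q w x t j" if "j \<ge> 2" for j
    using that by (simp add: val_def norm_pos_def flip_def)
  have v01: "val w x t 0 = gval id q w x t (if flipped w t then 1 else 0)"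
    "val w x t 1 = gval id q w x t (if flipped w t then 0 else 1)"
    by (auto simp: val_def norm_pos_def flip_def)
  consider "k = 0" | "k = n" "k \<noteq> 0" | "0 < k" "k < n" using k by linarith
  then show ?thesis
  proof cases
    case 1
    then show ?thesis unfolding g v01 using w01 n by (auto simp: std_perm_def switch_def)
  next
    case 2
    then show ?thesis unfolding g v01 using w01 n by (auto simp: std_perm_def)
  next
    case 3
    then show ?thesis unfolding g using w01 v[of "k + 1"] by (auto simp: std_perm_def)
  qed
qed

lemma val_queue:
  assumes w: "binary w"
  shows "j < n \<Longrightarrow> val w x (t + j) 1 = val w x t (j + 1)"
proof (induction j arbitrary: t)
  case (Suc j)
  then have "val w x (Suc t + j) 1 = val w x (Suc t) (j + 1)" using Suc.IH[of "Suc t"] by simp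
  also have "\<dots> = val w x t (j + 1 + 1)" using val_Suc[OF w, of "j + 1"] Suc.prems by simp
  also have "j + 1 + 1 = Suc j + 1" by arith
  finally show ?case by simp
qed simp

lemma val_queue_end:
  assumes w: "binary w"
  shows "val w x (t + n) 1 = val w x t 1 + val w x t 0"
proof -
  have "val w x (Suc t + (n - 1)) 1 = val w x (Suc t) n" using val_queue[OF w, of "n - 1" x "Suc t"] n by simp
  moreover have "Suc t + (n - 1) = t + n" using n by simp
  ultimately show ?thesis using val_Suc[OF w, of n x t] n by simp
qed

text \<open>Two sequences describe all columns: normalised position 0 is the survivor and position 1
  the head, and by \<open>val_queue\<close> position \<open>j + 1\<close> holds what will be the
  head after \<open>j\<close> more steps.\<close>

lemma ratio_contracts:
  assumes w: "binary w" and e: "e > 0"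
  shows "\<exists>t. \<forall>s\<ge>t. \<exists>a. \<forall>k\<le>n. ratio id q w x s k \<in> {a..a + e}"
proof -
  interpret queue n "switch w" "\<lambda>t. val w (\<lambda>_. 1) t 0" "\<lambda>t. val w (\<lambda>_. 1) t 1" "\<lambda>t. val w x t 0" "\<lambda>t. val w x t 1"
  proof
    show "val w (\<lambda>_. 1) t 1 = 1" if "t < n" for t
      using val_queue[OF w that, of "\<lambda>_. 1" 0] by (simp add: val_def)
  qed (use n val_Suc[OF w] val_queue_end[OF w] in \<open>auto simp: val_def[of _ _ 0]\<close>)
  obtain t a where c0: "confined t a e" using contraction[OF e] by blast
  have "ratio id q w x s k \<in> {a..a + e}" if s: "t \<le> s" and k: "k \<le> n" for s k
  proof -
    have c: "confined s a e" using confined_mono[OF c0 s] .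
    have "val w x s k / val w (\<lambda>_. 1) s k \<in> {a..a + e}" if k: "k \<le> n" for k
    proof (cases k)
      case 0
      then show ?thesis using c by (simp add: confined_def kr_def)
    next
      case (Suc j)
      then have "j < n" using k by simp
      then have "r (s + j) \<in> {a..a + e}" using c unfolding confined_def by blast
      moreover have "k = j + 1" using Suc by simp
      ultimately show ?thesis unfolding r_def val_queue[OF w \<open>j < n\<close>] by simp
    qed
    moreover have "norm_pos w s k \<le> n" "norm_pos w s (norm_pos w s k) = k"
      using k n by (auto simp: norm_pos_def flip_def)
    ultimately show ?thesis unfolding ratio_def val_def by metis
  qed
  then show ?thesis by blast
qed

lemma q_permutes:
  assumes "a \<in> {0, 1}"
  shows "q a permutes {0..n}"
proof -
  have "inj_on (std_perm n a) {0..n}" using n by (auto simp: inj_on_def std_perm_def split: if_splits)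
  moreover have "std_perm n a ` {0..n} \<subseteq> {0..n}" using n by (auto simp: std_perm_def)
  ultimately have "bij_betw (std_perm n a) {0..n} {0..n}" by (simp add: bij_betw_def endo_inj_surj)
  then have "std_perm n a permutes {0..n}" by (rule bij_imp_permutes) (simp add: std_perm_def)
  moreover have "f a permutes {0..n}" using f[of a] flip_permutes[OF n] permutes_id by metis
  ultimately show ?thesis using permutes_compose[of "f a" _ "std_perm n a"] by (simp add: q_def comp_def)
qed

sublocale splitting_game n id q
  using q_permutes n by unfold_locales auto

theorem contractive_standard: "contractive n (branch 0) (branch 1)"
  unfolding contractive_iff
proof (intro allI impI)
  fix w :: "nat \<Rightarrow> nat" and e :: real
  assume w: "binary w" and e: "e > 0"
  have "\<exists>t. \<forall>s\<ge>t. \<exists>a. \<forall>k\<le>n. share id q w i s k \<in> {a..a + e}" for i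
    using ratio_contracts[OF w e] .
  then obtain T where T: "\<And>i s. T i \<le> s \<Longrightarrow> \<exists>a. \<forall>k\<le>n. share id q w i s k \<in> {a..a + e}" by metis
  define t where "t = Max (T ` {..n})"
  have "\<bar>share id q w i t k - share id q w i t l\<bar> \<le> e" if le: "i \<le> n" "k \<le> n" "l \<le> n" for i k l
  proof -
    have "T i \<le> t" unfolding t_def using le(1) by simp
    then obtain a where a: "\<forall>k\<le>n. share id q w i t k \<in> {a..a + e}" using T by blast
    then have "share id q w i t k \<in> {a..a + e}" "share id q w i t l \<in> {a..a + e}" using le(2,3) by blast+
    then show ?thesis unfolding atLeastAtMost_iff by linarith
  qed
  then show "\<exists>t. \<forall>i\<le>n. \<forall>k\<le>n. \<forall>l\<le>n. \<bar>share id q w i t k - share id q w i t l\<bar> \<le> e" by blast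
qed

end

section \<open>The shape of a splitting\<close>

lemma carrier_mat_ring: "carrier (mat_ring n) = carrier_mat (n + 1) (n + 1)"
  and mult_mat_ring: "A \<otimes>\<^bsub>mat_ring n\<^esub> B = A * B"
  and one_mat_ring: "\<one>\<^bsub>mat_ring n\<^esub> = 1\<^sub>m (n + 1)"
  by (simp_all add: ring_mat_def)

lemma Sigma_matsD:
  assumes "A \<in> Sigma_mats n"
  shows "A \<in> carrier_mat (n + 1) (n + 1)" "\<And>i j. i \<le> n \<Longrightarrow> j \<le> n \<Longrightarrow> 0 \<le> A $$ (i, j)"
  using assms by (auto simp: Sigma_mats_def Units_def carrier_mat_ring)

lemma Sigma_mats_left_inverse:
  assumes "A \<in> Sigma_mats n"
  obtains B where "\<And>k l. k \<le> n \<Longrightarrow> l \<le> n \<Longrightarrow> (\<Sum>i\<le>n. B $$ (k, i) * A $$ (i, l)) = (if k = l then 1 else 0 :: int)"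
proof -
  obtain B where B: "B \<in> carrier_mat (n + 1) (n + 1)" "B * A = 1\<^sub>m (n + 1)"
    using assms by (auto simp: Sigma_mats_def Units_def carrier_mat_ring mult_mat_ring one_mat_ring)
  have "(\<Sum>i\<le>n. B $$ (k, i) * A $$ (i, l)) = (if k = l then 1 else 0)" if "k \<le> n" "l \<le> n" for k l
    using mult_index[OF B(1) Sigma_matsD(1)[OF assms] that] that unfolding B(2) by simp
  then show thesis by (rule that)
qed

definition has_col :: "nat \<Rightarrow> int mat \<Rightarrow> (nat \<Rightarrow> int) \<Rightarrow> bool" where
  "has_col n A v \<longleftrightarrow> (\<exists>k\<le>n. \<forall>i\<le>n. A $$ (i, k) = v i)"

abbreviation unit_vec :: "nat \<Rightarrow> nat \<Rightarrow> int" where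
  "unit_vec j \<equiv> \<lambda>i. of_bool (i = j)"

lemma pos_mat_Sigma: "A \<in> Sigma_mats n \<Longrightarrow> pos_mat n A"
  unfolding pos_mat_def
proof (intro conjI allI impI)
  assume A: "A \<in> Sigma_mats n"
  show "A \<in> carrier_mat (n + 1) (n + 1)" "\<And>i j. i \<le> n \<Longrightarrow> j \<le> n \<Longrightarrow> 0 \<le> A $$ (i, j)"
    using Sigma_matsD[OF A] by auto
  fix j assume j: "j \<le> n"
  obtain B where B: "\<And>k l. k \<le> n \<Longrightarrow> l \<le> n \<Longrightarrow> (\<Sum>i\<le>n. B $$ (k, i) * A $$ (i, l)) = (if k = l then 1 else 0 :: int)"
    using Sigma_mats_left_inverse[OF A] by metis
  show "\<exists>i\<le>n. 0 < A $$ (i, j)"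
  proof (rule ccontr)
    assume "\<not> ?thesis"
    then have "A $$ (i, j) = 0" if "i \<le> n" for i
      using Sigma_matsD(2)[OF A that j] that by force
    then show False using B[OF j j] by simp
  qed
qed

lemma columns_permutation:
  assumes A: "A \<in> Sigma_mats n" and col: "\<And>j. j \<le> n \<Longrightarrow> has_col n A (v j)"
    and dist: "\<And>j k. j \<le> n \<Longrightarrow> k \<le> n \<Longrightarrow> j \<noteq> k \<Longrightarrow> \<exists>i\<le>n. v j i \<noteq> v k i"
  shows "\<exists>p. p permutes {0..n} \<and> (\<forall>i\<le>n. \<forall>k\<le>n. A $$ (i, k) = v (p k) i)"
proof -
  obtain g where g: "\<And>j. j \<le> n \<Longrightarrow> g j \<le> n \<and> (\<forall>i\<le>n. A $$ (i, g j) = v j i)"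
    using col unfolding has_col_def by metis
  have inj: "inj_on g {0..n}"
  proof (rule inj_onI)
    fix j k assume jk: "j \<in> {0..n}" "k \<in> {0..n}" "g j = g k"
    then have "v j i = v k i" if "i \<le> n" for i using g[of j] g[of k] that by simp
    then show "j = k" using dist[of j k] jk(1,2) by auto
  qed
  moreover have "g ` {0..n} \<subseteq> {0..n}" using g by auto
  ultimately have bij: "bij_betw g {0..n} {0..n}" by (simp add: bij_betw_def endo_inj_surj)
  define p where "p k = (if k \<in> {0..n} then inv_into {0..n} g k else k)" for k
  have "bij_betw (inv_into {0..n} g) {0..n} {0..n}" using bij by (rule bij_betw_inv_into)
  then have "bij_betw p {0..n} {0..n}" by (subst bij_betw_cong[of _ p "inv_into {0..n} g"]) (auto simp: p_def)
  then have "p permutes {0..n}" by (rule bij_imp_permutes) (auto simp: p_def)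
  moreover have "A $$ (i, k) = v (p k) i" if "i \<le> n" "k \<le> n" for i k
  proof -
    have k: "k \<in> g ` {0..n}" using bij that(2) by (auto simp: bij_betw_def)
    then have "p k \<le> n" "g (p k) = k"
      using inv_into_into[OF k] f_inv_into_f[OF k] that(2) by (auto simp: p_def)
    then show ?thesis using g[of "p k"] that(1) by metis
  qed
  ultimately show ?thesis by blast
qed

lemma not_perm_mat_missing:
  assumes "A \<in> Sigma_mats n" "A \<notin> perm_mats n"
  shows "\<exists>j\<le>n. \<not> has_col n A (unit_vec j)"
proof (rule ccontr)
  assume "\<not> ?thesis"
  then have "\<And>j. j \<le> n \<Longrightarrow> has_col n A (unit_vec j)" by blast
  moreover have "\<exists>i\<le>n. unit_vec j i \<noteq> unit_vec k i" if "j \<le> n" "k \<le> n" "j \<noteq> k" for j k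
    using that by (intro exI[of _ j]) auto
  ultimately obtain p where p: "p permutes {0..n}" "\<forall>i\<le>n. \<forall>k\<le>n. A $$ (i, k) = unit_vec (p k) i"
    using columns_permutation[OF assms(1), of "\<lambda>j. unit_vec j"] by blast
  have "A = perm_mat n p"
    using Sigma_matsD(1)[OF assms(1)] p(2) by (intro eq_matI) (auto simp: perm_mat_def)
  then show False using assms(2) p(1) by (auto simp: perm_mats_def)
qed

section \<open>Columns forced by points of the image\<close>

context
  fixes n A B
  assumes A: "A \<in> Sigma_mats n"
    and B: "\<And>k l. k \<le> n \<Longrightarrow> l \<le> n \<Longrightarrow> (\<Sum>i\<le>n. B $$ (k, i) * A $$ (i, l)) = (if k = l then 1 else 0 :: int)"
begin

lemma inverse_row_two:
  assumes "k \<le> n" "l \<le> n" "i \<le> n" "j \<le> n" "i \<noteq> j" "\<And>m. m \<le> n \<Longrightarrow> m \<noteq> i \<Longrightarrow> m \<noteq> j \<Longrightarrow> A $$ (m, l) = 0"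
  shows "B $$ (k, i) * A $$ (i, l) + B $$ (k, j) * A $$ (j, l) = (if k = l then 1 else 0)"
proof -
  have "(\<Sum>m\<le>n. B $$ (k, m) * A $$ (m, l)) = (\<Sum>m\<in>{i, j}. B $$ (k, m) * A $$ (m, l))"
    using assms by (intro sum.mono_neutral_right) auto
  then show ?thesis using B[OF assms(1,2)] assms(5) by simp
qed

lemma proj_act_support:
  assumes x: "x \<in> standard_simplex n" and y: "proj_act A x i = 0" "i \<le> n" and l: "l \<le> n" "x l > 0"
  shows "A $$ (i, l) = 0"
proof -
  note PA = pos_mat_Sigma[OF A]
  have "lin_act A x i = 0"
    using y(1) sum_lin_act_ge[OF PA x] unfolding proj_act_eq[OF PA x] by auto
  then have "(\<Sum>j\<le>n. real_of_int (A $$ (i, j)) * x j) = 0"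
    using y(2) by (simp add: lin_act_eq[OF pos_matD(1)[OF PA]])
  then have "real_of_int (A $$ (i, l)) * x l = 0"
    using Sigma_matsD(2)[OF A y(2)] simplexD(1)[OF x] l(1) by (subst (asm) sum_nonneg_eq_0_iff) auto
  then show ?thesis using l(2) by simp
qed

text \<open>Any column used with positive weight to reach the vertex vanishes outside row
  \<open>k\<close>. The integral inverse makes its entry there a divisor of 1.\<close>

lemma vertex_column:
  assumes k: "k \<le> n" and in_cell: "(\<lambda>j. if j = k then 1 else 0) \<in> proj_act A ` standard_simplex n"
  shows "has_col n A (unit_vec k)"
proof -
  obtain x where x1: "x \<in> standard_simplex n" and xe: "(\<lambda>j. if j = k then 1 else 0) = proj_act A x"
    using in_cell by (rule imageE)
  have "proj_act A x j = (if j = k then 1 else 0)" for j using fun_cong[OF xe, of j] by simp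
  note x = x1 this
  obtain l where l: "l \<le> n" "x l > 0"
  proof -
    have "\<exists>l\<le>n. x l \<noteq> 0"
    proof (rule ccontr)
      assume "\<not> ?thesis"
      then show False using simplexD(4)[OF x(1)] by simp
    qed
    then obtain l where "l \<le> n" "x l \<noteq> 0" by blast
    then show thesis using simplexD(1)[OF x(1), of l] that by force
  qed
  have z: "A $$ (m, l) = 0" if "m \<le> n" "m \<noteq> k" for m
    using proj_act_support[OF x(1) _ that(1) l] x(2) that(2) by simp
  have "(\<Sum>m\<le>n. B $$ (l, m) * A $$ (m, l)) = (\<Sum>m\<in>{k}. B $$ (l, m) * A $$ (m, l))"
    using z k by (intro sum.mono_neutral_right) auto
  then have "B $$ (l, k) * A $$ (k, l) = 1" using B[OF l(1) l(1)] by simp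
  then have "A $$ (k, l) = 1" using Sigma_matsD(2)[OF A k l(1)] by (auto simp: zmult_eq_1_iff)
  then show ?thesis unfolding has_col_def using l(1) z by (intro exI[of _ l]) auto
qed

text \<open>Some column \<open>l\<close> of positive weight meets row \<open>j\<close>. Its dual row
  in the inverse annihilates the column \<open>e_i\<close>, so it reads off row \<open>j\<close> on
  columns supported on \<open>i\<close> and \<open>j\<close>. Thus the entry is 1, no other column
  of positive weight meets row \<open>j\<close>, and \<open>l\<close> supplies all of
  \<open>t\<close>; its entry \<open>q\<close> in row \<open>i\<close> must then fit into
  \<open>s\<close>.\<close>

lemma edge_column:
  assumes ij: "i \<le> n" "j \<le> n" "i \<noteq> j" and ci: "has_col n A (unit_vec i)" and cj: "\<not> has_col n A (unit_vec j)"
    and st: "s > 0" "t > 0" and in_cell: "(\<lambda>m. if m = i then s else if m = j then t else 0) \<in> proj_act A ` standard_simplex n"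
  shows "\<exists>q\<ge>1. has_col n A (\<lambda>m. if m = i then q else of_bool (m = j)) \<and> of_int q * t \<le> s"
proof -
  note PA = pos_mat_Sigma[OF A]
  obtain x where x: "x \<in> standard_simplex n"
    and xe: "(\<lambda>m. if m = i then s else if m = j then t else 0) = proj_act A x"
    using in_cell by (rule imageE)
  have y: "proj_act A x m = (if m = i then s else if m = j then t else 0)" for m
    using fun_cong[OF xe, of m] by simp
  define S where "S = (\<Sum>k\<le>n. lin_act A x k)"
  have S: "S \<ge> 1" unfolding S_def by (rule sum_lin_act_ge[OF PA x])
  have L: "(\<Sum>k\<le>n. real_of_int (A $$ (m, k)) * x k) = S * proj_act A x m" if "m \<le> n" for m
    using S that unfolding proj_act_eq[OF PA x] S_def[symmetric] by (simp add: lin_act_eq[OF pos_matD(1)[OF PA]])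
  have supp: "A $$ (m, l) = 0" if "m \<le> n" "m \<noteq> i" "m \<noteq> j" "l \<le> n" "x l > 0" for m l
    using proj_act_support[OF x _ that(1,4,5)] y that(2,3) by simp
  obtain l where l: "l \<le> n" "A $$ (j, l) \<noteq> 0" "x l > 0"
  proof -
    have "(\<Sum>k\<le>n. real_of_int (A $$ (j, k)) * x k) \<noteq> 0" using L[OF ij(2)] y[of j] S st ij(3) by auto
    then obtain l where "l \<le> n" "real_of_int (A $$ (j, l)) * x l \<noteq> 0" by (meson atMost_iff sum.neutral)
    then show thesis using simplexD(1)[OF x, of l] that[of l] by (auto simp: less_le)
  qed
  obtain k where k: "k \<le> n" "\<And>m. m \<le> n \<Longrightarrow> A $$ (m, k) = unit_vec i m" using ci by (auto simp: has_col_def)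
  have lk: "l \<noteq> k" using l(2) k(2)[OF ij(2)] ij(3) by auto
  have Bi: "B $$ (l, i) = 0" using inverse_row_two[OF l(1) k(1) ij] k(2) ij lk by auto
  have BA: "B $$ (l, j) * A $$ (j, l) = 1" using inverse_row_two[OF l(1) l(1) ij] supp l Bi by auto
  then have jl: "A $$ (j, l) = 1" "B $$ (l, j) = 1" using Sigma_matsD(2)[OF A ij(2) l(1)] by (auto simp: zmult_eq_1_iff)
  have other: "real_of_int (A $$ (j, l')) * x l' = 0" if "l' \<le> n" "l' \<noteq> l" for l'
  proof (cases "x l' > 0")
    case True
    then have "A $$ (j, l') = 0"
      using inverse_row_two[OF l(1) that(1) ij] supp that Bi jl by auto
    then show ?thesis by simp
  next
    case False
    then show ?thesis using simplexD(1)[OF x, of l'] by simp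
  qed
  have "S * t = (\<Sum>k\<in>{l}. real_of_int (A $$ (j, k)) * x k)"
    using L[OF ij(2)] y[of j] ij(3) other l(1) by (subst sum.mono_neutral_left[of "{..n}"]) auto
  then have tx: "S * t = x l" by (simp add: jl)
  define q where "q = A $$ (i, l)"
  have "real_of_int q * x l \<le> (\<Sum>k\<le>n. real_of_int (A $$ (i, k)) * x k)"
    unfolding q_def
  proof (rule member_le_sum)
    show "0 \<le> real_of_int (A $$ (i, k)) * x k" if "k \<in> {..n} - {l}" for k
      using Sigma_matsD(2)[OF A ij(1), of k] simplexD(1)[OF x, of k] that by simp
  qed (use l in auto)
  then have "real_of_int q * (S * t) \<le> S * s" using L[OF ij(1)] y[of i] tx by simp
  then have "S * (real_of_int q * t) \<le> S * s" by (simp add: mult.left_commute)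
  then have qt: "of_int q * t \<le> s" using S by simp
  have col: "has_col n A (\<lambda>m. if m = i then q else of_bool (m = j))"
    unfolding has_col_def using l supp jl by (intro exI[of _ l]) (auto simp: q_def)
  have "q \<noteq> 0"
  proof
    assume "q = 0"
    then have "has_col n A (unit_vec j)"
      using col ij(3) unfolding has_col_def by (metis (mono_tags) of_bool_eq(1))
    then show False using cj by blast
  qed
  moreover have "q \<ge> 0" unfolding q_def using Sigma_matsD(2)[OF A ij(1) l(1)] .
  ultimately show ?thesis using col qt by (intro exI[of _ q]) auto
qed

text \<open>\<open>(e_i + e_j) + e_k = (e_i + e_k) + e_j\<close> would be a linear dependence
  between columns of an invertible matrix.\<close>

lemma no_parallelogram:
  assumes ijk: "i \<le> n" "j \<le> n" "k \<le> n" "i \<noteq> j" "i \<noteq> k" "j \<noteq> k"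
    and c: "has_col n A (unit_vec j)" "has_col n A (unit_vec k)"
      "has_col n A (\<lambda>m. unit_vec i m + unit_vec j m)" "has_col n A (\<lambda>m. unit_vec i m + unit_vec k m)"
  shows False
proof -
  obtain a where a: "a \<le> n" "\<And>m. m \<le> n \<Longrightarrow> A $$ (m, a) = unit_vec j m" using c(1) by (auto simp: has_col_def)
  obtain b where b: "b \<le> n" "\<And>m. m \<le> n \<Longrightarrow> A $$ (m, b) = unit_vec k m" using c(2) by (auto simp: has_col_def)
  obtain d where d: "d \<le> n" "\<And>m. m \<le> n \<Longrightarrow> A $$ (m, d) = unit_vec i m + unit_vec j m"
    using c(3) by (auto simp: has_col_def)
  obtain e where e: "e \<le> n" "\<And>m. m \<le> n \<Longrightarrow> A $$ (m, e) = unit_vec i m + unit_vec k m"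
    using c(4) by (auto simp: has_col_def)
  have ne: "d \<noteq> a" "d \<noteq> b" "d \<noteq> e"
    using a(2)[OF ijk(1)] b(2)[OF ijk(1)] d(2)[OF ijk(1)] d(2)[OF ijk(2)] e(2)[OF ijk(2)] ijk by auto
  have "(\<Sum>m\<le>n. B $$ (d, m) * A $$ (m, d)) + (\<Sum>m\<le>n. B $$ (d, m) * A $$ (m, b)) =
      (\<Sum>m\<le>n. B $$ (d, m) * A $$ (m, e)) + (\<Sum>m\<le>n. B $$ (d, m) * A $$ (m, a))"
    unfolding sum.distrib[symmetric] using a b d e by (intro sum.cong) (auto simp: algebra_simps)
  then show False using B[OF d(1) d(1)] B[OF d(1) b(1)] B[OF d(1) e(1)] B[OF d(1) a(1)] ne by simp
qed

end

lemma splitting_missing: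
  assumes A: "A0 \<in> Sigma_mats n" "A1 \<in> Sigma_mats n"
    and cover: "standard_simplex n \<subseteq> proj_act A0 ` standard_simplex n \<union> proj_act A1 ` standard_simplex n"
    and miss: "j \<le> n" "\<not> has_col n A0 (unit_vec j)" "i \<le> n" "\<not> has_col n A1 (unit_vec i)"
  shows "i \<noteq> j \<and> has_col n A1 (unit_vec j) \<and> has_col n A0 (\<lambda>m. unit_vec i m + unit_vec j m)"
proof -
  obtain B0 where B0: "\<And>k l. k \<le> n \<Longrightarrow> l \<le> n \<Longrightarrow> (\<Sum>i\<le>n. B0 $$ (k, i) * A0 $$ (i, l)) = (if k = l then 1 else 0 :: int)"
    using Sigma_mats_left_inverse[OF A(1)] by metis
  obtain B1 where B1: "\<And>k l. k \<le> n \<Longrightarrow> l \<le> n \<Longrightarrow> (\<Sum>i\<le>n. B1 $$ (k, i) * A1 $$ (i, l)) = (if k = l then 1 else 0 :: int)"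
    using Sigma_mats_left_inverse[OF A(2)] by metis
  have vertex: "has_col n A0 (unit_vec k) \<or> has_col n A1 (unit_vec k)" if k: "k \<le> n" for k
  proof -
    have "(\<lambda>j. if j = k then 1 else 0) \<in> standard_simplex n" using k by simp
    then show ?thesis using cover vertex_column[OF A(1) B0 k] vertex_column[OF A(2) B1 k] by blast
  qed
  have c: "has_col n A1 (unit_vec j)" "has_col n A0 (unit_vec i)" using vertex miss by blast+
  then have ij: "i \<noteq> j" using miss by blast
  \<comment> \<open>The ratio 3 : 2 lies strictly between 1 and 2. In the image of \<open>A1\<close>
    it would require \<open>q <= 2 / 3\<close>; in that of \<open>A0\<close> it requires
    \<open>q <= 3 / 2\<close>, so \<open>q = 1\<close>.\<close>
  let ?y = "\<lambda>m. if m = i then 3 / 5 else if m = j then 2 / 5 else 0 :: real"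
  have "?y \<in> standard_simplex n"
  proof (rule simplexI)
    have "(\<Sum>m\<le>n. ?y m) = (\<Sum>m\<in>{i, j}. ?y m)" using miss by (intro sum.mono_neutral_right) auto
    then show "(\<Sum>m\<le>n. ?y m) = 1" using ij by simp
  qed (use miss in auto)
  moreover have "?y \<notin> proj_act A1 ` standard_simplex n"
  proof
    assume y: "?y \<in> proj_act A1 ` standard_simplex n"
    have "?y = (\<lambda>m. if m = j then 2 / 5 else if m = i then 3 / 5 else 0)" using ij by auto
    with y have "(\<lambda>m. if m = j then 2 / 5 else if m = i then 3 / 5 else 0) \<in> proj_act A1 ` standard_simplex n"
      by simp
    then obtain q where "q \<ge> 1" "of_int q * (3 / 5) \<le> (2 / 5 :: real)"
      using edge_column[OF A(2) B1 miss(1,3) ij[symmetric] c(1) miss(4), of "2 / 5" "3 / 5"] by auto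
    moreover from this have "real_of_int q \<ge> 1" by simp
    ultimately show False by linarith
  qed
  ultimately have "?y \<in> proj_act A0 ` standard_simplex n" using cover by blast
  then obtain q where q: "q \<ge> 1" "has_col n A0 (\<lambda>m. if m = i then q else of_bool (m = j))"
      "of_int q * (2 / 5) \<le> (3 / 5 :: real)"
    using edge_column[OF A(1) B0 miss(3,1) ij c(2) miss(2), of "3 / 5" "2 / 5"] by auto
  have "real_of_int q < 2" using q(3) by linarith
  then have q1: "q = 1" using q(1) by linarith
  have "(\<lambda>m. if m = i then q else of_bool (m = j)) = (\<lambda>m. unit_vec i m + unit_vec j m)"
    using ij q1 by auto
  then show ?thesis using q(2) ij c by simp
qed

lemma splitting_columns:
  assumes A: "A0 \<in> Sigma_mats n" "A1 \<in> Sigma_mats n"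
    and cover: "standard_simplex n \<subseteq> proj_act A0 ` standard_simplex n \<union> proj_act A1 ` standard_simplex n"
    and miss: "j \<le> n" "\<not> has_col n A0 (unit_vec j)" "i \<le> n" "\<not> has_col n A1 (unit_vec i)"
  shows "\<exists>p. p permutes {0..n} \<and> (\<forall>m\<le>n. \<forall>k\<le>n. A0 $$ (m, k) = unit_vec (p k) m + (if p k = j then unit_vec i m else 0))"
proof -
  have cover': "standard_simplex n \<subseteq> proj_act A1 ` standard_simplex n \<union> proj_act A0 ` standard_simplex n"
    using cover by blast
  note mj = splitting_missing[OF A cover miss] splitting_missing[OF A(2,1) cover' miss(3,4,1,2)]
  obtain B1 where B1: "\<And>k l. k \<le> n \<Longrightarrow> l \<le> n \<Longrightarrow> (\<Sum>i\<le>n. B1 $$ (k, i) * A1 $$ (i, l)) = (if k = l then 1 else 0 :: int)"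
    using Sigma_mats_left_inverse[OF A(2)] by metis
  \<comment> \<open>A second missing vertex \<open>k\<close> would give \<open>A1\<close> all four
    columns \<open>e_j\<close>, \<open>e_k\<close>, \<open>e_i + e_j\<close>,
    \<open>e_i + e_k\<close>.\<close>
  have others: "has_col n A0 (unit_vec k)" if k: "k \<le> n" "k \<noteq> j" for k
  proof (rule ccontr)
    assume nk: "\<not> ?thesis"
    note mk = splitting_missing[OF A cover k(1) nk miss(3,4)] splitting_missing[OF A(2,1) cover' miss(3,4) k(1) nk]
    have "has_col n A1 (\<lambda>m. unit_vec i m + unit_vec j m)" "has_col n A1 (\<lambda>m. unit_vec i m + unit_vec k m)"
      using mj(2) mk(2) by (simp_all only: add.commute)
    then show False
      using no_parallelogram[OF A(2) B1 miss(3,1) k(1)] mj mk k(2) by blast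
  qed
  define v where "v k = (\<lambda>m. unit_vec k m + (if k = j then unit_vec i m else 0))" for k
  have "has_col n A0 (v k)" if "k \<le> n" for k
  proof (cases "k = j")
    case True
    have "v j = (\<lambda>m. unit_vec i m + unit_vec j m)" by (auto simp: v_def)
    then show ?thesis using True mj(1) by simp
  next
    case False
    then show ?thesis using others[OF that] by (simp add: v_def)
  qed
  moreover have "\<exists>m\<le>n. v k m \<noteq> v l m" if "k \<le> n" "l \<le> n" "k \<noteq> l" for k l
  proof (cases "k = j")
    case True
    then show ?thesis using that mj(1) by (intro exI[of _ j]) (auto simp: v_def)
  next
    case False
    then show ?thesis using that mj(1) miss
      by (cases "l = j") (auto simp: v_def intro!: exI[of _ "if l = j then j else k"])
  qed
  ultimately show ?thesis using columns_permutation[OF A(1), of v] unfolding v_def by blast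
qed

section \<open>Inverse branches\<close>

lemma mat_ring_inverse:
  assumes "A \<in> carrier_mat (n + 1) (n + 1)" "B \<in> carrier_mat (n + 1) (n + 1)"
    "A * B = 1\<^sub>m (n + 1)" "B * A = 1\<^sub>m (n + 1)"
  shows "A \<in> Units (mat_ring n)" "inv\<^bsub>mat_ring n\<^esub> A = B"
proof -
  interpret R: ring "mat_ring n" by (rule ring_mat)
  show "A \<in> Units (mat_ring n)"
    using assms unfolding Units_def carrier_mat_ring mult_mat_ring one_mat_ring by blast
  show "inv\<^bsub>mat_ring n\<^esub> A = B"
    using R.inv_unique'[of A B] assms unfolding carrier_mat_ring mult_mat_ring one_mat_ring by simp
qed

lemma lin_act_one:
  assumes "\<And>i. i > n \<Longrightarrow> x i = 0"
  shows "lin_act (1\<^sub>m (n + 1)) x = x"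
proof
  fix i
  have "(\<Sum>j\<le>n. real_of_int (1\<^sub>m (n + 1) $$ (i, j)) * x j) = (\<Sum>j\<le>n. if j = i then x j else 0)" if "i \<le> n"
    using that by (intro sum.cong) auto
  then show "lin_act (1\<^sub>m (n + 1)) x i = x i"
    using assms by (simp add: lin_act_eq[OF one_carrier_mat])
qed

context splitting_game
begin

text \<open>On points: coordinate \<open>u (1 - a)\<close> is subtracted from coordinate
  \<open>u a\<close>, then the coordinates are permuted.\<close>

definition branch_inv :: "nat \<Rightarrow> int mat" where
  "branch_inv a = Matrix.mat (n + 1) (n + 1)
     (\<lambda>(i, j). (if p a i = j then 1 else 0) - (if j = u (1 - a) \<and> p a i = u a then 1 else 0))"

context
  fixes a :: nat
  assumes a: "a \<in> {0, 1}"
begin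

lemma u_le: "u a \<le> n" "u (1 - a) \<le> n" "u a \<noteq> u (1 - a)"
  using a u by auto

lemma p_permutes: "p a permutes {0..n}"
  using a perm by auto

lemma branch_inv_carrier: "branch_inv a \<in> carrier_mat (n + 1) (n + 1)"
  by (simp add: branch_inv_def)

lemma branch_inv_index: "i \<le> n \<Longrightarrow> j \<le> n \<Longrightarrow> branch_inv a $$ (i, j) =
    (if p a i = j then 1 else 0) - (if j = u (1 - a) \<and> p a i = u a then 1 else 0)"
  by (simp add: branch_inv_def)

lemma branch_inv_left: "branch_inv a * branch a = 1\<^sub>m (n + 1)"
proof (rule eq_matI)
  fix i k assume "i < dim_row (1\<^sub>m (n + 1) :: int mat)" "k < dim_col (1\<^sub>m (n + 1) :: int mat)"
  then have ik: "i \<le> n" "k \<le> n" by auto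
  have pk: "p a k \<le> n" using p_le[OF a ik(2)] .
  show "(branch_inv a * branch a) $$ (i, k) = 1\<^sub>m (n + 1) $$ (i, k)"
    unfolding mult_split_mat[where u = u and a = a and q = "p a", OF branch_inv_carrier ik pk u_le(1)]
    using ik pk u_le p_inj[OF a, of i k] by (auto simp: branch_inv_index)
qed (simp_all add: branch_inv_def split_mat_def)

lemma branch_inv_right: "branch a * branch_inv a = 1\<^sub>m (n + 1)"
proof (rule eq_matI)
  fix i k assume "i < dim_row (1\<^sub>m (n + 1) :: int mat)" "k < dim_col (1\<^sub>m (n + 1) :: int mat)"
  then have ik: "i \<le> n" "k \<le> n" by auto
  define h where "h m = (if m = k then 1 else 0) - (if k = u (1 - a) \<and> m = u a then 1 else 0 :: int)" for m
  define g where "g m = (if m = i then h m else 0) + (if m = u (1 - a) then if i = u a then h m else 0 else 0)" for m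
  have "(branch a * branch_inv a) $$ (i, k) = (\<Sum>j\<le>n. g (p a j))"
    unfolding mult_index[OF split_mat_carrier branch_inv_carrier ik]
    using ik by (intro sum.cong) (auto simp: split_mat_index branch_inv_index g_def h_def)
  also have "\<dots> = (\<Sum>m\<le>n. g m)"
    using sum.permute[OF p_permutes, of g] by (simp add: atLeast0AtMost comp_def)
  also have "\<dots> = h i + (if i = u a then h (u (1 - a)) else 0)"
    using ik u_le by (simp add: g_def sum.distrib)
  also have "\<dots> = 1\<^sub>m (n + 1) $$ (i, k)"
    using ik u_le by (auto simp: h_def)
  finally show "(branch a * branch_inv a) $$ (i, k) = 1\<^sub>m (n + 1) $$ (i, k)" .
qed (simp_all add: branch_inv_def split_mat_def)

lemma branch_unit: "branch a \<in> Units (mat_ring n)" and inv_branch: "inv\<^bsub>mat_ring n\<^esub> (branch a) = branch_inv a"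
  using mat_ring_inverse[OF split_mat_carrier branch_inv_carrier branch_inv_right branch_inv_left] by auto

lemma branch_Sigma: "branch a \<in> Sigma_mats n"
  using branch_unit pos_matD(4)[OF pos_mat_branch[OF a]] by (simp add: Sigma_mats_def)

lemma branch_not_perm: "branch a \<notin> perm_mats n"
proof
  assume "branch a \<in> perm_mats n"
  then obtain h where h: "branch a = perm_mat n h" by (auto simp: perm_mats_def)
  obtain k where k: "k \<le> n" "p a k = u (1 - a)" using p_surj[OF a u_le(2)] by blast
  have "branch a $$ (u a, k) = 1" "branch a $$ (u (1 - a), k) = 1"
    using k u_le by (simp_all add: split_mat_index)
  then show False using k u_le unfolding h by (simp add: perm_mat_def split: if_splits)
qed

lemma lin_act_branch_inv:
  "i \<le> n \<Longrightarrow> lin_act (branch_inv a) x i = x (p a i) - (if p a i = u a then x (u (1 - a)) else 0)"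
proof -
  assume i: "i \<le> n"
  have "lin_act (branch_inv a) x i =
      (\<Sum>j\<le>n. (if j = p a i then x j else 0) - (if j = u (1 - a) then if p a i = u a then x j else 0 else 0))"
    unfolding lin_act_eq[OF branch_inv_carrier] using i
    by (simp, intro sum.cong) (auto simp: branch_inv_index)
  then show ?thesis using p_le[OF a i] u_le by (simp add: sum_subtractf)
qed

lemma sum_lin_act_branch_inv:
  assumes "x \<in> standard_simplex n"
  shows "(\<Sum>i\<le>n. lin_act (branch_inv a) x i) = 1 - x (u (1 - a))"
proof -
  have "(\<Sum>i\<le>n. lin_act (branch_inv a) x i) = (\<Sum>i\<le>n. (\<lambda>m. x m - (if m = u a then x (u (1 - a)) else 0)) (p a i))"
    by (intro sum.cong) (auto simp: lin_act_branch_inv)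
  also have "\<dots> = (\<Sum>m\<le>n. x m - (if m = u a then x (u (1 - a)) else 0))"
    using sum.permute[OF p_permutes, of "\<lambda>m. x m - (if m = u a then x (u (1 - a)) else 0)"]
    by (simp add: atLeast0AtMost comp_def)
  also have "\<dots> = 1 - x (u (1 - a))"
    using simplexD(4)[OF assms] u_le by (simp add: sum_subtractf)
  finally show ?thesis .
qed

lemma proj_act_branch_inv:
  assumes x: "x \<in> standard_simplex n" and le: "x (u (1 - a)) \<le> x (u a)" and i: "i \<le> n"
  shows "proj_act (branch_inv a) x i =
    (x (p a i) - (if p a i = u a then x (u (1 - a)) else 0)) / (1 - x (u (1 - a)))"
proof -
  have "lin_act (branch_inv a) x k \<ge> 0" if "k \<le> n" for k
    unfolding lin_act_branch_inv[OF that] using simplexD(1)[OF x] le by auto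
  then have "(\<Sum>k<dim_row (branch_inv a). \<bar>lin_act (branch_inv a) x k\<bar>) = (\<Sum>k\<le>n. lin_act (branch_inv a) x k)"
    using branch_inv_carrier by (intro sum.cong) (auto simp: lessThan_Suc_atMost)
  then show ?thesis unfolding proj_act_def sum_lin_act_branch_inv[OF x] lin_act_branch_inv[OF i] by simp
qed

text \<open>Membership means that the inverse branch produces no negative coordinate, and only the
  subtraction \<open>x (u a) - x (u (1 - a))\<close> could. So the hyperplane of equal active
  coordinates cuts the simplex.\<close>

lemma image_branch:
  assumes x: "x \<in> standard_simplex n"
  shows "x \<in> proj_act (branch a) ` standard_simplex n \<longleftrightarrow> x (u (1 - a)) \<le> x (u a)"
proof
  assume "x \<in> proj_act (branch a) ` standard_simplex n"
  then obtain y where y: "y \<in> standard_simplex n" and xy: "x = proj_act (branch a) y" by blast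
  define z where "z = lin_act (branch a) y"
  have "lin_act (branch_inv a) z = y"
    unfolding z_def lin_act_mult[OF branch_inv_carrier split_mat_carrier, symmetric] branch_inv_left
    using simplexD(3)[OF y] by (rule lin_act_one)
  moreover obtain k where k: "k \<le> n" "p a k = u a" using p_surj[OF a u_le(1)] by blast
  ultimately have "z (u a) - z (u (1 - a)) \<ge> 0"
    using lin_act_branch_inv[OF k(1), of z] k(2) simplexD(1)[OF y, of k] by simp
  then show "x (u (1 - a)) \<le> x (u a)"
    unfolding xy proj_act_eq[OF pos_mat_branch[OF a] y] z_def
    using sum_lin_act_ge[OF pos_mat_branch[OF a] y] by (intro divide_right_mono) auto
next
  assume le: "x (u (1 - a)) \<le> x (u a)"
  define y where "y = lin_act (branch_inv a) x"
  define S where "S = (\<Sum>i\<le>n. y i)"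
  have "x (u a) + x (u (1 - a)) \<le> 1"
  proof -
    have "(\<Sum>m\<in>{u a, u (1 - a)}. x m) \<le> (\<Sum>m\<le>n. x m)"
      using u_le simplexD(1)[OF x] by (intro sum_mono2) auto
    then show ?thesis using u_le simplexD(4)[OF x] by simp
  qed
  then have S: "S > 0" unfolding S_def y_def sum_lin_act_branch_inv[OF x] using le by linarith
  have y0: "y i \<ge> 0" for i
    unfolding y_def using lin_act_branch_inv[of i x] simplexD(1)[OF x] le
    by (cases "i \<le> n") (auto simp: lin_act_eq[OF branch_inv_carrier])
  have "(\<lambda>i. y i / S) \<in> standard_simplex n"
  proof (rule simplexI)
    show "y i / S = 0" if "i > n" for i using that by (simp add: y_def lin_act_eq[OF branch_inv_carrier])
    show "(\<Sum>i\<le>n. y i / S) = 1" unfolding sum_divide_distrib[symmetric] S_def[symmetric] using S by simp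
  qed (use y0 S in simp)
  moreover have "proj_act (branch a) (\<lambda>i. y i / S) = x"
  proof -
    have "lin_act (branch a) y = x"
      unfolding y_def lin_act_mult[OF split_mat_carrier branch_inv_carrier, symmetric] branch_inv_right
      using simplexD(3)[OF x] by (rule lin_act_one)
    moreover have "dim_row (branch a) = n + 1" by (simp add: split_mat_def)
    ultimately have "proj_act (branch a) y = x"
      unfolding proj_act_def using simplexD(1,4)[OF x] by (simp add: lessThan_Suc_atMost flip: Suc_eq_plus1)
    then show ?thesis using proj_act_scale[OF pos_mat_branch[OF a] S] by simp
  qed
  ultimately show "x \<in> proj_act (branch a) ` standard_simplex n" by (metis imageI)
qed

end

lemma branch_neq: "branch 0 \<noteq> branch 1"
proof
  assume eq: "branch 0 = branch 1"
  obtain k where k: "k \<le> n" "p 0 k = u 0" using p_surj[of 0 "u 0"] u by auto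
  have "branch 0 $$ (u 0, k) = 1" "branch 0 $$ (u 1, k) = 0"
    using k u by (auto simp: split_mat_index)
  then show False unfolding eq using k u by (auto simp: split_mat_index split: if_splits)
qed

lemma is_ifs_branch: "is_ifs n (branch 0) (branch 1)"
  using branch_Sigma branch_not_perm branch_neq by (simp add: is_ifs_def)

lemma simplex_splitting_branch: "simplex_splitting n (branch 0) (branch 1)"
  unfolding simplex_splitting_def
proof
  let ?D = "standard_simplex n"
  have sub: "proj_act (branch a) ` ?D \<subseteq> ?D" if "a \<in> {0, 1}" for a
    using proj_act_in[OF pos_mat_branch[OF that]] by blast
  have i0: "x \<in> proj_act (branch 0) ` ?D \<longleftrightarrow> x (u 1) \<le> x (u 0)"
    and i1: "x \<in> proj_act (branch 1) ` ?D \<longleftrightarrow> x (u 0) \<le> x (u 1)" if "x \<in> ?D" for x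
    using image_branch[of 0, OF _ that] image_branch[of 1, OF _ that] by auto
  show "?D = proj_act (branch 0) ` ?D \<union> proj_act (branch 1) ` ?D"
    using sub[of 0] sub[of 1] i0 i1 by (auto 0 3 intro: linear[THEN disjE])
  show "(top_of_set ?D interior_of proj_act (branch 0) ` ?D) \<inter> (top_of_set ?D interior_of proj_act (branch 1) ` ?D) = {}"
  proof (rule ccontr)
    assume "\<not> ?thesis"
    then obtain x where x: "x \<in> top_of_set ?D interior_of proj_act (branch 0) ` ?D"
      "x \<in> top_of_set ?D interior_of proj_act (branch 1) ` ?D" by blast
    have x0: "x \<in> proj_act (branch 0) ` ?D" using x(1) interior_of_subset by fastforce
    then have xD: "x \<in> ?D" using sub[of 0] by auto
    obtain T where T: "openin (top_of_set ?D) T" "x \<in> T" "T \<subseteq> proj_act (branch 1) ` ?D"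
      using x(2) unfolding interior_of_def by blast
    obtain U where U: "open U" "T = ?D \<inter> U" using T(1) by (auto simp: openin_open)
    \<comment> \<open>Moving a common interior point towards vertex \<open>u 0\<close> makes that
      coordinate strictly larger than \<open>u 1\<close>, although a small move stays in the image
      of branch 1.\<close>
    define v where "v = (\<lambda>j. if j = u 0 then 1 else 0 :: real)"
    define c where "c e = (\<lambda>i. (1 - e) * x i + e * v i)" for e
    have v: "v \<in> ?D" unfolding v_def using u by simp
    have "continuous_on UNIV c"
      unfolding c_def by (intro continuous_on_coordinatewise_then_product continuous_intros)
    then have "open (c -` U)" using U(1) by (simp add: open_vimage)
    moreover have "0 \<in> c -` U" using T(2) U(2) by (simp add: c_def)
    ultimately obtain d where d: "d > 0" "ball 0 d \<subseteq> c -` U" by (meson open_contains_ball)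
    define e where "e = min (d / 2) (1 / 2)"
    have e: "e > 0" "e < d" "e \<le> 1" using d(1) by (auto simp: e_def)
    have "e \<in> ball 0 d" using e by (simp add: dist_real_def)
    then have "c e \<in> U" using d(2) by blast
    moreover have cD: "c e \<in> ?D" unfolding c_def using convex_standard_simplex[OF xD v] e by simp
    ultimately have "c e (u 0) \<le> c e (u 1)" using T(3) U(2) i1[OF cD] by blast
    moreover have "x (u 1) \<le> x (u 0)" using x0 i0[OF xD] by blast
    ultimately have "(1 - e) * x (u 0) + e \<le> (1 - e) * x (u 0)"
      using e u(3) mult_left_mono[of "x (u 1)" "x (u 0)" "1 - e"] by (simp add: c_def v_def)
    then show False using e(1) by simp
  qed
qed

end

lemma (in standard_ifs) standard_in_contractive_splitting:
  "{branch 0, branch 1} \<in> contractive_splitting_ifs n"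
  unfolding contractive_splitting_ifs_def
  using is_ifs_branch simplex_splitting_branch contractive_standard by blast

section \<open>Conjugation by permutation matrices\<close>

lemma perm_mat_carrier [simp]: "perm_mat n h \<in> carrier_mat (n + 1) (n + 1)"
  by (simp add: perm_mat_def)

lemma perm_mat_index: "i \<le> n \<Longrightarrow> j \<le> n \<Longrightarrow> perm_mat n h $$ (i, j) = (if i = h j then 1 else 0)"
  by (simp add: perm_mat_def)

lemma mult_perm_mat:
  fixes W :: "int mat"
  assumes "W \<in> carrier_mat (n + 1) (n + 1)" "i \<le> n" "k \<le> n" "h k \<le> n"
  shows "(W * perm_mat n h) $$ (i, k) = W $$ (i, h k)"
proof -
  have "(W * perm_mat n h) $$ (i, k) = (\<Sum>j\<le>n. if j = h k then W $$ (i, j) else 0)"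
    unfolding mult_index[OF assms(1) perm_mat_carrier assms(2,3)]
    using assms by (intro sum.cong) (auto simp: perm_mat_index)
  then show ?thesis using assms(4) by simp
qed

lemma perm_mat_mult:
  fixes W :: "int mat"
  assumes "W \<in> carrier_mat (n + 1) (n + 1)" "i \<le> n" "k \<le> n" and h: "h permutes {0..n}"
  shows "(perm_mat n h * W) $$ (i, k) = W $$ (inv_into UNIV h i, k)"
proof -
  have le: "inv_into UNIV h i \<le> n" using permutes_in_image[OF permutes_inv[OF h], of i] assms(2) by simp
  have "i = h j \<longleftrightarrow> j = inv_into UNIV h i" for j using permutes_inverses[OF h] by metis
  then have "(perm_mat n h * W) $$ (i, k) = (\<Sum>j\<le>n. if j = inv_into UNIV h i then W $$ (j, k) else 0)"
    unfolding mult_index[OF perm_mat_carrier assms(1,2,3)]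
    using assms by (intro sum.cong) (auto simp: perm_mat_index)
  then show ?thesis using le by simp
qed

lemma perm_mat_inverse:
  assumes h: "h permutes {0..n}"
  shows "perm_mat n h \<in> Units (mat_ring n)"
    "inv\<^bsub>mat_ring n\<^esub> (perm_mat n h) = perm_mat n (inv_into UNIV h)"
    "perm_mat n h * perm_mat n (inv_into UNIV h) = 1\<^sub>m (n + 1)"
proof -
  let ?g = "inv_into UNIV h"
  note hg = permutes_inverses[OF h]
  have le: "h k \<le> n" "?g k \<le> n" if "k \<le> n" for k
    using permutes_in_image[OF h, of k] permutes_in_image[OF permutes_inv[OF h], of k] that by auto
  have prod: "perm_mat n h1 * perm_mat n h2 = 1\<^sub>m (n + 1)"
    if "\<And>k. k \<le> n \<Longrightarrow> h2 k \<le> n" "\<And>k. h1 (h2 k) = k" for h1 h2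
  proof (rule eq_matI)
    fix i k assume "i < dim_row (1\<^sub>m (n + 1) :: int mat)" "k < dim_col (1\<^sub>m (n + 1) :: int mat)"
    then have ik: "i \<le> n" "k \<le> n" by auto
    show "(perm_mat n h1 * perm_mat n h2) $$ (i, k) = 1\<^sub>m (n + 1) $$ (i, k)"
      unfolding mult_perm_mat[where h = h2, OF perm_mat_carrier ik that(1)[OF ik(2)]]
      using ik that by (simp add: perm_mat_index)
  qed (simp_all add: perm_mat_def)
  show 1: "perm_mat n h * perm_mat n ?g = 1\<^sub>m (n + 1)"
    by (rule prod) (use le hg in auto)
  have 2: "perm_mat n ?g * perm_mat n h = 1\<^sub>m (n + 1)"
    by (rule prod) (use le hg in auto)
  show "perm_mat n h \<in> Units (mat_ring n)" "inv\<^bsub>mat_ring n\<^esub> (perm_mat n h) = perm_mat n ?g"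
    using mat_ring_inverse[OF perm_mat_carrier perm_mat_carrier 1 2] by auto
qed

lemma conj_mat_perm:
  assumes A: "A \<in> carrier_mat (n + 1) (n + 1)" and h: "h permutes {0..n}"
  shows "conj_mat n (perm_mat n h) A \<in> carrier_mat (n + 1) (n + 1)"
    "\<And>i k. i \<le> n \<Longrightarrow> k \<le> n \<Longrightarrow> conj_mat n (perm_mat n h) A $$ (i, k) = A $$ (inv_into UNIV h i, inv_into UNIV h k)"
proof -
  have le: "inv_into UNIV h k \<le> n" if "k \<le> n" for k
    using permutes_in_image[OF permutes_inv[OF h], of k] that by simp
  have c: "perm_mat n h * A \<in> carrier_mat (n + 1) (n + 1)" using perm_mat_carrier A by (rule mult_carrier_mat)
  show "conj_mat n (perm_mat n h) A \<in> carrier_mat (n + 1) (n + 1)"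
    unfolding conj_mat_def perm_mat_inverse(2)[OF h] using c perm_mat_carrier by (rule mult_carrier_mat)
  show "conj_mat n (perm_mat n h) A $$ (i, k) = A $$ (inv_into UNIV h i, inv_into UNIV h k)"
    if "i \<le> n" "k \<le> n" for i k
    unfolding conj_mat_def perm_mat_inverse(2)[OF h] mult_perm_mat[where h = "inv_into UNIV h", OF c that le[OF that(2)]]
    using perm_mat_mult[OF A that(1) le[OF that(2)] h] .
qed

lemma conj_mat_compose:
  assumes A: "A \<in> carrier_mat (n + 1) (n + 1)" and g: "g permutes {0..n}" and h: "h permutes {0..n}"
  shows "conj_mat n (perm_mat n h) (conj_mat n (perm_mat n g) A) = conj_mat n (perm_mat n (h \<circ> g)) A"
proof -
  note cg = conj_mat_perm[OF A g]
  note ch = conj_mat_perm[OF cg(1) h]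
  note chg = conj_mat_perm[OF A permutes_compose[OF g h]]
  have inv: "inv_into UNIV (h \<circ> g) = inv_into UNIV g \<circ> inv_into UNIV h"
    using permutes_bij[OF g] permutes_bij[OF h] by (rule o_inv_distrib[OF _ _, rotated])
  have le: "inv_into UNIV h k \<le> n" if "k \<le> n" for k
    using permutes_in_image[OF permutes_inv[OF h], of k] that by simp
  show ?thesis
    using carrier_matD[OF chg(1)] carrier_matD[OF ch(1)]
    by (intro eq_matI) (auto simp: ch(2) cg(2) chg(2) le inv less_Suc_eq_le)
qed

lemma conj_mat_id:
  assumes A: "A \<in> carrier_mat (n + 1) (n + 1)"
  shows "conj_mat n (perm_mat n id) A = A"
  using conj_mat_perm[OF A permutes_id] carrier_matD[OF A]
  by (intro eq_matI) (auto simp: less_Suc_eq_le carrier_matD[OF conj_mat_perm(1)[OF A permutes_id]] inv_id)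

lemma ifs_orbit_conj:
  assumes S: "S \<subseteq> carrier_mat (n + 1) (n + 1)" and g: "g permutes {0..n}"
  shows "ifs_orbit n (conj_mat n (perm_mat n g) ` S) = ifs_orbit n S"
proof -
  have c: "conj_mat n (perm_mat n h) ` conj_mat n (perm_mat n g) ` S = conj_mat n (perm_mat n (h \<circ> g)) ` S"
    if "h permutes {0..n}" for h
    unfolding image_image using conj_mat_compose[OF _ g that] S by (intro image_cong) auto
  have orb: "ifs_orbit n T = (\<lambda>h. conj_mat n (perm_mat n h) ` T) ` {h. h permutes {0..n}}" for T
    by (auto simp: ifs_orbit_def perm_mats_def)
  let ?H = "{h. h permutes {0..n}}"
  have H: "?H = (\<lambda>h. h \<circ> g) ` ?H"
  proof (intro equalityI subsetI)
    fix h assume "h \<in> ?H"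
    then have mem: "h \<circ> inv_into UNIV g \<in> ?H" using permutes_compose[OF permutes_inv[OF g]] by simp
    have "h = (h \<circ> inv_into UNIV g) \<circ> g" using permutes_inv_o(2)[OF g] by (simp add: comp_assoc)
    then show "h \<in> (\<lambda>h. h \<circ> g) ` ?H" using mem by (rule image_eqI)
  next
    fix h assume "h \<in> (\<lambda>h. h \<circ> g) ` ?H"
    then show "h \<in> ?H" using permutes_compose[OF g] by blast
  qed
  have "ifs_orbit n S = (\<lambda>h. conj_mat n (perm_mat n h) ` S) ` (\<lambda>h. h \<circ> g) ` ?H"
    unfolding orb using H by (rule arg_cong)
  also have "\<dots> = (\<lambda>h. conj_mat n (perm_mat n (h \<circ> g)) ` S) ` ?H"
    by (simp only: image_image)
  also have "\<dots> = ifs_orbit n (conj_mat n (perm_mat n g) ` S)"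
    unfolding orb by (rule image_cong[OF refl]) (use c in simp)
  finally show ?thesis by simp
qed

section \<open>The Gauss map\<close>

text \<open>Both branches share this formula, as it is symmetric in \<open>x 0\<close> and
  \<open>x 1\<close>. They can differ only in where \<open>f\<close> sends the coordinates, which
  decides continuity.\<close>

definition gauss_coord :: "nat \<Rightarrow> (nat \<Rightarrow> real) \<Rightarrow> nat \<Rightarrow> real" where
  "gauss_coord n x k = (if k = 0 then \<bar>x 0 - x 1\<bar> else if k = n then min (x 0) (x 1) else x (k + 1)) /
     (1 - min (x 0) (x 1))"

context standard_ifs
begin

abbreviation gauss :: "(nat \<Rightarrow> real) \<Rightarrow> nat \<Rightarrow> real" where
  "gauss \<equiv> gauss_map n (branch 0) (branch 1)"

lemma gauss_index_eq:
  assumes "x \<in> standard_simplex n"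
  shows "gauss_index n (branch 0) (branch 1) x = (if x 1 \<le> x 0 then 0 else 1)"
proof -
  have i: "x \<in> proj_act (branch_mat (branch 0) (branch 1) a) ` standard_simplex n \<longleftrightarrow> x (1 - a) \<le> x a"
    if "a \<in> {0, 1}" for a
    unfolding branch_mat_eq[OF that] using image_branch[OF that assms] by simp
  show ?thesis
  proof (cases "x 1 \<le> x 0")
    case True
    then have "gauss_index n (branch 0) (branch 1) x = 0"
      unfolding gauss_index_def using i[of 0] by (intro Least_eq_0) simp
    then show ?thesis using True by simp
  next
    case False
    then have "gauss_index n (branch 0) (branch 1) x = 1"
      unfolding gauss_index_def using i[of 0] i[of 1]
      by (intro Least_equality) (auto simp del: image_iff)
    then show ?thesis using False by simp
  qed
qed

lemma min_le_half: "x \<in> standard_simplex n \<Longrightarrow> min (x 0) (x 1) \<le> 1 / 2"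
proof -
  assume x: "x \<in> standard_simplex n"
  have "(\<Sum>m\<in>{0, 1}. x m) \<le> (\<Sum>m\<le>n. x m)"
    using n simplexD(1)[OF x] by (intro sum_mono2) auto
  then have "x 0 + x 1 \<le> 1" using simplexD(4)[OF x] by simp
  then show ?thesis by linarith
qed

lemma gauss_map_eq:
  assumes x: "x \<in> standard_simplex n" and i: "i \<le> n"
  shows "gauss x i = gauss_coord n x (f (if x 1 \<le> x 0 then 0 else 1) i)"
proof -
  define a where "a = (if x 1 \<le> x 0 then 0 else 1 :: nat)"
  have a: "a \<in> {0, 1}" and le: "x (1 - a) \<le> x a" by (auto simp: a_def)
  have m: "min (x 0) (x 1) = x (1 - a)" "\<bar>x 0 - x 1\<bar> = x a - x (1 - a)" by (auto simp: a_def)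
  have "gauss x i =
      (x (q a i) - (if q a i = a then x (1 - a) else 0)) / (1 - x (1 - a))"
    unfolding gauss_map_def gauss_index_eq[OF x] a_def[symmetric] branch_mat_eq[OF a] inv_branch[OF a]
    using proj_act_branch_inv[OF a x _ i] le by simp
  also have "\<dots> = gauss_coord n x (f a i)"
  proof -
    have fi: "f a i \<le> n" using f[of a] i n by (auto simp: flip_def)
    have a1: "1 - a \<noteq> a" using a by auto
    consider "f a i = 0" | "f a i = n" "f a i \<noteq> 0" | "0 < f a i" "f a i < n" using fi by linarith
    then show ?thesis
    proof cases
      case 1
      then have "q a i = a" using a n by (auto simp: q_def std_perm_def)
      then show ?thesis using 1 by (simp add: gauss_coord_def m)
    next
      case 2
      then have "q a i = 1 - a" using a n by (auto simp: q_def std_perm_def)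
      then show ?thesis using 2 a1 by (simp add: gauss_coord_def m)
    next
      case 3
      then have "q a i = f a i + 1" using a by (auto simp: q_def std_perm_def)
      moreover have "f a i + 1 \<noteq> a" using 3 a by auto
      ultimately show ?thesis using 3 by (simp add: gauss_coord_def m)
    qed
  qed
  finally show ?thesis unfolding a_def .
qed

lemma gauss_map_beyond:
  assumes x: "x \<in> standard_simplex n" and i: "i > n"
  shows "gauss x i = 0"
proof -
  define a where "a = (if x 1 \<le> x 0 then 0 else 1 :: nat)"
  have a: "a \<in> {0, 1}" by (auto simp: a_def)
  show ?thesis
    unfolding gauss_map_def gauss_index_eq[OF x] a_def[symmetric] branch_mat_eq[OF a] inv_branch[OF a]
    using i by (simp add: proj_act_def lin_act_eq[OF branch_inv_carrier[OF a]])
qed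

lemma continuous_gauss_map:
  assumes "f 0 = f 1"
  shows "continuous_on (standard_simplex n) gauss"
proof (rule continuous_on_coordinatewise_then_product)
  fix i
  have c: "continuous_on (standard_simplex n) (\<lambda>x. x k)" for k
    by (rule continuous_on_subset[OF continuous_on_product_coordinates]) simp
  show "continuous_on (standard_simplex n) (\<lambda>x. gauss x i)"
  proof (cases "i \<le> n")
    case True
    have "continuous_on (standard_simplex n) (\<lambda>x. gauss_coord n x (f 0 i))"
      unfolding gauss_coord_def
    proof (intro continuous_on_divide ballI)
      show "1 - min (x 0) (x 1) \<noteq> 0" if "x \<in> standard_simplex n" for x
        using min_le_half[OF that] by linarith
      show "continuous_on (standard_simplex n)
          (\<lambda>x. if f 0 i = 0 then \<bar>x 0 - x 1\<bar> else if f 0 i = n then min (x 0) (x 1) else x (f 0 i + 1))"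
      proof -
        have "continuous_on (standard_simplex n) (\<lambda>x. \<bar>x 0 - x 1\<bar>)"
          "continuous_on (standard_simplex n) (\<lambda>x. min (x 0) (x 1))"
          "continuous_on (standard_simplex n) (\<lambda>x. x (f 0 i + 1))"
          by (intro continuous_intros c)+
        then show ?thesis by (cases "f 0 i = 0"; cases "f 0 i = n") simp_all
      qed
    qed (intro continuous_intros c)
    then show ?thesis
      by (rule continuous_on_eq) (use assms True in \<open>simp add: gauss_map_eq\<close>)
  next
    case False
    have "continuous_on (standard_simplex n) (\<lambda>x. 0 :: real)" by simp
    then show ?thesis by (rule continuous_on_eq) (use False in \<open>simp add: gauss_map_beyond\<close>)
  qed
qed

lemma discontinuous_gauss_map:
  assumes "f 0 \<noteq> f 1"
  shows "\<not> continuous_on (standard_simplex n) gauss"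
proof
  assume cont: "continuous_on (standard_simplex n) gauss"
  define b where "b k = (if k \<le> n then 1 / (n + 1) else 0 :: real)" for k :: nat
  \<comment> \<open>At the barycenter the tie selects index 0; any move towards vertex 1 selects
    index 1.\<close>
  define v where "v = (\<lambda>j :: nat. if j = 1 then 1 else 0 :: real)"
  define e where "e m = 1 / (real m + 2)" for m :: nat
  define c where "c m = (\<lambda>i. (1 - e m) * b i + e m * v i)" for m
  define i where "i = f 0 0"
  have i: "i \<le> n" "f 0 i = 0" "f 1 i = 1"
    using assms f[of 0] f[of 1] n by (auto simp: i_def flip_def)
  have e: "0 < e m" "e m \<le> 1 / 2" for m by (auto simp: e_def field_simps)
  \<comment> \<open>at the barycenter the two branches disagree\<close>
  have bD: "b \<in> standard_simplex n" by (rule simplexI) (auto simp: b_def)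
  have vD: "v \<in> standard_simplex n" unfolding v_def using n by simp
  have cD: "c m \<in> standard_simplex n" for m
    unfolding c_def using convex_standard_simplex[OF bD vD] e[of m] by simp
  have "(\<lambda>m. 1 / real (m + 2)) \<longlonglongrightarrow> 0"
    by (rule LIMSEQ_ignore_initial_segment[OF lim_inverse_n'])
  moreover have "e = (\<lambda>m. 1 / real (m + 2))" by (rule ext) (simp add: e_def)
  ultimately have e0: "e \<longlonglongrightarrow> 0" by simp
  define path where "path s = (\<lambda>k. (1 - s) * b k + s * v k)" for s
  have "continuous_on {0..1 / 2} path"
    unfolding path_def by (intro continuous_on_coordinatewise_then_product continuous_intros)
  moreover have "path ` {0..1 / 2} \<subseteq> standard_simplex n"
    unfolding path_def using convex_standard_simplex[OF bD vD] by auto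
  ultimately have "continuous_on {0..1 / 2} (\<lambda>s. gauss (path s))"
    by (rule continuous_on_compose2[OF cont])
  then have "continuous_on {0..1 / 2} (\<lambda>s. gauss (path s) i)"
    by (rule continuous_on_product_then_coordinatewise)
  then have "(\<lambda>m. gauss (path (e m)) i) \<longlonglongrightarrow> gauss (path 0) i"
    by (rule continuous_on_tendsto_compose[OF _ e0]) (use e less_imp_le[OF e(1)] in auto)
  moreover have "path 0 = b" "path (e m) = c m" for m by (auto simp: path_def c_def)
  ultimately have lim: "(\<lambda>m. gauss (c m) i) \<longlonglongrightarrow> gauss b i"
    by simp
  have b01: "b 0 = 1 / (n + 1)" "b 1 = 1 / (n + 1)" using n by (auto simp: b_def)
  have "gauss b i = 0"
    unfolding gauss_map_eq[OF bD i(1)] by (simp add: b01 i gauss_coord_def)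
  moreover have "gauss (c m) i \<ge> 1 / (2 * (real n + 1))" for m
  proof -
    define t where "t = (1 - e m) * (1 / (real n + 1))"
    have c0: "c m 0 = t" and c1: "c m 1 = t + e m" using b01 by (auto simp: c_def v_def t_def add.commute)
    have ck: "c m (1 + 1) = t" if "n \<noteq> 1" using that n by (auto simp: c_def v_def t_def b_def add.commute)
    have m0: "min (c m 0) (c m 1) = t" unfolding c0 c1 using e(1)[of m] by simp
    have "\<not> c m 1 \<le> c m 0" unfolding c0 c1 using e(1)[of m] by simp
    then have "gauss (c m) i = gauss_coord n (c m) 1"
      unfolding gauss_map_eq[OF cD i(1)] by (simp add: i)
    also have "\<dots> = t / (1 - t)" unfolding gauss_coord_def m0 using ck by auto
    finally have g: "gauss (c m) i = t / (1 - t)" .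
    have "1 / 2 * (1 / (real n + 1)) \<le> t" unfolding t_def using e(2)[of m] by (intro mult_right_mono) auto
    then have t: "1 / (2 * (real n + 1)) \<le> t" by simp
    have t0: "t > 0" using t by (smt (verit) divide_pos_pos of_nat_0_le_iff)
    have "t \<le> 1 / 2" using min_le_half[OF cD, of m] m0 by simp
    then have "t \<le> t / (1 - t)" using t0 by (simp add: field_simps)
    then show ?thesis unfolding g using t by linarith
  qed
  ultimately have "1 / (2 * (real n + 1)) \<le> 0"
    using LIMSEQ_le_const[OF lim, of "1 / (2 * (real n + 1))"] by metis
  moreover have "1 / (2 * (real n + 1)) > 0" by simp
  ultimately show False by linarith
qed

end

section \<open>Determinants\<close>

lemma det_perm_mat:
  assumes h: "h permutes {0..n}"
  shows "Determinant.det (perm_mat n h) = sign h"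
proof -
  let ?g = "inv_into UNIV h"
  have perm: "{0..n} = {0..<n + 1}" by auto
  have g: "?g permutes {0..<n + 1}" using permutes_inv[OF h] unfolding perm .
  have le: "?g i \<le> n" if "i \<le> n" for i using permutes_in_image[OF permutes_inv[OF h], of i] that by simp
  have iff: "i = h j \<longleftrightarrow> ?g i = j" for i j using permutes_inverses[OF h] by metis
  have "perm_mat n h = Matrix.mat (n + 1) (n + 1) (\<lambda>(i, j). 1\<^sub>m (n + 1) $$ (?g i, j))"
  proof (rule eq_matI)
    fix i j assume "i < dim_row (Matrix.mat (n + 1) (n + 1) (\<lambda>(i, j). 1\<^sub>m (n + 1) $$ (?g i, j)) :: int mat)"
      "j < dim_col (Matrix.mat (n + 1) (n + 1) (\<lambda>(i, j). 1\<^sub>m (n + 1) $$ (?g i, j)) :: int mat)"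
    then have ij: "i < n + 1" "j < n + 1" by auto
    then have "?g i < n + 1" using le[of i] by linarith
    then show "perm_mat n h $$ (i, j) = Matrix.mat (n + 1) (n + 1) (\<lambda>(i, j). 1\<^sub>m (n + 1) $$ (?g i, j)) $$ (i, j)"
      using ij by (simp add: perm_mat_def iff)
  qed (simp_all add: perm_mat_def)
  then have "Determinant.det (perm_mat n h) = of_int (sign ?g) * Determinant.det (1\<^sub>m (n + 1) :: int mat)"
    using det_permute_rows[OF one_carrier_mat g, where ?'a = int] by simp
  also have "\<dots> = sign h"
    using sign_inverse[OF permutation_permutes[THEN iffD2, OF exI[of _ "{0..n}"]], of h] h by auto
  finally show ?thesis .
qed

lemma perm_mat_cong: "(\<And>k. k \<le> n \<Longrightarrow> g k = h k) \<Longrightarrow> perm_mat n g = perm_mat n h"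
  by (intro eq_matI) (auto simp: perm_mat_def less_Suc_eq_le)

lemma flip_eq_transpose: "flip = Transposition.transpose 0 1"
  by (auto simp: flip_def Transposition.transpose_def fun_eq_iff)

lemma F_mat_eq: "F_mat n = perm_mat n flip"
  unfolding F_mat_def by (rule perm_mat_cong) (simp add: flip_def)

lemma det_F_mat:
  assumes "n \<ge> 1"
  shows "Determinant.det (F_mat n) = -1"
  unfolding F_mat_eq det_perm_mat[OF flip_permutes[OF assms]] by (simp add: flip_eq_transpose sign_swap_id)

lemma std_perm_one_step: "std_perm (Suc n) 1 = Transposition.transpose 0 (Suc n) \<circ> std_perm n 1"
  by (auto simp: std_perm_def Transposition.transpose_def fun_eq_iff)

lemma std_perm_one: "std_perm n 1 permutes {0..n} \<and> sign (std_perm n 1) = (-1) ^ n"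
proof (induction n)
  case 0
  have "std_perm 0 1 = id" by (auto simp: std_perm_def)
  then show ?case by (simp only: permutes_id sign_id power_0)
next
  case (Suc n)
  have t: "Transposition.transpose 0 (Suc n) permutes {0..Suc n}" by (rule permutes_swap_id) auto
  have s: "std_perm n 1 permutes {0..Suc n}" using Suc by (auto intro: permutes_subset)
  have p: "permutation (Transposition.transpose 0 (Suc n))" "permutation (std_perm n 1)"
    using t s permutation_permutes by blast+
  show ?case unfolding std_perm_one_step sign_compose[OF p] using permutes_compose[OF s t] Suc
    by (simp only: sign_swap_id) simp
qed

lemma R_mat_eq: "R_mat n = perm_mat n (std_perm n 1)"
  unfolding R_mat_def by (rule perm_mat_cong) (auto simp: std_perm_def)

lemma det_R_mat: "Determinant.det (R_mat n) = (-1) ^ n"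
  unfolding R_mat_eq using det_perm_mat std_perm_one by metis

lemma N_mat_carrier: "N_mat n \<in> carrier_mat (n + 1) (n + 1)"
  by (simp add: N_mat_def)

lemma N_mat_index: "i \<le> n \<Longrightarrow> j \<le> n \<Longrightarrow> N_mat n $$ (i, j) = (if i = j \<or> i = 0 \<and> j = 1 then 1 else 0)"
  by (simp add: N_mat_def)

lemma det_N_mat: "Determinant.det (N_mat n) = 1"
proof -
  have "Determinant.det (N_mat n) = prod_list (diag_mat (N_mat n))"
    by (rule det_upper_triangular[OF _ N_mat_carrier]) (auto simp: N_mat_def)
  also have "diag_mat (N_mat n) = replicate (n + 1) 1"
    by (rule nth_equalityI) (auto simp: diag_mat_def N_mat_def)
  finally show ?thesis by simp
qed

lemma FR_carrier: "F_mat n \<in> carrier_mat (n + 1) (n + 1)" "R_mat n \<in> carrier_mat (n + 1) (n + 1)"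
  by (simp_all add: F_mat_eq R_mat_eq)

lemma L_mat_carrier: "L_mat n \<in> carrier_mat (n + 1) (n + 1)"
  unfolding L_mat_def
  by (rule mult_carrier_mat[OF mult_carrier_mat[OF FR_carrier(1) N_mat_carrier] FR_carrier(1)])

lemma M_carrier: "M0 n \<in> carrier_mat (n + 1) (n + 1)" "M1 n \<in> carrier_mat (n + 1) (n + 1)"
  unfolding M0_def M1_def
  by (rule mult_carrier_mat[OF mult_carrier_mat[OF N_mat_carrier FR_carrier(1)] FR_carrier(2)],
      rule mult_carrier_mat[OF L_mat_carrier FR_carrier(2)])

lemma det_mult': "A \<in> carrier_mat m m \<Longrightarrow> B \<in> carrier_mat m m \<Longrightarrow>
    Determinant.det (A * B) = Determinant.det A * Determinant.det (B :: int mat)"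
  by (rule det_mult)

lemma det_M:
  assumes "n \<ge> 1"
  shows "Determinant.det (M0 n) = - ((-1) ^ n)" "Determinant.det (M1 n) = (-1) ^ n"
    "Determinant.det (M0 n * F_mat n) = (-1) ^ n" "Determinant.det (M1 n * F_mat n) = - ((-1) ^ n)"
proof -
  note c = N_mat_carrier[of n] FR_carrier[of n] L_mat_carrier[of n] M_carrier[of n]
  show 0: "Determinant.det (M0 n) = - ((-1) ^ n)"
    unfolding M0_def using det_mult'[OF mult_carrier_mat[OF c(1,2)] c(3)] det_mult'[OF c(1,2)]
    by (simp add: det_N_mat det_F_mat[OF assms] det_R_mat)
  have "Determinant.det (L_mat n) = 1"
    unfolding L_mat_def using det_mult'[OF mult_carrier_mat[OF c(2,1)] c(2)] det_mult'[OF c(2,1)]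
    by (simp add: det_N_mat det_F_mat[OF assms])
  then show 1: "Determinant.det (M1 n) = (-1) ^ n"
    unfolding M1_def using det_mult'[OF c(4,3)] by (simp add: det_R_mat)
  show "Determinant.det (M0 n * F_mat n) = (-1) ^ n" "Determinant.det (M1 n * F_mat n) = - ((-1) ^ n)"
    using det_mult'[OF c(5,2)] det_mult'[OF c(6,2)] 0 1 by (simp_all add: det_F_mat[OF assms])
qed

lemma det_conj_mat:
  assumes A: "A \<in> carrier_mat (n + 1) (n + 1)" and h: "h permutes {0..n}"
  shows "Determinant.det (conj_mat n (perm_mat n h) A) = Determinant.det A"
proof -
  let ?P = "perm_mat n h" and ?Q = "perm_mat n (inv_into UNIV h)"
  have c: "?P \<in> carrier_mat (n + 1) (n + 1)" "?Q \<in> carrier_mat (n + 1) (n + 1)" by simp_all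
  have "Determinant.det ?P * Determinant.det ?Q = 1"
    using det_mult'[OF c] perm_mat_inverse(3)[OF h] by simp
  then show ?thesis
    unfolding conj_mat_def perm_mat_inverse(2)[OF h]
    using det_mult'[OF mult_carrier_mat[OF c(1) A] c(2)] det_mult'[OF c(1) A] by (simp add: algebra_simps)
qed

lemma det_inv_Sigma:
  assumes A: "A \<in> Sigma_mats n" and d: "Determinant.det A = 1 \<or> Determinant.det A = -1"
  shows "Determinant.det (inv\<^bsub>mat_ring n\<^esub> A) = Determinant.det A"
proof -
  interpret R: ring "mat_ring n" by (rule ring_mat)
  have U: "A \<in> Units (mat_ring n)" using A by (simp add: Sigma_mats_def)
  have "A * inv\<^bsub>mat_ring n\<^esub> A = 1\<^sub>m (n + 1)"
    using R.Units_r_inv[OF U] unfolding mult_mat_ring one_mat_ring .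
  moreover have "inv\<^bsub>mat_ring n\<^esub> A \<in> carrier_mat (n + 1) (n + 1)"
    using R.Units_inv_closed[OF U] unfolding carrier_mat_ring .
  ultimately have "Determinant.det A * Determinant.det (inv\<^bsub>mat_ring n\<^esub> A) = 1"
    using det_mult'[OF Sigma_matsD(1)[OF A]] by (metis det_one)
  then show ?thesis using d by auto
qed

section \<open>The classification\<close>

abbreviation std_mat :: "nat \<Rightarrow> nat \<Rightarrow> (nat \<Rightarrow> nat) \<Rightarrow> int mat" where
  "std_mat n a f \<equiv> split_mat n id a (\<lambda>k. std_perm n a (f k))"

lemma std_perm_le: "n \<ge> 1 \<Longrightarrow> k \<le> n \<Longrightarrow> std_perm n a k \<le> n"
  by (auto simp: std_perm_def)

lemma flip_le: "n \<ge> 1 \<Longrightarrow> k \<le> n \<Longrightarrow> flip k \<le> n"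
  by (auto simp: flip_def)

lemma flip_std_perm: "n \<ge> 1 \<Longrightarrow> k \<le> n \<Longrightarrow> a \<in> {0, 1} \<Longrightarrow> flip (std_perm n a k) = std_perm n (1 - a) k"
  by (auto simp: flip_def std_perm_def)

lemma M_eq:
  assumes n: "n \<ge> 1"
  shows "M0 n = std_mat n 0 id" "M1 n = std_mat n 1 id"
    "M0 n * F_mat n = std_mat n 0 flip" "M1 n * F_mat n = std_mat n 1 flip"
proof -
  note c = N_mat_carrier[of n] FR_carrier[of n] L_mat_carrier[of n] M_carrier[of n]
  have F: "(W * F_mat n) $$ (i, k) = W $$ (i, flip k)"
    if "W \<in> carrier_mat (n + 1) (n + 1)" "i \<le> n" "k \<le> n" for W :: "int mat" and i k
    unfolding F_mat_eq using mult_perm_mat[where h = flip, OF that flip_le[OF n that(3)]] .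
  have R: "(W * R_mat n) $$ (i, k) = W $$ (i, std_perm n 1 k)"
    if "W \<in> carrier_mat (n + 1) (n + 1)" "i \<le> n" "k \<le> n" for W :: "int mat" and i k
    unfolding R_mat_eq using mult_perm_mat[where h = "std_perm n 1", OF that std_perm_le[OF n that(3)]] .
  have FN: "(F_mat n * N_mat n) $$ (i, k) = N_mat n $$ (flip i, k)" if "i \<le> n" "k \<le> n" for i k
    unfolding F_mat_eq using perm_mat_mult[OF c(1) that flip_permutes[OF n]] by (simp add: inv_flip)
  have M0i: "M0 n $$ (i, k) = std_mat n 0 id $$ (i, k)" if "i \<le> n" "k \<le> n" for i k
    unfolding M0_def R[OF mult_carrier_mat[OF c(1,2)] that] F[OF c(1) that(1) std_perm_le[OF n that(2)]]
    using that n flip_std_perm[OF n that(2), of 1] std_perm_le[OF n that(2), of 0]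
    by (auto simp: N_mat_index split_mat_index)
  have M1i: "M1 n $$ (i, k) = std_mat n 1 id $$ (i, k)" if "i \<le> n" "k \<le> n" for i k
  proof -
    have s: "std_perm n 1 k \<le> n" by (rule std_perm_le[OF n that(2)])
    have "M1 n $$ (i, k) = N_mat n $$ (flip i, flip (std_perm n 1 k))"
      unfolding M1_def R[OF c(4) that] unfolding L_mat_def
      unfolding F[OF mult_carrier_mat[OF c(2,1)] that(1) s] FN[OF that(1) flip_le[OF n s]] ..
    moreover have "flip i = flip j \<longleftrightarrow> i = j" "flip i = 0 \<longleftrightarrow> i = 1" "flip j = 1 \<longleftrightarrow> j = 0" for i j
      by (auto simp: flip_def split: if_splits)
    ultimately show ?thesis
      using that s n by (auto simp: N_mat_index flip_le split_mat_index)
  qed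
  show 0: "M0 n = std_mat n 0 id"
    using carrier_matD[OF c(5)] carrier_matD[OF split_mat_carrier] M0i by (intro eq_matI) (auto simp: less_Suc_eq_le)
  show 1: "M1 n = std_mat n 1 id"
    using carrier_matD[OF c(6)] carrier_matD[OF split_mat_carrier] M1i by (intro eq_matI) (auto simp: less_Suc_eq_le)
  have "(M0 n * F_mat n) $$ (i, k) = std_mat n 0 flip $$ (i, k)" "(M1 n * F_mat n) $$ (i, k) = std_mat n 1 flip $$ (i, k)"
    if "i \<le> n" "k \<le> n" for i k
    using F[OF c(5) that] F[OF c(6) that] that flip_le[OF n that(2)] unfolding 0 1 by (simp_all add: split_mat_index)
  then show "M0 n * F_mat n = std_mat n 0 flip" "M1 n * F_mat n = std_mat n 1 flip"
    using carrier_matD[OF mult_carrier_mat[OF c(5,2)]] carrier_matD[OF mult_carrier_mat[OF c(6,2)]]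
      carrier_matD[OF split_mat_carrier] by (auto intro!: eq_matI simp: less_Suc_eq_le)
qed

text \<open>Conjugation by \<open>F_mat n\<close> exchanges the labels and adds a flip. Of the four
  pairs \<open>(f0, f1)\<close> it identifies \<open>(id, id)\<close> with
  \<open>(flip, flip)\<close>, whereas each mixed pair is mapped to itself.\<close>

lemma conj_F_mat:
  assumes n: "n \<ge> 1" and a: "a \<in> {0, 1}"
  shows "conj_mat n (F_mat n) (std_mat n a id) = std_mat n (1 - a) flip"
proof -
  note c = conj_mat_perm[OF split_mat_carrier[of n id a "\<lambda>k. std_perm n a (id k)"] flip_permutes[OF n]]
  have "conj_mat n (perm_mat n flip) (std_mat n a id) $$ (i, k) = std_mat n (1 - a) flip $$ (i, k)"
    if "i \<le> n" "k \<le> n" for i k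
  proof -
    let ?s = "std_perm n a (flip k)"
    have fs: "flip ?s = std_perm n (1 - a) (flip k)" using flip_std_perm[OF n flip_le[OF n that(2)] a] .
    have swap: "flip x = y \<longleftrightarrow> x = flip y" for x y using flip_flip by metis
    have fa: "flip a = 1 - a" "flip (1 - a) = a" "1 - (1 - a) = a" using a by (auto simp: flip_def)
    have lhs: "std_mat n a id $$ (flip i, flip k) = (if flip i = ?s then 1 else 0) + (if ?s = 1 - a \<and> flip i = a then 1 else 0)"
      by (simp only: split_mat_index[OF flip_le[OF n that(1)] flip_le[OF n that(2)]] id_apply)
    have rhs: "std_mat n (1 - a) flip $$ (i, k) = (if i = flip ?s then 1 else 0) + (if flip ?s = a \<and> i = 1 - a then 1 else 0)"
      by (simp only: split_mat_index[OF that] id_apply fs fa(3))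
    have "?s = 1 - a \<longleftrightarrow> flip ?s = a" "flip i = a \<longleftrightarrow> i = 1 - a" "flip i = ?s \<longleftrightarrow> i = flip ?s"
      using swap fa by metis+
    then show ?thesis unfolding c(2)[OF that] inv_flip lhs rhs by simp
  qed
  then show ?thesis
    unfolding F_mat_eq using carrier_matD[OF c(1)] carrier_matD[OF split_mat_carrier]
    by (intro eq_matI) (auto simp: less_Suc_eq_le)
qed

lemma std_mats:
  assumes n: "n \<ge> 1" and f: "f0 \<in> {id, flip}" "f1 \<in> {id, flip}"
  shows "{std_mat n 0 f0, std_mat n 1 f1} \<in> contractive_splitting_ifs n"
    "std_mat n 0 f0 \<in> Sigma_mats n" "std_mat n 1 f1 \<in> Sigma_mats n"
    "f0 = f1 \<Longrightarrow> continuous_on (standard_simplex n) (gauss_map n (std_mat n 0 f0) (std_mat n 1 f1))"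
    "f0 \<noteq> f1 \<Longrightarrow> \<not> continuous_on (standard_simplex n) (gauss_map n (std_mat n 0 f0) (std_mat n 1 f1))"
proof -
  define f where "f a = (if a = 0 then f0 else f1)" for a :: nat
  interpret S: standard_ifs n f
    using n f by unfold_locales (auto simp: f_def)
  have b: "S.branch 0 = std_mat n 0 f0" "S.branch 1 = std_mat n 1 f1"
    by (simp_all add: S.q_def f_def)
  show "{std_mat n 0 f0, std_mat n 1 f1} \<in> contractive_splitting_ifs n"
    using S.standard_in_contractive_splitting unfolding b .
  show "std_mat n 0 f0 \<in> Sigma_mats n" "std_mat n 1 f1 \<in> Sigma_mats n"
    using S.branch_Sigma[of 0] S.branch_Sigma[of 1] unfolding b by auto
  show "continuous_on (standard_simplex n) (gauss_map n (std_mat n 0 f0) (std_mat n 1 f1))" if "f0 = f1"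
    using S.continuous_gauss_map that unfolding b by (simp add: f_def)
  show "\<not> continuous_on (standard_simplex n) (gauss_map n (std_mat n 0 f0) (std_mat n 1 f1))" if "f0 \<noteq> f1"
    using S.discontinuous_gauss_map that unfolding b by (simp add: f_def)
qed

lemma conj_split_mat:
  assumes g: "g permutes {0..n}" "g 0 = u 0" "g 1 = u 1" and n: "n \<ge> 1" and a: "a \<in> {0, 1}"
    and p: "\<And>k. k \<le> n \<Longrightarrow> (inv_into UNIV g \<circ> p \<circ> g) k = s k"
  shows "conj_mat n (perm_mat n (inv_into UNIV g)) (split_mat n u a p) = split_mat n id a s"
proof -
  note gi = permutes_inv[OF g(1)]
  note c = conj_mat_perm[OF split_mat_carrier[of n u a p] gi]
  have ii: "inv_into UNIV (inv_into UNIV g) = g" using permutes_inv_inv[OF g(1)] .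
  have le: "g k \<le> n" if "k \<le> n" for k using permutes_in_image[OF g(1), of k] that by simp
  have inj: "g x = g y \<longleftrightarrow> x = y" for x y using permutes_inj[OF g(1)] by (simp add: inj_eq)
  have ga: "u a = g a" "u (1 - a) = g (1 - a)" using a g by auto
  have "conj_mat n (perm_mat n (inv_into UNIV g)) (split_mat n u a p) $$ (i, k) = split_mat n id a s $$ (i, k)"
    if "i \<le> n" "k \<le> n" for i k
  proof -
    have "p (g k) = g (s k)" using p[OF that(2)] permutes_inverses(1)[OF g(1)] by (metis comp_apply)
    then show ?thesis
      unfolding c(2)[OF that] ii using that le by (simp add: split_mat_index ga inj)
  qed
  then show ?thesis
    using carrier_matD[OF c(1)] carrier_matD[OF split_mat_carrier]
    by (intro eq_matI) (auto simp: less_Suc_eq_le)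
qed

lemma classification:
  assumes n: "n \<ge> 1" and A: "is_ifs n A0 A1" "simplex_splitting n A0 A1" "contractive n A0 A1"
  shows "\<exists>g f0 f1. g permutes {0..n} \<and> f0 \<in> {id, flip} \<and> f1 \<in> {id, flip} \<and>
    conj_mat n (perm_mat n g) ` {A0, A1} = {std_mat n 0 f0, std_mat n 1 f1}"
proof -
  have S: "A0 \<in> Sigma_mats n" "A1 \<in> Sigma_mats n" "A0 \<notin> perm_mats n" "A1 \<notin> perm_mats n"
    using A(1) by (auto simp: is_ifs_def)
  have cover: "standard_simplex n \<subseteq> proj_act A0 ` standard_simplex n \<union> proj_act A1 ` standard_simplex n"
    "standard_simplex n \<subseteq> proj_act A1 ` standard_simplex n \<union> proj_act A0 ` standard_simplex n"
    using A(2) unfolding simplex_splitting_def by blast+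
  obtain j where j: "j \<le> n" "\<not> has_col n A0 (unit_vec j)" using not_perm_mat_missing[OF S(1,3)] by blast
  obtain i where i: "i \<le> n" "\<not> has_col n A1 (unit_vec i)" using not_perm_mat_missing[OF S(2,4)] by blast
  have ij: "i \<noteq> j" using splitting_missing[OF S(1,2) cover(1) j i] by blast
  obtain p0 where p0: "p0 permutes {0..n}"
    "\<forall>m\<le>n. \<forall>k\<le>n. A0 $$ (m, k) = unit_vec (p0 k) m + (if p0 k = j then unit_vec i m else 0)"
    using splitting_columns[OF S(1,2) cover(1) j i] by blast
  obtain p1 where p1: "p1 permutes {0..n}"
    "\<forall>m\<le>n. \<forall>k\<le>n. A1 $$ (m, k) = unit_vec (p1 k) m + (if p1 k = i then unit_vec j m else 0)"
    using splitting_columns[OF S(2,1) cover(2) i j] by blast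
  \<comment> \<open>\<open>A0\<close> misses vertex \<open>j\<close>, so label 0 keeps column
    \<open>i\<close> and replaces \<open>j\<close>.\<close>
  define u where "u a = (if a = 0 then i else j)" for a :: nat
  define p where "p a = (if a = 0 then p0 else p1)" for a :: nat
  interpret splitting_game n u p
    using p0 p1 i j ij by unfold_locales (auto simp: u_def p_def)
  have b: "A0 = branch 0" "A1 = branch 1"
    using carrier_matD[OF Sigma_matsD(1)[OF S(1)]] carrier_matD[OF Sigma_matsD(1)[OF S(2)]] p0(2) p1(2)
      carrier_matD[OF split_mat_carrier]
    by (auto intro!: eq_matI simp: split_mat_index u_def p_def less_Suc_eq_le)
  interpret contractive_game n u p
    using contractive_imp_uniformly A(3) unfolding b by unfold_locales
  obtain g where g: "g permutes {0..n}" "g 0 = u 0" "g 1 = u 1"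
    and fs: "\<forall>a\<in>{0, 1}. \<exists>f\<in>{id, flip}. \<forall>k\<le>n. (inv_into UNIV g \<circ> p a \<circ> g) k = std_perm n a (f k)"
    using relabelled_maps by blast
  obtain f0 where f0: "f0 \<in> {id, flip}" "\<And>k. k \<le> n \<Longrightarrow> (inv_into UNIV g \<circ> p 0 \<circ> g) k = std_perm n 0 (f0 k)"
    using fs by blast
  obtain f1 where f1: "f1 \<in> {id, flip}" "\<And>k. k \<le> n \<Longrightarrow> (inv_into UNIV g \<circ> p 1 \<circ> g) k = std_perm n 1 (f1 k)"
    using fs by blast
  have "conj_mat n (perm_mat n (inv_into UNIV g)) A0 = std_mat n 0 f0"
    "conj_mat n (perm_mat n (inv_into UNIV g)) A1 = std_mat n 1 f1"
    unfolding b using conj_split_mat[where u = u, OF g n _ f0(2)] conj_split_mat[where u = u, OF g n _ f1(2)] by auto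
  then have "conj_mat n (perm_mat n (inv_into UNIV g)) ` {A0, A1} = {std_mat n 0 f0, std_mat n 1 f1}" by simp
  then show ?thesis using permutes_inv[OF g(1)] f0(1) f1(1) by blast
qed

text \<open>The set of determinants is an invariant of the orbit; it is what tells the three
  algorithms apart.\<close>

lemma ifs_orbit_det:
  assumes "S \<subseteq> carrier_mat (n + 1) (n + 1)" "T \<subseteq> carrier_mat (n + 1) (n + 1)" "ifs_orbit n S = ifs_orbit n T"
  shows "Determinant.det ` S = Determinant.det ` T"
proof -
  have "conj_mat n (perm_mat n id) ` T = T" using conj_mat_id assms(2) by (auto simp: subset_iff image_iff)
  then have "T \<in> ifs_orbit n T" unfolding ifs_orbit_def perm_mats_def using permutes_id by blast
  then have "T \<in> ifs_orbit n S" unfolding assms(3) .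
  then obtain h where h: "h permutes {0..n}" "T = conj_mat n (perm_mat n h) ` S"
    unfolding ifs_orbit_def perm_mats_def by blast
  show ?thesis unfolding h(2) image_image using det_conj_mat[OF _ h(1)] assms(1) by (intro image_cong) auto
qed

theorem theorem2p1:
  fixes n :: nat
  assumes "n \<ge> 1"
  shows
    "{{M0 n, M1 n}, {M0 n, M1 n * F_mat n}, {M0 n * F_mat n, M1 n}}
       \<subseteq> contractive_splitting_ifs n
     \<and> ifs_orbit n ` contractive_splitting_ifs n =
         {ifs_orbit n {M0 n, M1 n},
          ifs_orbit n {M0 n, M1 n * F_mat n},
          ifs_orbit n {M0 n * F_mat n, M1 n}}
     \<and> card (ifs_orbit n ` contractive_splitting_ifs n) = 3
     \<and> continuous_on (standard_simplex n) (gauss_map n (M0 n) (M1 n))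
     \<and> \<not> continuous_on (standard_simplex n) (gauss_map n (M0 n) (M1 n * F_mat n))
     \<and> \<not> continuous_on (standard_simplex n) (gauss_map n (M0 n * F_mat n) (M1 n))
     \<and> (odd n \<longrightarrow> orientation_preserving_on n (M0 n) (M1 n) 0
                \<and> orientation_reversing_on n (M0 n) (M1 n) 1)
     \<and> (even n \<longrightarrow> orientation_reversing_on n (M0 n) (M1 n) 0
                 \<and> orientation_preserving_on n (M0 n) (M1 n) 1)
     \<and> ifs_orbit n {conj_mat n (F_mat n) (M1 n), conj_mat n (F_mat n) (M0 n)} =
         ifs_orbit n {M0 n, M1 n}
     \<and> (odd n \<longrightarrow>
          orientation_reversing_on n (conj_mat n (F_mat n) (M1 n)) (conj_mat n (F_mat n) (M0 n)) 0
        \<and> orientation_preserving_on n (conj_mat n (F_mat n) (M1 n)) (conj_mat n (F_mat n) (M0 n)) 1)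
     \<and> (even n \<longrightarrow>
          orientation_preserving_on n (conj_mat n (F_mat n) (M1 n)) (conj_mat n (F_mat n) (M0 n)) 0
        \<and> orientation_reversing_on n (conj_mat n (F_mat n) (M1 n)) (conj_mat n (F_mat n) (M0 n)) 1)
     \<and> (odd n \<longrightarrow> orientation_preserving n (M0 n) (M1 n * F_mat n))
     \<and> (even n \<longrightarrow> orientation_reversing n (M0 n) (M1 n * F_mat n))
     \<and> (odd n \<longrightarrow> orientation_reversing n (M0 n * F_mat n) (M1 n))
     \<and> (even n \<longrightarrow> orientation_preserving n (M0 n * F_mat n) (M1 n))"
proof -
  note n = assms
  note M = M_eq[OF n]
  let ?S1 = "{M0 n, M1 n}" and ?S2 = "{M0 n, M1 n * F_mat n}" and ?S3 = "{M0 n * F_mat n, M1 n}"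
  let ?S4 = "{M0 n * F_mat n, M1 n * F_mat n}"
  let ?C = "contractive_splitting_ifs n"
  have mem: "?S1 \<in> ?C" "?S2 \<in> ?C" "?S3 \<in> ?C"
    unfolding M(3,4) unfolding M(1,2)
    using std_mats(1)[OF n, where ?f0.0 = id and ?f1.0 = id] std_mats(1)[OF n, where ?f0.0 = id and ?f1.0 = flip]
      std_mats(1)[OF n, where ?f0.0 = flip and ?f1.0 = id] by simp_all
  have cF: "conj_mat n (F_mat n) (M0 n) = M1 n * F_mat n" "conj_mat n (F_mat n) (M1 n) = M0 n * F_mat n"
    unfolding M(3,4) unfolding M(1,2) using conj_F_mat[OF n, of 0] conj_F_mat[OF n, of 1] by simp_all
  have Sig: "M0 n \<in> Sigma_mats n" "M1 n \<in> Sigma_mats n" "M0 n * F_mat n \<in> Sigma_mats n" "M1 n * F_mat n \<in> Sigma_mats n"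
    unfolding M(3,4) unfolding M(1,2)
    using std_mats(2,3)[OF n, where ?f0.0 = id and ?f1.0 = id] std_mats(2,3)[OF n, where ?f0.0 = flip and ?f1.0 = flip] by simp_all
  note car = Sigma_matsD(1)[OF Sig(1)] Sigma_matsD(1)[OF Sig(2)] Sigma_matsD(1)[OF Sig(3)] Sigma_matsD(1)[OF Sig(4)]
  have S4: "ifs_orbit n ?S4 = ifs_orbit n ?S1"
  proof -
    have "?S4 = conj_mat n (perm_mat n flip) ` ?S1" using cF unfolding F_mat_eq by auto
    then show ?thesis using ifs_orbit_conj[OF _ flip_permutes[OF n], of ?S1] car by auto
  qed
  have orbit: "ifs_orbit n S \<in> {ifs_orbit n ?S1, ifs_orbit n ?S2, ifs_orbit n ?S3}" if "S \<in> ?C" for S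
  proof -
    obtain A0 A1 where A: "S = {A0, A1}" "is_ifs n A0 A1" "simplex_splitting n A0 A1" "contractive n A0 A1"
      using \<open>S \<in> ?C\<close> unfolding contractive_splitting_ifs_def by blast
    obtain g f0 f1 where g: "g permutes {0..n}" and f: "f0 \<in> {id, flip}" "f1 \<in> {id, flip}"
      and eq: "conj_mat n (perm_mat n g) ` S = {std_mat n 0 f0, std_mat n 1 f1}"
      using classification[OF n A(2-4)] unfolding A(1) by blast
    have "S \<subseteq> carrier_mat (n + 1) (n + 1)" using A(1,2) Sigma_matsD(1) by (auto simp: is_ifs_def)
    then have "ifs_orbit n S = ifs_orbit n {std_mat n 0 f0, std_mat n 1 f1}"
      using ifs_orbit_conj[OF _ g] eq by metis
    then show ?thesis using f S4 unfolding M(3,4) unfolding M(1,2) by auto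
  qed
  have image: "ifs_orbit n ` ?C = {ifs_orbit n ?S1, ifs_orbit n ?S2, ifs_orbit n ?S3}"
    using orbit mem by blast
  note D = det_M[OF n]
  have dets: "Determinant.det ` ?S1 = {-1, 1}" "Determinant.det ` ?S2 = {- ((-1) ^ n)}" "Determinant.det ` ?S3 = {(-1) ^ n}"
    using D by (cases "even n"; auto)+
  have "ifs_orbit n ?S1 \<noteq> ifs_orbit n ?S2" "ifs_orbit n ?S1 \<noteq> ifs_orbit n ?S3" "ifs_orbit n ?S2 \<noteq> ifs_orbit n ?S3"
    using ifs_orbit_det[of ?S1 n ?S2] ifs_orbit_det[of ?S1 n ?S3] ifs_orbit_det[of ?S2 n ?S3] car dets
    by (auto simp: doubleton_eq_iff)
  then have card: "card (ifs_orbit n ` ?C) = 3" unfolding image by simp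
  have cont: "continuous_on (standard_simplex n) (gauss_map n (M0 n) (M1 n))"
    "\<not> continuous_on (standard_simplex n) (gauss_map n (M0 n) (M1 n * F_mat n))"
    "\<not> continuous_on (standard_simplex n) (gauss_map n (M0 n * F_mat n) (M1 n))"
  proof -
    have ne: "id \<noteq> flip"
    proof
      assume "id = flip"
      then have "id 0 = flip 0" by simp
      then show False by (simp add: flip_def)
    qed
    show "continuous_on (standard_simplex n) (gauss_map n (M0 n) (M1 n))"
      unfolding M(1,2) using std_mats(4)[OF n, where ?f0.0 = id and ?f1.0 = id] by simp
    show "\<not> continuous_on (standard_simplex n) (gauss_map n (M0 n) (M1 n * F_mat n))"
      "\<not> continuous_on (standard_simplex n) (gauss_map n (M0 n * F_mat n) (M1 n))"
      unfolding M(3,4) unfolding M(1,2)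
      using std_mats(5)[OF n, where ?f0.0 = id and ?f1.0 = flip] std_mats(5)[OF n, where ?f0.0 = flip and ?f1.0 = id] ne by simp_all
  qed
  have orb: "ifs_orbit n {conj_mat n (F_mat n) (M1 n), conj_mat n (F_mat n) (M0 n)} = ifs_orbit n ?S1"
    unfolding cF by (rule S4)
  have detinv: "Determinant.det (inv\<^bsub>mat_ring n\<^esub> (M0 n)) = - ((-1) ^ n)"
    "Determinant.det (inv\<^bsub>mat_ring n\<^esub> (M1 n)) = (-1) ^ n"
    "Determinant.det (inv\<^bsub>mat_ring n\<^esub> (M0 n * F_mat n)) = (-1) ^ n"
    "Determinant.det (inv\<^bsub>mat_ring n\<^esub> (M1 n * F_mat n)) = - ((-1) ^ n)"
    using det_inv_Sigma[OF Sig(1)] det_inv_Sigma[OF Sig(2)] det_inv_Sigma[OF Sig(3)] det_inv_Sigma[OF Sig(4)] D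
    by (cases "even n"; simp)+
  note orient = orientation_preserving_on_def orientation_reversing_on_def
    orientation_preserving_def orientation_reversing_def branch_mat_def
  show ?thesis
    unfolding image[symmetric] cF
    using mem card cont orb[unfolded cF] detinv by (simp add: orient)
qed

end
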